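(* Let $p\le q$ be positive integers with $\gcd(p,q)=1$. Then for all sufficiently large integers $n$ (depending on $p,q$), $$M(p,q,n)\;\ge\; n^2-2rn+r^2-1,$$ where $r$ is the integer with $0\le r\le p+q-1$ and $r\equiv n \pmod{p+q}$.
   Context: Consider planar systems $$\dot x=px+P(x,y),\qquad \dot y=-qy+Q(x,y),$$ where $P,Q$ are real or complex polynomials of degree $n$ without constant and linear terms (not necessarily homogeneous), and $p\le q$ are positive integers with $\gcd(p,q)=1$ (a $p:-q$ resonant saddle at the origin). There is a formal change of coordinates $X=x+\text{h.o.t.}$, $Y=y+\text{h.o.t.}$ (h.o.t. = higher-order terms) bringing the system to the formal normal form $$\dot X=pX\Bigl(1+\sum_{k\ge1}\pi_{1,k}(X^qY^p)^k\Bigr),\qquad \dot Y=-qY\Bigl(1+\sum_{k\ge1}\pi_{2,k}(X^qY^p)^k\Bigr).$$ The quantity $\pi_k=\pi_{1,k}-\pi_{2,k}$ is the $k$-th saddle value, also denoted $L_k$. The saddle order of the system is the minimal $k$ with $L_k\ne0$ (it does not depend on the choice of the change of coordinates). The system is integrable (the origin is a generalized center) if and only if all $L_k$ vanish, in which case the saddle order is not defined. $M(p,q,n)$ denotes the maximal possible saddle order among the (non-integrable) systems of the form $\dot x=px+P(x,y)$, $\dot y=-qy+Q(x,y)$ with $P,Q$ polynomials of degree $n$ without constant and linear terms (not necessarily homogeneous); equivalently, it is the minimal number $M$ such that, for every such system, $L_k=0$ for all $k\le M$ implies $L_k=0$ for all $k>M$. It is finite by Hilbert's Basis Theorem. The base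 field may be $\mathbb R$ or $\mathbb C$; the result is asserted in both cases. *)

theory Defs
  imports Complex_Main
    "HOL-Computational_Algebra.Computational_Algebra"
    "HOL-Library.Extended_Nat"
begin

text \<open>
  A bivariate formal power series \<open>F(x, y)\<close> is a power series in the outer variable \<open>y\<close> whose
  coefficients are power series in the inner variable \<open>x\<close>: the coefficient of \<open>x\<^sup>i y\<^sup>j\<close>
  is \<open>F $ j $ i\<close>. Bivariate polynomials (type \<open>'a poly poly\<close>) follow the same convention.
\<close>

type_synonym 'a fps2 = "'a fps fps"

definition var_x :: "'a::field_char_0 fps2" where
  "var_x = fps_const fps_X"

definition var_y :: "'a::field_char_0 fps2" where
  "var_y = fps_X"

definition deriv_x :: "'a::field_char_0 fps2 \<Rightarrow> 'a fps2" where
  "deriv_x F = Abs_fps (\<lambda>j. fps_deriv (F $ j))"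

definition deriv_y :: "'a::field_char_0 fps2 \<Rightarrow> 'a fps2" where
  "deriv_y F = fps_deriv F"

definition fps2_of_poly :: "'a::field_char_0 poly poly \<Rightarrow> 'a fps2" where
  "fps2_of_poly P = fps_of_poly (map_poly fps_of_poly P)"

text \<open>
  Polynomials of total degree at most \<open>n\<close> without constant and linear terms.
\<close>

definition nonlinear_poly :: "nat \<Rightarrow> 'a::field_char_0 poly poly \<Rightarrow> bool" where
  "nonlinear_poly n P \<longleftrightarrow>
     (\<forall>i j. coeff (coeff P j) i \<noteq> 0 \<longrightarrow> 2 \<le> i + j \<and> i + j \<le> n)"

text \<open>
  The formal sum of \<open>c k * W ^ k\<close> over all \<open>k \<ge> 1\<close>, for \<open>W\<close> without constant term. Then
  \<open>W ^ k\<close> has only terms of total degree at least \<open>k\<close>, so that \<open>k > i + j\<close> does not contribute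
  to the coefficient of \<open>x\<^sup>i y\<^sup>j\<close>. (\<open>fps_compose\<close> is not applicable: it would require
  \<open>W $ 0 = 0\<close>, that is, divisibility of \<open>W\<close> by \<open>y\<close>.)
\<close>

definition series_in :: "(nat \<Rightarrow> 'a::field_char_0) \<Rightarrow> 'a fps2 \<Rightarrow> 'a fps2" where
  "series_in c W = Abs_fps (\<lambda>j. Abs_fps (\<lambda>i. \<Sum>k = 1..i + j. c k * (W ^ k) $ j $ i))"

text \<open>
  \<open>X = x + h.o.t.\<close>, \<open>Y = y + h.o.t.\<close>
\<close>

definition formal_coordinate_change :: "'a::field_char_0 fps2 \<Rightarrow> 'a fps2 \<Rightarrow> bool" where
  "formal_coordinate_change X Y \<longleftrightarrow>
     (\<forall>i j. i + j \<le> 1 \<longrightarrow> X $ j $ i = var_x $ j $ i \<and> Y $ j $ i = var_y $ j $ i)"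

text \<open>
  The derivative of \<open>F\<close> along the solutions of \<open>x' = p x + P(x, y)\<close>, \<open>y' = - q y + Q(x, y)\<close>.
\<close>

definition dot ::
  "nat \<Rightarrow> nat \<Rightarrow> 'a::field_char_0 poly poly \<Rightarrow> 'a poly poly \<Rightarrow> 'a fps2 \<Rightarrow> 'a fps2" where
  "dot p q P Q F =
     deriv_x F * (of_nat p * var_x + fps2_of_poly P) +
     deriv_y F * (- of_nat q * var_y + fps2_of_poly Q)"

definition brings_to_normal_form ::
  "nat \<Rightarrow> nat \<Rightarrow> 'a::field_char_0 poly poly \<Rightarrow> 'a poly poly \<Rightarrow> 'a fps2 \<Rightarrow> 'a fps2 \<Rightarrow>
     (nat \<Rightarrow> 'a) \<Rightarrow> (nat \<Rightarrow> 'a) \<Rightarrow> bool" where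
  "brings_to_normal_form p q P Q X Y \<pi>\<^sub>1 \<pi>\<^sub>2 \<longleftrightarrow>
     formal_coordinate_change X Y \<and>
     dot p q P Q X = of_nat p * X * (1 + series_in \<pi>\<^sub>1 (X ^ q * Y ^ p)) \<and>
     dot p q P Q Y = - of_nat q * Y * (1 + series_in \<pi>\<^sub>2 (X ^ q * Y ^ p))"

text \<open>
  The saddle values \<open>L k\<close> (for \<open>k \<ge> 1\<close>) depend on the choice of the coordinate change, so
  they are given by a relation; the first index with \<open>L k \<noteq> 0\<close> does not depend on it.
\<close>

definition saddle_values ::
  "nat \<Rightarrow> nat \<Rightarrow> 'a::field_char_0 poly poly \<Rightarrow> 'a poly poly \<Rightarrow> (nat \<Rightarrow> 'a) \<Rightarrow> bool" where
  "saddle_values p q P Q L \<longleftrightarrow>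
     (\<exists>X Y \<pi>\<^sub>1 \<pi>\<^sub>2. brings_to_normal_form p q P Q X Y \<pi>\<^sub>1 \<pi>\<^sub>2 \<and>
        (\<forall>k\<ge>1. L k = \<pi>\<^sub>1 k - \<pi>\<^sub>2 k))"

definition has_saddle_order ::
  "nat \<Rightarrow> nat \<Rightarrow> 'a::field_char_0 poly poly \<Rightarrow> 'a poly poly \<Rightarrow> nat \<Rightarrow> bool" where
  "has_saddle_order p q P Q k \<longleftrightarrow>
     (\<exists>L. saddle_values p q P Q L \<and> 1 \<le> k \<and> L k \<noteq> 0 \<and> (\<forall>j. 1 \<le> j \<and> j < k \<longrightarrow> L j = 0))"

text \<open>
  The base field is the type \<open>'a\<close>. The supremum is taken in \<^typ>\<open>enat\<close> so that the definition
  does not presuppose that the saddle orders are bounded; they are, by Hilbert's basis theorem,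
  so that it is a maximum.
\<close>

definition max_saddle_order :: "'a::field_char_0 itself \<Rightarrow> nat \<Rightarrow> nat \<Rightarrow> nat \<Rightarrow> enat" where
  "max_saddle_order _ p q n =
     Sup {enat k | k (P :: 'a poly poly) Q.
            nonlinear_poly n P \<and> nonlinear_poly n Q \<and> has_saddle_order p q P Q k}"

end

theory Submission
  imports Defs
begin

text \<open>
  It suffices to treat degrees \<open>n\<close> divisible by \<open>c = p + q\<close>, with bound \<open>n\<^sup>2 - 1\<close>. For homogeneous
  nonlinearities of degree \<open>n\<close> and \<open>d = n - 1\<close>, which is then coprime to \<open>c\<close>, only the saddle values
  \<open>L\<^bsub>dj\<^esub>\<close> can be nonzero, so that only \<open>n\<close> conditions \<open>L\<^bsub>dj\<^esub> = 0\<close>, \<open>1 \<le> j \<le> n\<close>, have to be met in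
  order to reach \<open>L\<^bsub>d(n+1)\<^esub>\<close>, where \<open>d (n + 1) = n\<^sup>2 - 1\<close>. In the variables \<open>\<rho> = x\<^bsup>d\<^esup>\<close>, \<open>u = y / x\<close> such
  a system reads \<open>\<rho>' = d \<rho> (p + \<rho> f(u))\<close>, \<open>u' = - c u + \<rho> h(u)\<close>. For \<open>h = 0\<close> it is a Bernoulli
  equation, hence integrable. Choosing \<open>f\<close> so that the first integral involves \<open>F(u) = (1 + u)\<^bsup>n-2\<^esup>\<close>, the
  derivative of the \<open>j\<close>-th obstruction in the direction \<open>h\<close> is a combination of the coefficients of
  \<open>F\<^bsup>cj-1\<^esup>\<close>, that is, of binomial coefficients. On a subspace of dimension \<open>n + 1\<close> these \<open>n + 1\<close> linear forms
  are independent, so that by the inverse function theorem there is a small \<open>h\<close> for which the first \<open>n\<close>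
  obstructions vanish but the last one does not.
\<close>

section \<open>Total order of bivariate power series\<close>

text \<open>The normalising coordinates are never computed: they are only shown to exist, and the
  saddle order is read off from any series H = (x^q y^p)^M + ... whose derivative starts with a
  nonzero multiple of (x^q y^p)^(K+M); it is then K. Here M = d, since \<rho>^c u^(pd) = (x^q
  y^p)^d, so that the obstruction belonging to L_(dj) carries the index k = j + 1, and the one for k
  = 1 is void.

  The polynomial h + u f of the second equation must have degree at most n. Still, h may have degree
  n + 1, with f cancelling the excess; this is free to first order, because changing f alone leaves
  a Bernoulli equation. Thus h has n + 2 coefficients, one more than there are obstructions, and
  that of u is dropped.

  The exponent n - 2 of F turns the binomial coefficients, up to nonzero factors, into products of
  falling factorials of p d j + 1 and (q d - c) j + 2. As q d - c is -c modulo d and d is coprime to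
  c, the factors that could spoil independence do not vanish.\<close>

definition ord_ge :: "nat \<Rightarrow> 'a::field_char_0 fps2 \<Rightarrow> bool" where
  "ord_ge d F \<longleftrightarrow> (\<forall>i j. i + j < d \<longrightarrow> F $ j $ i = 0)"

lemma ord_geD: "ord_ge d F \<Longrightarrow> i + j < d \<Longrightarrow> F $ j $ i = 0"
  by (simp add: ord_ge_def)

lemma ord_ge_0 [simp]: "ord_ge 0 F"
  by (simp add: ord_ge_def)

lemma ord_ge_zero [simp]: "ord_ge d 0"
  by (simp add: ord_ge_def)

lemma ord_ge_mono: "ord_ge d F \<Longrightarrow> d' \<le> d \<Longrightarrow> ord_ge d' F"
  by (simp add: ord_ge_def)

lemma ord_ge_add: "ord_ge d F \<Longrightarrow> ord_ge d G \<Longrightarrow> ord_ge d (F + G)"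
  by (simp add: ord_ge_def)

lemma ord_ge_diff: "ord_ge d F \<Longrightarrow> ord_ge d G \<Longrightarrow> ord_ge d (F - G)"
  by (simp add: ord_ge_def)

lemma ord_ge_minus_iff: "ord_ge d (F - G) \<longleftrightarrow> ord_ge d (G - F)"
  by (auto simp: ord_ge_def)

lemma ord_ge_diff_trans: "ord_ge d (F - G) \<Longrightarrow> ord_ge d (G - H) \<Longrightarrow> ord_ge d (F - H)"
  by (auto simp add: ord_ge_def)

lemma fps2_mult_nth:
  fixes F G :: "'a::field_char_0 fps2"
  shows "(F * G) $ j $ i = (\<Sum>j'=0..j. \<Sum>i'=0..i. F $ j' $ i' * G $ (j - j') $ (i - i'))"
  by (simp add: fps_mult_nth fps_sum_nth)

lemma ord_ge_mult:
  assumes "ord_ge a F" "ord_ge b G"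
  shows "ord_ge (a + b) (F * G)"
  unfolding ord_ge_def
proof (intro allI impI)
  fix i j assume ij: "i + j < a + b"
  have "F $ j' $ i' * G $ (j - j') $ (i - i') = 0" if "j' \<le> j" "i' \<le> i" for i' j'
  proof (cases "i' + j' < a")
    case True
    then show ?thesis using assms(1) by (simp add: ord_ge_def)
  next
    case False
    then have "(i - i') + (j - j') < b" using ij that by linarith
    then show ?thesis using assms(2) by (simp add: ord_ge_def)
  qed
  then show "(F * G) $ j $ i = 0"
    unfolding fps2_mult_nth by (intro sum.neutral ballI) simp
qed

lemma ord_ge_mult_left: "ord_ge a F \<Longrightarrow> ord_ge a (G * F)"
  using ord_ge_mult[of 0 G a F] by simp

lemma ord_ge_power: "ord_ge a F \<Longrightarrow> ord_ge (a * k) (F ^ k)"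
  by (induction k) (simp_all add: ord_ge_mult)

lemma ord_ge_Suc_eq0:
  assumes "ord_ge d F" "\<And>i j. i + j = d \<Longrightarrow> F $ j $ i = 0"
  shows "ord_ge (Suc d) F"
  using assms by (auto simp: ord_ge_def less_Suc_eq)

text \<open>Precision is counted relative to the order of a factor: if both factors are known up to
  \<open>r\<close> degrees beyond their order, so is the product.\<close>

lemma ord_ge_mult_diff:
  assumes "ord_ge a F" "ord_ge (a + r) (F - F')" "ord_ge b G'" "ord_ge (b + r) (G - G')"
  shows "ord_ge (a + b + r) (F * G - F' * G')"
proof -
  have "F * G - F' * G' = F * (G - G') + (F - F') * G'"
    by (simp add: algebra_simps)
  moreover have "ord_ge (a + b + r) (F * (G - G'))"
    using ord_ge_mult[OF assms(1,4)] by (simp add: add.assoc)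
  moreover have "ord_ge (a + b + r) ((F - F') * G')"
    using ord_ge_mult[OF assms(2,3)] by (simp add: ac_simps)
  ultimately show ?thesis by (simp add: ord_ge_add)
qed

lemma ord_ge_power_diff:
  assumes "ord_ge a F" "ord_ge (a + r) (F - F')" "ord_ge a F'"
  shows "ord_ge (a * k + r) (F ^ k - F' ^ k)"
proof (induction k)
  case (Suc k)
  have "ord_ge (a + a * k + r) (F * F ^ k - F' * F' ^ k)"
    by (rule ord_ge_mult_diff[OF assms(1,2) ord_ge_power[OF assms(3)] Suc])
  then show ?case by simp
qed simp

lemma fps2_const_mult_nth [simp]:
  "(fps_const (fps_const c) * F) $ j $ i = c * F $ j $ i" for F :: "'a::field_char_0 fps2"
  by simp

lemma of_nat_fps2: "(of_nat k :: 'a::field_char_0 fps2) = fps_const (fps_const (of_nat k))"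
  by (simp add: fps_of_nat)

lemma of_nat_fps2_mult_nth [simp]: "(of_nat k * F) $ j $ i = of_nat k * F $ j $ i"
  for F :: "'a::field_char_0 fps2"
  by (simp only: of_nat_fps2 fps2_const_mult_nth)

lemma fps_one_nth: "(1 :: 'a::field_char_0 fps2) $ j $ i = (if i = 0 \<and> j = 0 then 1 else 0)"
  by simp

section \<open>Monomials, partial derivatives and the derivation along the system\<close>

definition mono2 :: "nat \<Rightarrow> nat \<Rightarrow> 'a::field_char_0 fps2" where
  "mono2 i j = var_x ^ i * var_y ^ j"

lemma mono2_mult_nth:
  "(mono2 a b * F) $ j $ i = (if a \<le> i \<and> b \<le> j then F $ (j - b) $ (i - a) else 0)"
  for F :: "'a::field_char_0 fps2"
proof -
  have "mono2 a b * F = fps_const (fps_X ^ a) * (fps_X ^ b * F)"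
    by (simp add: mono2_def var_x_def var_y_def fps_const_power mult.assoc)
  also have "\<dots> $ j = fps_X ^ a * (if j < b then 0 else F $ (j - b))"
    by (simp add: fps_X_power_mult_nth)
  finally show ?thesis by (auto simp: fps_X_power_mult_nth)
qed

lemma mono2_nth: "(mono2 a b :: 'a::field_char_0 fps2) $ j $ i = (if i = a \<and> j = b then 1 else 0)"
  using mono2_mult_nth[of a b 1 j i] by (auto simp: fps_one_nth)

lemma mono2_mult: "mono2 a b * mono2 a' b' = mono2 (a + a') (b + b')"
  by (simp add: mono2_def power_add mult_ac)

lemma mono2_power: "mono2 a b ^ k = mono2 (a * k) (b * k)"
  by (simp add: mono2_def power_mult_distrib power_mult)

lemma ord_ge_mono2: "ord_ge (a + b) (mono2 a b)"
  by (auto simp: ord_ge_def mono2_nth)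

lemma var_x_eq: "var_x = mono2 1 0" and var_y_eq: "var_y = mono2 0 1"
  by (simp_all add: mono2_def)

lemma deriv_x_nth: "deriv_x F $ j $ i = of_nat (i + 1) * F $ j $ (i + 1)"
  by (simp add: deriv_x_def)

lemma deriv_y_nth: "deriv_y F $ j $ i = of_nat (j + 1) * F $ (j + 1) $ i"
  by (simp add: deriv_y_def fps_of_nat[symmetric] del: of_nat_Suc fps_of_nat)

lemma deriv_x_mult: "deriv_x (F * G) = deriv_x F * G + F * deriv_x G"
  by (rule fps_ext) (simp add: deriv_x_def fps_mult_nth fps_deriv_sum sum.distrib add.commute)

lemma deriv_y_mult: "deriv_y (F * G) = deriv_y F * G + F * deriv_y G"
  by (simp add: deriv_y_def)

lemma deriv_x_diff: "deriv_x (F - G) = deriv_x F - deriv_x G"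
  by (rule fps_ext) (simp add: deriv_x_def)

lemma ord_ge_deriv_x: "ord_ge (Suc d) F \<Longrightarrow> ord_ge d (deriv_x F)"
  by (simp add: ord_ge_def deriv_x_nth)

lemma ord_ge_deriv_y: "ord_ge (Suc d) F \<Longrightarrow> ord_ge d (deriv_y F)"
  by (simp add: ord_ge_def deriv_y_nth del: of_nat_Suc)

lemma dot_mult: "dot p q P Q (F * G) = dot p q P Q F * G + F * dot p q P Q G"
  by (simp add: dot_def deriv_x_mult deriv_y_mult algebra_simps)

lemma dot_diff: "dot p q P Q (F - G) = dot p q P Q F - dot p q P Q G"
  by (simp add: dot_def deriv_x_diff deriv_y_def algebra_simps)

lemma dot_const: "dot p q P Q (fps_const (fps_const a)) = 0"
proof -
  have "deriv_x (fps_const (fps_const a)) = 0" by (rule fps_ext) (simp add: deriv_x_def)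
  then show ?thesis by (simp add: dot_def deriv_y_def)
qed

lemma dot_one: "dot p q P Q 1 = 0"
  using dot_const[of p q P Q 1] by simp

lemma dot_power: "dot p q P Q (F ^ k) = of_nat k * F ^ (k - 1) * dot p q P Q F"
proof (induction k)
  case (Suc k)
  then show ?case by (cases k) (simp_all add: dot_mult algebra_simps)
qed (simp add: dot_one)

text \<open>The part of \<open>dot\<close> that raises the total degree. What remains is diagonal on
  monomials, with eigenvalue p i - q j (see \<open>dot_nth\<close>), so every equation for
  \<open>dot\<close> can be solved degree by degree.\<close>

definition nonlin_dot :: "'a::field_char_0 poly poly \<Rightarrow> 'a poly poly \<Rightarrow> 'a fps2 \<Rightarrow> 'a fps2" where
  "nonlin_dot P Q F = deriv_x F * fps2_of_poly P + deriv_y F * fps2_of_poly Q"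

lemma deriv_x_mult_var_x: "(deriv_x F * var_x) $ j $ i = of_nat i * F $ j $ i"
  using mono2_mult_nth[of 1 0 "deriv_x F" j i]
  by (cases i) (simp_all add: var_x_eq mult.commute deriv_x_nth)

lemma deriv_y_mult_var_y: "(deriv_y F * var_y) $ j $ i = of_nat j * F $ j $ i"
  using mono2_mult_nth[of 0 1 "deriv_y F" j i]
  by (cases j) (simp_all add: var_y_eq mult.commute deriv_y_nth)

lemma dot_nth:
  "dot p q P Q F $ j $ i =
     (of_nat p * of_nat i - of_nat q * of_nat j) * F $ j $ i + nonlin_dot P Q F $ j $ i"
proof -
  have "dot p q P Q F = of_nat p * (deriv_x F * var_x) - of_nat q * (deriv_y F * var_y) + nonlin_dot P Q F"
    by (simp add: dot_def nonlin_dot_def algebra_simps)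
  then show ?thesis
    by (simp only: fps_add_nth fps_sub_nth of_nat_fps2_mult_nth deriv_x_mult_var_x deriv_y_mult_var_y)
      (simp add: algebra_simps)
qed

lemma fps2_of_poly_nth: "fps2_of_poly P $ j $ i = coeff (coeff P j) i"
  by (simp add: fps2_of_poly_def coeff_map_poly)

lemma ord_ge_fps2_of_poly: "nonlinear_poly n P \<Longrightarrow> ord_ge 2 (fps2_of_poly P)"
  by (force simp: nonlinear_poly_def ord_ge_def fps2_of_poly_nth)

lemma nonlin_dot_diff: "nonlin_dot P Q (F - G) = nonlin_dot P Q F - nonlin_dot P Q G"
  by (simp add: nonlin_dot_def deriv_x_diff deriv_y_def algebra_simps)

lemma ord_ge_nonlin_dot:
  assumes "nonlinear_poly n P" "nonlinear_poly n Q" "ord_ge d F"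
  shows "ord_ge (Suc d) (nonlin_dot P Q F)"
proof (cases d)
  case 0
  have "ord_ge (0 + 2) (deriv_x F * fps2_of_poly P)" "ord_ge (0 + 2) (deriv_y F * fps2_of_poly Q)"
    by (intro ord_ge_mult ord_ge_fps2_of_poly assms(1,2)[THEN ord_ge_fps2_of_poly]; simp)+
  then show ?thesis using 0
    unfolding nonlin_dot_def by (intro ord_ge_add) (auto elim: ord_ge_mono)
next
  case (Suc d')
  then have "ord_ge (d' + 2) (deriv_x F * fps2_of_poly P)" "ord_ge (d' + 2) (deriv_y F * fps2_of_poly Q)"
    by (intro ord_ge_mult ord_ge_deriv_x ord_ge_deriv_y assms(1,2)[THEN ord_ge_fps2_of_poly];
        use assms(3) in simp)+
  then show ?thesis using Suc by (simp add: nonlin_dot_def ord_ge_add)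
qed

lemma ord_ge_dot:
  assumes "nonlinear_poly n P" "nonlinear_poly n Q" "ord_ge d F"
  shows "ord_ge d (dot p q P Q F)"
  using ord_ge_nonlin_dot[OF assms] assms(3) by (simp add: ord_ge_def dot_nth)

section \<open>Existence of the normal form\<close>

text \<open>At \<open>x\<close> the iterates of \<open>T\<close> are constant from step
  \<open>m x + 1\<close> on, because \<open>T\<close> looks only at smaller degrees; the fixed point
  is the diagonal. The start value does not matter: at a point of least degree the premise on
  \<open>s\<close> and \<open>s'\<close> is vacuous.\<close>

lemma graded_fixpoint:
  fixes T :: "('i \<Rightarrow> 'b) \<Rightarrow> 'i \<Rightarrow> 'b" and m :: "'i \<Rightarrow> nat"
  assumes T: "\<And>s s' x. (\<And>y. m y < m x \<Longrightarrow> s y = s' y) \<Longrightarrow> T s x = T s' x"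
  obtains s where "T s = s"
proof
  define u where "u = (\<lambda>k. (T ^^ k) (\<lambda>_. undefined))"
  have stable: "u k x = u (Suc (m x)) x" if "m x < k" for k x
    using that
  proof (induction "m x" arbitrary: k x rule: less_induct)
    case less
    then obtain k' where k: "k = Suc k'" by (cases k) auto
    have "u k' y = u (m x) y" if "m y < m x" for y
      using less.hyps[OF that, of k'] less.hyps[OF that, of "m x"] less.prems k that by simp
    then have "T (u k') x = T (u (m x)) x" by (rule T)
    then show ?case by (simp add: u_def k)
  qed
  define s where "s = (\<lambda>x. u (Suc (m x)) x)"
  show "T s = s"
  proof
    fix x
    have "s y = u (m x) y" if "m y < m x" for y
      using stable[OF that] by (simp only: s_def)
    then have "T s x = T (u (m x)) x" by (rule T)
    then show "T s x = s x" by (simp add: s_def u_def)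
  qed
qed

lemma series_in_nth:
  assumes "ord_ge 1 W" "i + j \<le> K"
  shows "series_in a W $ j $ i = (\<Sum>k=1..K. a k * (W ^ k) $ j $ i)"
proof -
  have "(W ^ k) $ j $ i = 0" if "k > i + j" for k
    using ord_ge_power[OF assms(1), of k] that by (simp add: ord_ge_def)
  then show ?thesis
    unfolding series_in_def fps_nth_Abs_fps by (intro sum.mono_neutral_left) (use assms(2) in auto)
qed

lemma mult_series_in_nth:
  assumes "ord_ge 1 W"
  shows "(F * series_in a W) $ j $ i = (\<Sum>k=1..i + j. a k * (F * W ^ k) $ j $ i)"
proof -
  have "(F * series_in a W) $ j $ i =
      (\<Sum>j'=0..j. \<Sum>i'=0..i. F $ j' $ i' * (\<Sum>k=1..i + j. a k * (W ^ k) $ (j - j') $ (i - i')))"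
    unfolding fps2_mult_nth
    by (intro sum.cong refl arg_cong2[where f = times] series_in_nth[OF assms]) auto
  also have "\<dots> = (\<Sum>j'=0..j. \<Sum>k=1..i + j. \<Sum>i'=0..i. a k * (F $ j' $ i' * (W ^ k) $ (j - j') $ (i - i')))"
    by (subst sum.swap) (simp add: sum_distrib_left mult_ac)
  also have "\<dots> = (\<Sum>k=1..i + j. a k * (F * W ^ k) $ j $ i)"
    by (subst sum.swap) (simp add: fps2_mult_nth sum_distrib_left)
  finally show ?thesis .
qed

context
  fixes p q :: nat and n :: nat and P Q :: "'a::field_char_0 poly poly"
  assumes pq: "0 < p" "0 < q" "coprime p q"
    and PQ: "nonlinear_poly n P" "nonlinear_poly n Q"
begin

definition coord :: "bool \<Rightarrow> 'a fps2" where
  "coord b = (if b then var_x else var_y)"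

definition eigval :: "bool \<Rightarrow> 'a" where
  "eigval b = (if b then of_nat p else - of_nat q)"

definition resonant :: "bool \<Rightarrow> nat \<Rightarrow> nat \<Rightarrow> bool" where
  "resonant b i j \<longleftrightarrow> of_nat p * of_nat i - of_nat q * of_nat j = eigval b"

text \<open>Position of x (x^q y^p)^k in the first equation or of y (x^q y^p)^k in the second: the
  resonant monomials.\<close>

definition slot :: "bool \<Rightarrow> nat \<Rightarrow> bool \<times> nat \<times> nat" where
  "slot b k = (b, q * k + of_bool b, p * k + of_bool (\<not> b))"

text \<open>A single family \<open>s\<close> holds all unknowns. At a nonresonant position it is a
  coefficient of the coordinate change; at a resonant one, where that coefficient is set to 0, it is
  a coefficient of the normal form. So the degree i + j grades both kinds at once.\<close>

definition nf_coord :: "(bool \<times> nat \<times> nat \<Rightarrow> 'a) \<Rightarrow> bool \<Rightarrow> 'a fps2" where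
  "nf_coord s b = Abs_fps (\<lambda>j. Abs_fps (\<lambda>i.
     if i + j \<le> 1 then coord b $ j $ i else if resonant b i j then 0 else s (b, i, j)))"

definition nf_prod :: "(bool \<times> nat \<times> nat \<Rightarrow> 'a) \<Rightarrow> 'a fps2" where
  "nf_prod s = nf_coord s True ^ q * nf_coord s False ^ p"

text \<open>The subtracted monomial is the one through which the unknown \<open>s (slot b k)\<close>
  enters in its own degree. The remainder starts one degree later and therefore belongs to the known
  data.\<close>

definition nf_rest :: "(bool \<times> nat \<times> nat \<Rightarrow> 'a) \<Rightarrow> bool \<Rightarrow> nat \<Rightarrow> 'a fps2" where
  "nf_rest s b k = nf_coord s b * nf_prod s ^ k - coord b * mono2 q p ^ k"

definition nf_gap :: "(bool \<times> nat \<times> nat \<Rightarrow> 'a) \<Rightarrow> bool \<Rightarrow> nat \<Rightarrow> nat \<Rightarrow> 'a" where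
  "nf_gap s b i j = nonlin_dot P Q (nf_coord s b) $ j $ i -
     eigval b * (\<Sum>k=1..i + j. s (slot b k) * nf_rest s b k $ j $ i)"

text \<open>The homological equation at (b, i, j), solved for its unknown: division by the
  eigenvalue difference where this is nonzero, and otherwise by \<open>eigval b\<close>, the factor
  in front of the normal form coefficient.\<close>

definition nf_step :: "(bool \<times> nat \<times> nat \<Rightarrow> 'a) \<Rightarrow> bool \<times> nat \<times> nat \<Rightarrow> 'a" where
  "nf_step s = (\<lambda>(b, i, j). nf_gap s b i j /
     (if resonant b i j then eigval b else eigval b - (of_nat p * of_nat i - of_nat q * of_nat j)))"

lemma eigval_nonzero: "eigval b \<noteq> 0"
  using pq by (simp add: eigval_def)

lemma coord_eq: "coord b = mono2 (of_bool b) (of_bool (\<not> b))"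
  by (simp add: coord_def var_x_eq var_y_eq)

lemma coord_mult_nth:
  "(coord b * mono2 q p ^ k) $ j $ i = (if (b, i, j) = slot b k then 1 else 0)"
  by (simp add: coord_eq mono2_power mono2_mult mono2_nth slot_def add.commute)

text \<open>For \<open>b\<close> true the condition reads p (i - 1) = q j, and coprimality makes (i
  - 1, j) a multiple of (q, p); i = 0 is excluded by sign. The other case is symmetric.\<close>

lemma resonant_iff: "resonant b i j \<longleftrightarrow> (\<exists>k. (b, i, j) = slot b k)"
proof
  have inj: "int p * int i - int q * int j = (if b then int p else - int q)" if "resonant b i j"
  proof -
    from that have "(of_int (int p * int i - int q * int j) :: 'a) = of_int (if b then int p else - int q)"
      by (simp add: resonant_def eigval_def)
    then show ?thesis by (rule of_int_eq_iff[THEN iffD1])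
  qed
  have cop: "\<exists>k. x = q * k \<and> y = p * k" if "p * x = q * y" for x y
  proof -
    from that have "q dvd p * x" by simp
    then have "q dvd x" using pq(3) by (simp add: coprime_commute coprime_dvd_mult_right_iff)
    then obtain k where k: "x = q * k" ..
    with that pq show ?thesis by auto
  qed
  assume "resonant b i j"
  note eq = inj[OF this]
  show "\<exists>k. (b, i, j) = slot b k"
  proof (cases b)
    case True
    with eq have eq': "int p * int i = int q * int j + int p" by simp
    have "i \<noteq> 0"
    proof
      assume "i = 0"
      with eq' have "int q * int j + int p = 0" by simp
      moreover have "0 \<le> int q * int j" by simp
      ultimately show False using pq by linarith
    qed
    then obtain i' where i: "i = Suc i'" by (cases i) auto
    with eq' have "int (p * i') = int (q * j)" by (simp add: algebra_simps)
    then have "p * i' = q * j" by (simp only: of_nat_eq_iff)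
    from cop[OF this] show ?thesis using True i by (auto simp: slot_def)
  next
    case False
    with eq have eq': "int q * int j = int p * int i + int q" by simp
    have "j \<noteq> 0"
    proof
      assume "j = 0"
      with eq' have "int p * int i + int q = 0" by simp
      moreover have "0 \<le> int p * int i" by simp
      ultimately show False using pq by linarith
    qed
    then obtain j' where j: "j = Suc j'" by (cases j) auto
    with eq' have "int (p * i) = int (q * j')" by (simp add: algebra_simps)
    then have "p * i = q * j'" by (simp only: of_nat_eq_iff)
    from cop[OF this] show ?thesis using False j by (auto simp: slot_def)
  qed
next
  assume "\<exists>k. (b, i, j) = slot b k"
  then obtain k where "i = q * k + of_bool b" "j = p * k + of_bool (\<not> b)"
    by (auto simp: slot_def)
  then show "resonant b i j"
    by (cases b) (simp_all add: resonant_def eigval_def algebra_simps)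
qed

lemma nf_coord_diff: "ord_ge 2 (nf_coord s b - coord b)"
  by (auto simp: ord_ge_def nf_coord_def)

lemma ord_ge_coord: "ord_ge 1 (coord b)"
  by (auto simp: ord_ge_def coord_eq mono2_nth)

lemma ord_ge_nf_coord: "ord_ge 1 (nf_coord s b)"
  using ord_ge_add[OF ord_ge_mono[OF nf_coord_diff[of s b], of 1] ord_ge_coord[of b]] by simp

lemma nf_prod_diff:
  assumes "\<And>b. ord_ge (1 + r) (nf_coord s b - Z b)" "\<And>b. ord_ge 1 (Z b)"
  shows "ord_ge (q + p + r) (nf_prod s - Z True ^ q * Z False ^ p)"
proof -
  have *: "ord_ge (k + r) (nf_coord s b ^ k - Z b ^ k)" "ord_ge k (nf_coord s b ^ k)" "ord_ge k (Z b ^ k)"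
    for b k
    using ord_ge_power_diff[OF ord_ge_nf_coord[of s b], of r "Z b" k] assms
      ord_ge_power[OF ord_ge_nf_coord[of s b], of k] ord_ge_power[OF assms(2)[of b], of k] by simp_all
  show ?thesis
    unfolding nf_prod_def by (rule ord_ge_mult_diff[OF *(2) *(1) *(3) *(1)])
qed

lemma ord_ge_nf_prod: "ord_ge (q + p) (nf_prod s)"
  using ord_ge_mult[OF ord_ge_power[OF ord_ge_nf_coord[of s True], of q] ord_ge_power[OF ord_ge_nf_coord[of s False], of p]]
  by (simp add: nf_prod_def)

lemma nf_prod_mono2: "ord_ge (q + p + 1) (nf_prod s - mono2 q p)"
  using nf_prod_diff[of 1 s coord] nf_coord_diff ord_ge_coord
  by (simp add: numeral_2_eq_2 coord_def mono2_def)

lemma ord_ge_nf_rest: "ord_ge ((q + p) * k + 2) (nf_rest s b k)"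
proof -
  have "ord_ge (1 + (q + p) * k + 1) (nf_rest s b k)"
    unfolding nf_rest_def
    by (intro ord_ge_mult_diff ord_ge_nf_coord ord_ge_power_diff ord_ge_power ord_ge_mono2 nf_prod_mono2
        ord_ge_nf_prod) (use nf_coord_diff in \<open>simp add: numeral_2_eq_2\<close>)
  then show ?thesis by simp
qed

text \<open>The nonlinear part raises the degree, so it sees only lower unknowns. In the k-th
  product, either \<open>slot b k\<close> has degree below \<open>d\<close> and the relative
  precision of the factors suffices, or the remainder starts beyond degree \<open>d\<close> and
  contributes nothing.\<close>

lemma nf_step_cong:
  assumes eq: "\<And>b i j. i + j < d \<Longrightarrow> s (b, i, j) = s' (b, i, j)" and ij: "i + j = d"
  shows "nf_step s (b, i, j) = nf_step s' (b, i, j)"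
proof -
  have diff: "ord_ge d (nf_coord s b - nf_coord s' b)" for b
    using eq by (auto simp: ord_ge_def nf_coord_def)
  have diff': "ord_ge (Suc d) (nonlin_dot P Q (nf_coord s b) - nonlin_dot P Q (nf_coord s' b))"
    unfolding nonlin_dot_diff[symmetric] by (rule ord_ge_nonlin_dot[OF PQ diff])
  have rest: "s (slot b k) * nf_rest s b k $ j $ i = s' (slot b k) * nf_rest s' b k $ j $ i"
    if "k \<ge> 1" for k
  proof (cases "(q + p) * k + 1 < d")
    case True
    then have "s (slot b k) = s' (slot b k)"
      by (cases b) (auto simp: slot_def algebra_simps intro!: eq)
    obtain r where r: "d = 1 + r" using True by (cases d) auto
    have "ord_ge (1 + (q + p) * k + r) (nf_coord s b * nf_prod s ^ k - nf_coord s' b * nf_prod s' ^ k)"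
      by (intro ord_ge_mult_diff ord_ge_nf_coord ord_ge_power_diff ord_ge_power ord_ge_nf_prod)
        (use diff nf_prod_diff[of r s "nf_coord s'"] ord_ge_nf_coord in \<open>simp_all add: r nf_prod_def\<close>)
    moreover have "(q + p) * k \<ge> 1" using that pq by (simp add: Suc_le_eq)
    then have "i + j < 1 + (q + p) * k + r" using ij r by linarith
    ultimately have "(nf_coord s b * nf_prod s ^ k - nf_coord s' b * nf_prod s' ^ k) $ j $ i = 0"
      by (rule ord_geD)
    then have "(nf_rest s b k - nf_rest s' b k) $ j $ i = 0"
      by (simp add: nf_rest_def)
    with \<open>s (slot b k) = s' (slot b k)\<close> show ?thesis by simp
  next
    case False
    then show ?thesis
      using ord_geD[OF ord_ge_nf_rest[of k s b], of i j] ord_geD[OF ord_ge_nf_rest[of k s' b], of i j] ij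
      by simp
  qed
  have "nf_gap s b i j = nf_gap s' b i j"
    unfolding nf_gap_def
    using ord_geD[OF diff', of i j] rest ij by simp
  then show ?thesis by (simp add: nf_step_def)
qed

lemma normal_form_exists: "\<exists>X Y \<pi>1 \<pi>2. brings_to_normal_form p q P Q X Y \<pi>1 \<pi>2"
proof -
  obtain s where s: "nf_step s = s"
  proof (rule graded_fixpoint[where m = "\<lambda>x :: bool \<times> nat \<times> nat. fst (snd x) + snd (snd x)" and T = nf_step])
    fix s s' :: "bool \<times> nat \<times> nat \<Rightarrow> 'a" and x :: "bool \<times> nat \<times> nat"
    assume *: "\<And>y. fst (snd y) + snd (snd y) < fst (snd x) + snd (snd x) \<Longrightarrow> s y = s' y"
    obtain b i j where x: "x = (b, i, j)" by (cases x) auto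
    show "nf_step s x = nf_step s' x"
      unfolding x by (rule nf_step_cong[OF _ refl]) (use * x in simp)
  qed
  have prod1: "ord_ge 1 (nf_prod s)" by (rule ord_ge_mono[OF ord_ge_nf_prod]) (use pq in simp)
  have eqn: "dot p q P Q (nf_coord s b) =
      fps_const (fps_const (eigval b)) * nf_coord s b * (1 + series_in (\<lambda>k. s (slot b k)) (nf_prod s))" for b
  proof (intro fps_ext)
    fix j i
    let ?l = "of_nat p * of_nat i - of_nat q * of_nat j :: 'a"
    \<comment> \<open>At most one leading monomial meets position (b, i, j), and it brings in the
      unknown sought. The sum omits k = 0, the linear term itself; hence the condition 2 \<le> i +
      j.\<close>
    have slots: "(\<Sum>k=1..i + j. s (slot b k) * (coord b * mono2 q p ^ k) $ j $ i) =
        (if resonant b i j \<and> 2 \<le> i + j then s (b, i, j) else 0)"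
    proof (cases "resonant b i j")
      case True
      then obtain k0 where k0: "(b, i, j) = slot b k0" by (auto simp: resonant_iff)
      have "(b, i, j) = slot b k \<longleftrightarrow> k = k0" for k
        using k0 pq by (auto simp: slot_def)
      then have "(\<Sum>k=1..i + j. s (slot b k) * (coord b * mono2 q p ^ k) $ j $ i) =
          (\<Sum>k=1..i + j. if k = k0 then s (b, i, j) else 0)"
        unfolding coord_mult_nth using k0 by (intro sum.cong) auto
      also have "\<dots> = (if 1 \<le> k0 \<and> k0 \<le> i + j then s (b, i, j) else 0)" by simp
      also have "1 \<le> k0 \<and> k0 \<le> i + j \<longleftrightarrow> 2 \<le> i + j"
      proof -
        have ij: "i + j = (q + p) * k0 + 1" using k0 by (cases b) (auto simp: slot_def algebra_simps)
        have "k0 \<le> (q + p) * k0" using pq by simp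
        moreover have "1 \<le> k0 \<longleftrightarrow> 1 \<le> (q + p) * k0" using pq by (cases k0) auto
        ultimately show ?thesis using ij by linarith
      qed
      finally show ?thesis using True by simp
    next
      case False
      then show ?thesis by (auto simp: coord_mult_nth resonant_iff intro!: sum.neutral)
    qed
    have "(nf_coord s b * (1 + series_in (\<lambda>k. s (slot b k)) (nf_prod s))) $ j $ i =
        nf_coord s b $ j $ i + (\<Sum>k=1..i + j. s (slot b k) * (nf_coord s b * nf_prod s ^ k) $ j $ i)"
      by (simp add: distrib_left mult_series_in_nth[OF prod1])
    also have "(\<Sum>k=1..i + j. s (slot b k) * (nf_coord s b * nf_prod s ^ k) $ j $ i) =
        (\<Sum>k=1..i + j. s (slot b k) * nf_rest s b k $ j $ i) +
        (if resonant b i j \<and> 2 \<le> i + j then s (b, i, j) else 0)"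
      unfolding slots[symmetric] sum.distrib[symmetric] by (simp add: nf_rest_def algebra_simps)
    finally have rhs: "eigval b * (nf_coord s b * (1 + series_in (\<lambda>k. s (slot b k)) (nf_prod s))) $ j $ i =
        eigval b * nf_coord s b $ j $ i + nonlin_dot P Q (nf_coord s b) $ j $ i - nf_gap s b i j
        + (if resonant b i j \<and> 2 \<le> i + j then eigval b * s (b, i, j) else 0)"
      by (simp add: nf_gap_def algebra_simps)
    have s_ij: "s (b, i, j) = nf_gap s b i j / (if resonant b i j then eigval b else eigval b - ?l)"
      by (subst s[symmetric]) (simp add: nf_step_def)
    have "?l * nf_coord s b $ j $ i = eigval b * nf_coord s b $ j $ i - nf_gap s b i j
        + (if resonant b i j \<and> 2 \<le> i + j then eigval b * s (b, i, j) else 0)"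
    proof (cases "2 \<le> i + j")
      case True
      show ?thesis
      proof (cases "resonant b i j")
        case res: True
        then show ?thesis using True s_ij eigval_nonzero[of b] by (simp add: nf_coord_def)
      next
        case False
        then have "(eigval b - ?l) * s (b, i, j) = nf_gap s b i j"
          using s_ij by (simp add: resonant_def)
        then show ?thesis using True False by (simp add: nf_coord_def algebra_simps)
      qed
    next
      case False
      \<comment> \<open>There is nothing to solve in degree at most 1: all other terms start later,
        and x and y are eigenvectors of the linear part.\<close>
      have "nf_rest s b k $ j $ i = 0" if "k \<ge> 1" for k
        by (rule ord_geD[OF ord_ge_nf_rest]) (use False in simp)
      moreover have "nonlin_dot P Q (nf_coord s b) $ j $ i = 0"
        by (rule ord_geD[OF ord_ge_nonlin_dot[OF PQ ord_ge_nf_coord]]) (use False in simp)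
      ultimately have gap: "nf_gap s b i j = 0" by (simp add: nf_gap_def)
      have "(i, j) = (0, 0) \<or> (i, j) = (1, 0) \<or> (i, j) = (0, 1)" using False by auto
      then show ?thesis
        using gap by (cases b) (auto simp: nf_coord_def coord_eq mono2_nth eigval_def)
    qed
    then show "dot p q P Q (nf_coord s b) $ j $ i =
      (fps_const (fps_const (eigval b)) * nf_coord s b * (1 + series_in (\<lambda>k. s (slot b k)) (nf_prod s))) $ j $ i"
      unfolding dot_nth mult.assoc fps2_const_mult_nth rhs by (simp add: algebra_simps)
  qed
  have minus: "fps_const (fps_const (- of_nat q)) = (- of_nat q :: 'a fps2)"
    by (simp add: fps_of_nat fps_const_neg[symmetric] del: fps_const_neg)
  have "brings_to_normal_form p q P Q (nf_coord s True) (nf_coord s False)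
      (\<lambda>k. s (slot True k)) (\<lambda>k. s (slot False k))"
    unfolding brings_to_normal_form_def
  proof (intro conjI)
    show "formal_coordinate_change (nf_coord s True) (nf_coord s False)"
      by (auto simp: formal_coordinate_change_def nf_coord_def coord_def)
  qed (use eqn[of True] eqn[of False] in \<open>simp_all add: eigval_def nf_prod_def fps_of_nat minus\<close>)
  then show ?thesis by blast
qed

end

section \<open>Saddle order from an approximate first integral\<close>

text \<open>The value v = 0 is allowed and then says that \<open>F\<close> has no term of degree up
  to (q + p) k.\<close>

definition lead :: "nat \<Rightarrow> nat \<Rightarrow> nat \<Rightarrow> 'a::field_char_0 \<Rightarrow> 'a fps2 \<Rightarrow> bool" where
  "lead p q k v F \<longleftrightarrow> ord_ge ((q + p) * k + 1) (F - fps_const (fps_const v) * mono2 q p ^ k)"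

lemma ord_ge_mono2_power: "ord_ge ((q + p) * k) (mono2 q p ^ k)"
  by (intro ord_ge_power ord_ge_mono2)

lemma lead_ord_ge:
  assumes "lead p q k v F"
  shows "ord_ge ((q + p) * k) F"
proof -
  have "ord_ge ((q + p) * k) (F - fps_const (fps_const v) * mono2 q p ^ k)"
    by (rule ord_ge_mono[OF assms[unfolded lead_def]]) simp
  moreover have "ord_ge ((q + p) * k) (fps_const (fps_const v) * mono2 q p ^ k)"
    by (intro ord_ge_mult_left ord_ge_mono2_power)
  ultimately show ?thesis using ord_ge_add by fastforce
qed

lemma lead_nth:
  assumes "lead p q k v F" "i + j \<le> (q + p) * k"
  shows "F $ j $ i = (if i = q * k \<and> j = p * k then v else 0)"
  using ord_geD[OF assms(1)[unfolded lead_def], of i j] assms(2)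
  by (auto simp: mono2_power mono2_nth split: if_splits)

lemma lead_mult:
  assumes "lead p q k v F" "lead p q k' v' F'"
  shows "lead p q (k + k') (v * v') (F * F')"
proof -
  have "ord_ge ((q + p) * k + (q + p) * k' + 1)
     (F * F' - fps_const (fps_const v) * mono2 q p ^ k * (fps_const (fps_const v') * mono2 q p ^ k'))"
    using assms lead_ord_ge[OF assms(1)]
    by (intro ord_ge_mult_diff ord_ge_mult_left ord_ge_mono2_power) (simp_all add: lead_def)
  moreover have "fps_const (fps_const v) * mono2 q p ^ k * (fps_const (fps_const v') * mono2 q p ^ k') =
      fps_const (fps_const v) * fps_const (fps_const v') * mono2 q p ^ (k + k')"
    by (simp add: power_add mult_ac del: fps_const_mult)
  ultimately show ?thesis by (simp add: lead_def distrib_left)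
qed

lemma lead_one: "lead p q 0 1 1"
  by (simp add: lead_def)

lemma lead_power: "lead p q k 1 F \<Longrightarrow> lead p q (k * r) 1 (F ^ r)"
proof (induction r)
  case (Suc r)
  then have "lead p q (k + k * r) (1 * 1) (F * F ^ r)" by (intro lead_mult)
  then show ?case by simp
qed (simp add: lead_one)

lemma lead_const_mult:
  assumes "lead p q k v F"
  shows "lead p q k (a * v) (fps_const (fps_const a) * F)"
proof -
  have "lead p q 0 a (fps_const (fps_const a))" by (simp add: lead_def)
  from lead_mult[OF this assms] show ?thesis by simp
qed

lemma lead_series_in:
  assumes U: "lead p q 1 1 U" and "0 < p" "1 \<le> k0" and L: "\<And>k. 1 \<le> k \<Longrightarrow> k < k0 \<Longrightarrow> L k = 0"
  shows "lead p q k0 (L k0) (series_in L U)"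
proof -
  have "ord_ge ((q + p) * k0 + 1) (series_in L U - fps_const (fps_const (L k0)) * U ^ k0)"
    unfolding ord_ge_def
  proof (intro allI impI)
    fix i j assume ij: "i + j < (q + p) * k0 + 1"
    have "L k * (U ^ k) $ j $ i = (if k = k0 then L k0 * (U ^ k0) $ j $ i else 0)" if "1 \<le> k" for k
    proof (cases k k0 rule: linorder_cases)
      case greater
      then have "(q + p) * (k0 + 1) \<le> (q + p) * k" by (intro mult_le_mono2) simp
      then have "i + j < (q + p) * k" using ij \<open>0 < p\<close> by (simp add: algebra_simps)
      then show ?thesis using lead_ord_ge[OF lead_power[OF U, of k]] greater by (simp add: ord_ge_def)
    qed (use L that in auto)
    then have "(\<Sum>k=1..i + j + k0. L k * (U ^ k) $ j $ i) =
        (\<Sum>k=1..i + j + k0. if k = k0 then L k0 * (U ^ k0) $ j $ i else 0)"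
      by (intro sum.cong) auto
    then have "series_in L U $ j $ i = L k0 * (U ^ k0) $ j $ i"
      using ord_ge_mono[OF lead_ord_ge[OF U], of 1] assms(2,3)
      by (subst series_in_nth[where K = "i + j + k0"]) auto
    then show "(series_in L U - fps_const (fps_const (L k0)) * U ^ k0) $ j $ i = 0"
      by simp
  qed
  moreover have "lead p q k0 (L k0 * 1) (fps_const (fps_const (L k0)) * U ^ k0)"
    using lead_const_mult[OF lead_power[OF U, of k0]] by simp
  ultimately show ?thesis unfolding lead_def by (auto intro: ord_ge_diff_trans)
qed

lemma series_in_diff: "series_in a W - series_in b W = series_in (\<lambda>k. a k - b k) W"
  by (intro fps_ext) (simp add: series_in_def sum_subtractf[symmetric] algebra_simps)

section \<open>Comparison of an approximate first integral with the normal form\<close>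

context
  fixes p q :: nat and n :: nat and P Q :: "'a::field_char_0 poly poly"
  assumes pq: "0 < p" "0 < q" "coprime p q"
    and PQ: "nonlinear_poly n P" "nonlinear_poly n Q"
begin

text \<open>
  Subtracting powers of an approximate first integral \<open>U\<close> from \<open>G\<close> removes its resonant terms
  degree by degree, without affecting the terms of \<open>dot p q P Q G\<close> that are of interest.
\<close>

lemma resonant_coeff_dot_eq_0:
  assumes U: "lead p q 1 1 U" "ord_ge ((q + p) * (k0 + 1)) (dot p q P Q U)"
    and r: "r \<le> k0 + M" and G: "ord_ge ((q + p) * M + 1) G" "ord_ge ((q + p) * r) (dot p q P Q G)"
  shows "dot p q P Q G $ (p * r) $ (q * r) = 0"
proof (cases "(q + p) * M + 1 \<le> (q + p) * r")
  case False
  then show ?thesis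
    using ord_geD[OF ord_ge_dot[OF PQ G(1)], of "q * r" "p * r"] by (simp add: algebra_simps)
next
  case True
  have "d \<le> (q + p) * r \<Longrightarrow>
      \<exists>G'. ord_ge d G' \<and> ord_ge ((q + p) * r + 1) (dot p q P Q G' - dot p q P Q G)"
    if "(q + p) * M + 1 \<le> d" for d
    using that
  proof (induction d rule: dec_induct)
    case base
    then show ?case using G(1) by (intro exI[of _ G]) simp
  next
    case (step d)
    then obtain G' where G': "ord_ge d G'" "ord_ge ((q + p) * r + 1) (dot p q P Q G' - dot p q P Q G)"
      by auto
    have hom: "(of_nat p * of_nat i - of_nat q * of_nat j) * G' $ j $ i = 0" if "i + j = d" for i j
    proof -
      have "dot p q P Q G $ j $ i = 0" using that step.prems by (intro ord_geD[OF G(2)]) simp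
      moreover have "(dot p q P Q G' - dot p q P Q G) $ j $ i = 0"
        using that step.prems by (intro ord_geD[OF G'(2)]) simp
      moreover have "nonlin_dot P Q G' $ j $ i = 0"
        using that by (intro ord_geD[OF ord_ge_nonlin_dot[OF PQ G'(1)]]) simp
      ultimately show ?thesis by (simp add: dot_nth)
    qed
    have res: "G' $ j $ i = 0 \<or> (\<exists>k. i = q * k \<and> j = p * k)" if "i + j = d" for i j
    proof (rule disjCI)
      assume "\<not> (\<exists>k. i = q * k \<and> j = p * k)"
      moreover have "\<exists>k. i = q * k \<and> j = p * k" if "p * i = q * j"
      proof -
        from that have "q dvd p * i" by simp
        then have "q dvd i" using pq(3) by (simp add: coprime_commute coprime_dvd_mult_right_iff)
        then obtain k where "i = q * k" ..
        with that pq show ?thesis by auto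
      qed
      ultimately have "p * i \<noteq> q * j" by blast
      then have "(of_nat (p * i) :: 'a) \<noteq> of_nat (q * j)" by (simp only: of_nat_eq_iff not_False_eq_True)
      then show "G' $ j $ i = 0" using hom[OF that] by simp
    qed
    show ?case
    proof (cases "\<exists>k. d = (q + p) * k")
      case False
      have "ord_ge (Suc d) G'"
      proof (rule ord_ge_Suc_eq0[OF G'(1)])
        fix i j assume "i + j = d"
        then show "G' $ j $ i = 0" using res[of i j] False by (auto simp: algebra_simps)
      qed
      then show ?thesis using G'(2) by auto
    next
      case True
      then obtain k where k: "d = (q + p) * k" ..
      define a where "a = G' $ (p * k) $ (q * k)"
      define G'' where "G'' = G' - fps_const (fps_const a) * U ^ k"
      have Uk: "lead p q k 1 (U ^ k)" using lead_power[OF U(1), of k] by simp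
      have "M < k"
      proof (rule ccontr)
        assume "\<not> M < k"
        then have "(q + p) * k \<le> (q + p) * M" by (intro mult_le_mono2) simp
        then show False using step.hyps k by linarith
      qed
      have "ord_ge (Suc d) G''"
      proof (rule ord_ge_Suc_eq0)
        show "ord_ge d G''"
          unfolding G''_def k using G'(1) k lead_ord_ge[OF Uk] by (intro ord_ge_diff ord_ge_mult_left) simp_all
        fix i j assume ij: "i + j = d"
        show "G'' $ j $ i = 0"
        proof (cases "i = q * k \<and> j = p * k")
          case True
          then show ?thesis using lead_nth[OF Uk, of i j] by (simp add: G''_def a_def algebra_simps)
        next
          case False
          then have "G' $ j $ i = 0" using res[OF ij] ij k pq by (auto simp: distrib_right[symmetric])
          then show ?thesis using lead_nth[OF Uk, of i j] False ij k by (auto simp add: G''_def)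
        qed
      qed
      moreover have "ord_ge ((q + p) * r + 1) (dot p q P Q G'' - dot p q P Q G)"
      proof -
        \<comment> \<open>The derivative of U^k is k U^(k-1) times that of \<open>U\<close>, of
          order at least (q + p)(k + k0). Since M < k and r \<le> k0 + M, this lies beyond degree (q
          + p) r, so the correction is invisible there.\<close>
        have "ord_ge ((q + p) * (k - 1) + (q + p) * (k0 + 1)) (U ^ (k - 1) * dot p q P Q U)"
          using ord_ge_power[OF lead_ord_ge[OF U(1)], of "k - 1"] by (intro ord_ge_mult U(2)) simp
        then have "ord_ge ((q + p) * (k - 1) + (q + p) * (k0 + 1))
           (fps_const (fps_const a) * (of_nat k * (U ^ (k - 1) * dot p q P Q U)))"
          by (rule ord_ge_mult_left[OF ord_ge_mult_left])
        moreover have "(q + p) * (k - 1) + (q + p) * (k0 + 1) = (q + p) * (k + k0)"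
          using \<open>M < k\<close> by (cases k) (simp_all add: algebra_simps)
        moreover have "(q + p) * (r + 1) \<le> (q + p) * (k + k0)"
          using \<open>M < k\<close> r by (intro mult_le_mono2) simp
        ultimately have "ord_ge ((q + p) * r + 1)
           (fps_const (fps_const a) * (of_nat k * (U ^ (k - 1) * dot p q P Q U)))"
          using pq by (elim ord_ge_mono) (simp add: algebra_simps)
        moreover have eq: "dot p q P Q G'' - dot p q P Q G = (dot p q P Q G' - dot p q P Q G) -
           fps_const (fps_const a) * (of_nat k * (U ^ (k - 1) * dot p q P Q U))"
          by (simp add: G''_def dot_diff dot_mult dot_const dot_power mult.assoc)
        ultimately show ?thesis unfolding eq by (intro ord_ge_diff[OF G'(2)])
      qed
      ultimately show ?thesis by blast
    qed
  qed
  from this[OF True] obtain G' where G': "ord_ge ((q + p) * r) G'"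
    "ord_ge ((q + p) * r + 1) (dot p q P Q G' - dot p q P Q G)" by auto
  \<comment> \<open>\<open>G'\<close> starts only in degree (q + p) r. There the diagonal part
    annihilates the resonant monomial and the nonlinear part has not yet set in.\<close>
  have "nonlin_dot P Q G' $ (p * r) $ (q * r) = 0"
    by (rule ord_geD[OF ord_ge_nonlin_dot[OF PQ G'(1)]]) (simp add: algebra_simps)
  then have "dot p q P Q G' $ (p * r) $ (q * r) = 0"
    by (simp add: dot_nth algebra_simps)
  moreover have "(dot p q P Q G' - dot p q P Q G) $ (p * r) $ (q * r) = 0"
    by (rule ord_geD[OF G'(2)]) (simp add: algebra_simps)
  ultimately show ?thesis by simp
qed

text \<open>For U = X^q Y^p the normal form gives dot U = p q U (L_1 U + L_2 U^2 + ...). The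
  difference \<open>G = H - U ^ M\<close> has no terms of degree up to (q + p) M, so the first
  relevant resonant coefficient of its derivative vanishes. Hence \<open>H\<close> and U^M have the
  same leading obstruction: L_k = 0 for k < K, and V = M p q L_K.\<close>

lemma has_saddle_orderI:
  assumes M: "1 \<le> M" and K: "1 \<le> K"
    and H: "lead p q M 1 H" "lead p q (K + M) V (dot p q P Q H)" and V: "V \<noteq> 0"
  shows "has_saddle_order p q P Q K"
proof -
  obtain X Y \<pi>1 \<pi>2 where nf: "brings_to_normal_form p q P Q X Y \<pi>1 \<pi>2"
    using normal_form_exists[OF pq PQ] by blast
  define L where "L = (\<lambda>k. \<pi>1 k - \<pi>2 k)"
  define U where "U = X ^ q * Y ^ p"
  have sv: "saddle_values p q P Q L" using nf by (auto simp: saddle_values_def L_def)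
  have U: "lead p q 1 1 U"
  proof -
    have X: "ord_ge (1 + 1) (X - var_x)" and Y: "ord_ge (1 + 1) (Y - var_y)"
      using nf by (simp_all add: brings_to_normal_form_def formal_coordinate_change_def ord_ge_def)
    have xy: "ord_ge 1 (var_x :: 'a fps2)" "ord_ge 1 (var_y :: 'a fps2)"
      by (simp_all add: var_x_eq var_y_eq ord_ge_def mono2_nth)
    have "ord_ge 1 X" "ord_ge 1 Y"
      using ord_ge_add[OF ord_ge_mono[OF X, of 1] xy(1)] ord_ge_add[OF ord_ge_mono[OF Y, of 1] xy(2)] by simp_all
    then have "ord_ge (1 * q + 1 * p + 1) (X ^ q * Y ^ p - var_x ^ q * var_y ^ p)"
      using X Y xy by (intro ord_ge_mult_diff ord_ge_power_diff ord_ge_power)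
    then show ?thesis by (simp add: lead_def U_def mono2_def)
  qed
  have dotU: "dot p q P Q U = fps_const (fps_const (of_nat (p * q))) * (U * series_in L U)"
  proof -
    obtain q' p' where q': "q = Suc q'" and p': "p = Suc p'" using pq by (cases q; cases p) auto
    have dX: "dot p q P Q X = of_nat p * X * (1 + series_in \<pi>1 U)"
      and dY: "dot p q P Q Y = - of_nat q * Y * (1 + series_in \<pi>2 U)"
      using nf by (simp_all add: brings_to_normal_form_def U_def)
    have 1: "dot p q P Q (X ^ q) = of_nat q * of_nat p * X ^ q * (1 + series_in \<pi>1 U)"
      unfolding dot_power dX by (simp add: q' mult_ac del: of_nat_Suc)
    have 2: "dot p q P Q (Y ^ p) = - (of_nat q * of_nat p * Y ^ p * (1 + series_in \<pi>2 U))"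
      unfolding dot_power dY by (simp add: p' mult_ac del: of_nat_Suc)
    have ring: "a * b * A * (1 + S) * B + A * - (a * b * B * (1 + T)) = a * b * (A * B * (S - T))"
      for a b A B S T :: "'a fps2" by (simp add: algebra_simps)
    have "dot p q P Q (X ^ q * Y ^ p) =
        of_nat q * of_nat p * (X ^ q * Y ^ p * (series_in \<pi>1 U - series_in \<pi>2 U))"
      unfolding dot_mult 1 2 by (rule ring)
    then have "dot p q P Q U = of_nat q * of_nat p * (U * series_in L U)"
      unfolding U_def[symmetric] series_in_diff L_def .
    then show ?thesis
      unfolding of_nat_fps2[symmetric] unfolding of_nat_mult by (simp only: mult_ac)
  qed
  have lead_dotU: "lead p q (k0 + 1) (of_nat (p * q) * L k0) (dot p q P Q U)"
    if "1 \<le> k0" "\<And>k. 1 \<le> k \<Longrightarrow> k < k0 \<Longrightarrow> L k = 0" for k0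
    using lead_const_mult[OF lead_mult[OF U lead_series_in[OF U pq(1) that]]] by (simp add: dotU add.commute)
  define G where "G = H - U ^ M"
  have G: "ord_ge ((q + p) * M + 1) G"
    using H(1) lead_power[OF U, of M] unfolding lead_def G_def
    by (auto intro: ord_ge_diff_trans simp: ord_ge_minus_iff[of _ "U ^ M"])
  have dotG: "dot p q P Q G = dot p q P Q H - fps_const (fps_const (of_nat M)) * (U ^ (M - 1) * dot p q P Q U)"
    by (simp add: G_def dot_diff dot_power of_nat_fps2 mult.assoc)
  have lead_dotUM: "lead p q (k0 + M) (of_nat M * (of_nat (p * q) * L k0))
      (fps_const (fps_const (of_nat M)) * (U ^ (M - 1) * dot p q P Q U))"
    if "1 \<le> k0" "\<And>k. 1 \<le> k \<Longrightarrow> k < k0 \<Longrightarrow> L k = 0" for k0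
    using lead_const_mult[OF lead_mult[OF lead_power[OF U, of "M - 1"] lead_dotU[OF that]]] M
    by (simp add: add.commute)
  \<comment> \<open>If the first nonzero \<open>L k\<close> came before \<open>K\<close>, it would
    appear in \<open>dot p q P Q G\<close> in a degree where the derivative of \<open>H\<close>
    still vanishes.\<close>
  have "L k \<noteq> 0 \<longrightarrow> K \<le> k" if "1 \<le> k" for k
    using that
  proof (induction k rule: less_induct)
    case (less k)
    show ?case
    proof (intro impI, rule ccontr)
      assume Lk: "L k \<noteq> 0" and "\<not> K \<le> k"
      then have *: "\<And>k'. 1 \<le> k' \<Longrightarrow> k' < k \<Longrightarrow> L k' = 0" using less.IH by fastforce
      have kK: "(q + p) * (k + M) + 1 \<le> (q + p) * (K + M)"
      proof -
        have "(q + p) * (k + M + 1) \<le> (q + p) * (K + M)" using \<open>\<not> K \<le> k\<close> by (intro mult_le_mono2) simp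
        then show ?thesis using pq by (simp add: algebra_simps)
      qed
      have H0: "ord_ge ((q + p) * (k + M) + 1) (dot p q P Q H)"
        by (rule ord_ge_mono[OF lead_ord_ge[OF H(2)] kK])
      note UM = lead_dotUM[OF less.prems *]
      have "ord_ge ((q + p) * (k + M)) (dot p q P Q G)"
        unfolding dotG by (intro ord_ge_diff ord_ge_mono[OF H0] lead_ord_ge[OF UM]) simp
      from resonant_coeff_dot_eq_0[OF U _ le_refl G this] lead_ord_ge[OF lead_dotU[OF less.prems *]]
      have "dot p q P Q G $ (p * (k + M)) $ (q * (k + M)) = 0" by simp
      moreover have "dot p q P Q H $ (p * (k + M)) $ (q * (k + M)) = 0"
        by (rule ord_geD[OF H0]) (simp add: algebra_simps)
      moreover have "(fps_const (fps_const (of_nat M)) * (U ^ (M - 1) * dot p q P Q U))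
          $ (p * (k + M)) $ (q * (k + M)) = of_nat M * (of_nat (p * q) * L k)"
        by (subst lead_nth[OF UM]) (simp_all add: algebra_simps)
      ultimately have "of_nat M * (of_nat (p * q) * L k) = 0"
        unfolding dotG fps_sub_nth by (simp only: diff_0 neg_equal_0_iff_equal)
      then show False using Lk M pq by simp
    qed
  qed
  then have L0: "L k = 0" if "1 \<le> k" "k < K" for k using that by fastforce
  \<comment> \<open>Otherwise the derivative of U^M would contribute nothing in the resonant degree
    of index K + M, and \<open>V\<close> would survive alone.\<close>
  have "L K \<noteq> 0"
  proof
    assume "L K = 0"
    note UM = lead_dotUM[OF K L0] and dU = lead_dotU[OF K L0]
    have "ord_ge ((q + p) * (K + M)) (dot p q P Q G)"
      unfolding dotG by (intro ord_ge_diff lead_ord_ge[OF UM] lead_ord_ge[OF H(2)])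
    from resonant_coeff_dot_eq_0[OF U _ le_refl G this] lead_ord_ge[OF dU]
    have "dot p q P Q G $ (p * (K + M)) $ (q * (K + M)) = 0" by simp
    moreover have "(fps_const (fps_const (of_nat M)) * (U ^ (M - 1) * dot p q P Q U))
        $ (p * (K + M)) $ (q * (K + M)) = 0"
      by (subst lead_nth[OF UM]) (simp_all add: algebra_simps \<open>L K = 0\<close>)
    moreover have "dot p q P Q H $ (p * (K + M)) $ (q * (K + M)) = V"
      by (subst lead_nth[OF H(2)]) (simp_all add: algebra_simps)
    ultimately show False using V unfolding dotG fps_sub_nth by (simp only: diff_0_right)
  qed
  then show ?thesis using sv K L0 by (auto simp: has_saddle_order_def)
qed

end

section \<open>Systems with homogeneous nonlinearities\<close>

definition homog_poly :: "nat \<Rightarrow> 'a::field_char_0 poly \<Rightarrow> 'a poly poly" where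
  "homog_poly n f = (\<Sum>i\<le>n. monom (monom (coeff f i) (n - i)) i)"

lemma coeff_homog_poly: "coeff (coeff (homog_poly n f) j) i = (if i + j = n then coeff f j else 0)"
proof -
  have "coeff (coeff (homog_poly n f) j) i = (\<Sum>k\<le>n. if k = j then (if n - j = i then coeff f j else 0) else 0)"
    unfolding homog_poly_def coeff_sum by (intro sum.cong) auto
  then show ?thesis by auto
qed

lemma nonlinear_homog_poly: "2 \<le> n \<Longrightarrow> n \<le> n' \<Longrightarrow> nonlinear_poly n' (homog_poly n f)"
  by (simp add: nonlinear_poly_def coeff_homog_poly)

lemma fps2_of_homog_poly:
  "fps2_of_poly (homog_poly n f) = (\<Sum>k\<le>n. fps_const (fps_const (coeff f k)) * mono2 (n - k) k)"
proof (intro fps_ext)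
  fix j i
  have "(\<Sum>k\<le>n. fps_const (fps_const (coeff f k)) * mono2 (n - k) k) $ j $ i =
      (\<Sum>k\<le>n. if k = j then (if n - j = i then coeff f j else 0) else 0)"
    unfolding fps_sum_nth fps2_const_mult_nth mono2_nth by (intro sum.cong) auto
  also have "\<dots> = (if i + j = n then coeff f j else 0)" by auto
  finally show "fps2_of_poly (homog_poly n f) $ j $ i =
      (\<Sum>k\<le>n. fps_const (fps_const (coeff f k)) * mono2 (n - k) k) $ j $ i"
    by (simp add: fps2_of_poly_nth coeff_homog_poly)
qed

lemma mult_homog_poly_nth:
  "(F * fps2_of_poly (homog_poly n f)) $ j $ i =
     (\<Sum>k\<le>n. if n - k \<le> i \<and> k \<le> j then coeff f k * F $ (j - k) $ (i - (n - k)) else 0)"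
proof -
  have "F * fps2_of_poly (homog_poly n f) =
      (\<Sum>k\<le>n. fps_const (fps_const (coeff f k)) * (mono2 (n - k) k * F))"
    by (simp add: fps2_of_homog_poly sum_distrib_left sum_distrib_right mult_ac)
  then have "(F * fps2_of_poly (homog_poly n f)) $ j $ i =
      (\<Sum>k\<le>n. coeff f k * (mono2 (n - k) k * F) $ j $ i)"
    by (simp only: fps_sum_nth fps2_const_mult_nth)
  then show ?thesis by (simp only: mono2_mult_nth if_distrib mult_zero_right)
qed

text \<open>
  With \<open>\<rho> = x\<^bsup>d\<^esup>\<close> and \<open>u = y / x\<close>, the series \<open>\<Sum>m. \<rho>\<^bsup>m\<^esup> * G m u\<close> collects the terms of degree
  divisible by \<open>d\<close>. It is a power series in \<open>x\<close> and \<open>y\<close> if \<open>degree (G m) \<le> d * m\<close>.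
\<close>

definition fps2_of_graded :: "nat \<Rightarrow> (nat \<Rightarrow> 'a::field_char_0 poly) \<Rightarrow> 'a fps2" where
  "fps2_of_graded d G =
     Abs_fps (\<lambda>j. Abs_fps (\<lambda>i. if d dvd i + j then coeff (G ((i + j) div d)) j else 0))"

text \<open>The derivative of \<rho>^m G(u) has two components: \<open>lin_op\<close> at \<rho>^m
  and \<open>nonlin_op\<close> at \<rho>^(m+1).\<close>

definition lin_op :: "nat \<Rightarrow> nat \<Rightarrow> nat \<Rightarrow> nat \<Rightarrow> 'a::field_char_0 poly \<Rightarrow> 'a poly" where
  "lin_op p q d m G = smult (of_nat (p * d * m)) G - smult (of_nat (p + q)) (pCons 0 (pderiv G))"

definition nonlin_op :: "nat \<Rightarrow> 'a::field_char_0 poly \<Rightarrow> 'a poly \<Rightarrow> nat \<Rightarrow> 'a poly \<Rightarrow> 'a poly" where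
  "nonlin_op d f h m G = smult (of_nat (d * m)) (f * G) + h * pderiv G"

definition graded_dot :: "nat \<Rightarrow> nat \<Rightarrow> nat \<Rightarrow> 'a::field_char_0 poly \<Rightarrow> 'a poly \<Rightarrow>
    (nat \<Rightarrow> 'a poly) \<Rightarrow> nat \<Rightarrow> 'a poly" where
  "graded_dot p q d f h G m = lin_op p q d m (G m) +
     (case m of 0 \<Rightarrow> 0 | Suc m' \<Rightarrow> nonlin_op d f h m' (G m'))"

lemma coeff_pCons_0_pderiv: "coeff (pCons 0 (pderiv G)) i = of_nat i * coeff G i"
  by (cases i) (simp_all add: coeff_pderiv)

lemma coeff_lin_op:
  "coeff (lin_op p q d m G) i = (of_nat (p * d * m) - of_nat ((p + q) * i)) * coeff G i"
  unfolding lin_op_def coeff_diff coeff_smult coeff_pCons_0_pderiv by (simp add: algebra_simps)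

lemma dot_fps2_of_graded:
  assumes n: "2 \<le> n" and f: "degree f \<le> n" and g: "degree (h + pCons 0 f) \<le> n"
    and G: "\<And>m. degree (G m) \<le> (n - 1) * m"
  shows "dot p q (homog_poly n f) (homog_poly n (h + pCons 0 f)) (fps2_of_graded (n - 1) G) =
     fps2_of_graded (n - 1) (graded_dot p q (n - 1) f h G)"
proof (intro fps_ext)
  fix j i
  define F where "F = fps2_of_graded (n - 1) G"
  have F: "F $ j $ i = (if n - 1 dvd i + j then coeff (G ((i + j) div (n - 1))) j else 0)" for i j
    by (simp add: F_def fps2_of_graded_def)
  let ?g = "h + pCons 0 f"
  have dotF: "dot p q (homog_poly n f) (homog_poly n ?g) F $ j $ i =
      (of_nat p * of_nat i - of_nat q * of_nat j) * F $ j $ i +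
      (deriv_x F * fps2_of_poly (homog_poly n f)) $ j $ i + (deriv_y F * fps2_of_poly (homog_poly n ?g)) $ j $ i"
    by (simp add: dot_nth nonlin_dot_def)
  show "dot p q (homog_poly n f) (homog_poly n ?g) (fps2_of_graded (n - 1) G) $ j $ i =
     fps2_of_graded (n - 1) (graded_dot p q (n - 1) f h G) $ j $ i"
  proof (cases "n - 1 dvd i + j")
    case False
    have nd: "\<not> n - 1 dvd i' + j'" if "i' + j' + (n - 1) = i + j" for i' j'
      using False that by (metis dvd_add_triv_right_iff)
    have "deriv_x F $ (j - k) $ (i - (n - k)) = 0" "deriv_y F $ (j - k) $ (i - (n - k)) = 0"
      if "k \<le> n" "n - k \<le> i" "k \<le> j" for k
      using that n nd[of "i - (n - k) + 1" "j - k"] nd[of "i - (n - k)" "j - k + 1"]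
      by (simp_all add: deriv_x_nth deriv_y_nth F)
    then have "(deriv_x F * fps2_of_poly (homog_poly n f)) $ j $ i = 0"
        "(deriv_y F * fps2_of_poly (homog_poly n ?g)) $ j $ i = 0"
      unfolding mult_homog_poly_nth by (intro sum.neutral ballI; simp)+
    moreover have rhs: "fps2_of_graded (n - 1) (graded_dot p q (n - 1) f h G) $ j $ i = 0"
      using False by (simp add: fps2_of_graded_def)
    ultimately show ?thesis
      unfolding F_def[symmetric] dotF rhs using False by (simp add: F)
  next
    case True
    then obtain m where m: "i + j = (n - 1) * m" ..
    then have div: "(i + j) div (n - 1) = m" using n by simp
    have "of_nat p * of_nat i - of_nat q * of_nat j =
        (of_nat (p * (n - 1) * m) - of_nat ((p + q) * j) :: 'a)"
    proof -
      have "p * (n - 1) * m = p * (i + j)" by (simp add: m)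
      then show ?thesis by (simp add: algebra_simps)
    qed
    then have lin: "(of_nat p * of_nat i - of_nat q * of_nat j) * F $ j $ i =
        coeff (lin_op p q (n - 1) m (G m)) j"
      unfolding F div coeff_lin_op using True by simp
    have res: "fps2_of_graded (n - 1) (graded_dot p q (n - 1) f h G) $ j $ i =
        coeff (graded_dot p q (n - 1) f h G m) j"
      using True div by (simp add: fps2_of_graded_def)
    show ?thesis
    proof (cases m)
      case 0
      then have "i = 0" "j = 0" using m by simp_all
      have "(\<Sum>k\<le>n. if n - k \<le> i \<and> k \<le> j then X k else 0) = (0 :: 'a)" for X
        using n \<open>i = 0\<close> \<open>j = 0\<close> by (intro sum.neutral) auto
      then show ?thesis
        unfolding F_def[symmetric] dotF lin res mult_homog_poly_nth by (simp add: graded_dot_def 0)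
    next
      case (Suc m')
      have nm': "i + j = (n - 1) * m' + (n - 1)" using m Suc by simp
      \<comment> \<open>The x-derivative of x^(d m') G(y/x), with d = n - 1, is x^(d m' - 1)
        T(y/x).\<close>
      define T where "T = smult (of_nat ((n - 1) * m')) (G m') - pCons 0 (pderiv (G m'))"
      have T: "coeff T k = (of_nat ((n - 1) * m') - of_nat k) * coeff (G m') k" for k
        unfolding T_def coeff_diff coeff_pCons_0_pderiv by (simp add: algebra_simps)
      have G0: "coeff (G m') k = 0" if "(n - 1) * m' < k" for k
        using G[of m'] that by (intro coeff_eq_0) simp
      have "(deriv_x F * fps2_of_poly (homog_poly n f)) $ j $ i = (\<Sum>k\<le>n + j. if k \<le> j then coeff f k * coeff T (j - k) else 0)"
        unfolding mult_homog_poly_nth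
      proof (intro sum.mono_neutral_cong_left ballI)
        fix k assume "k \<in> {..n + j} - {..n}"
        then show "(if k \<le> j then coeff f k * coeff T (j - k) else 0) = 0"
          using f by (simp add: coeff_eq_0)
      next
        fix k assume k: "k \<in> {..n}"
        show "(if n - k \<le> i \<and> k \<le> j then coeff f k * deriv_x F $ (j - k) $ (i - (n - k)) else 0) =
          (if k \<le> j then coeff f k * coeff T (j - k) else 0)"
        proof (cases "k \<le> j")
          case kj: True
          show ?thesis
          proof (cases "n - k \<le> i")
            case True
            have sum: "i - (n - k) + 1 + (j - k) = (n - 1) * m'" using True kj k nm' n by simp
            then have "deriv_x F $ (j - k) $ (i - (n - k)) = of_nat (i - (n - k) + 1) * coeff (G m') (j - k)"
              unfolding deriv_x_nth F sum using n by simp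
            also have "(of_nat (i - (n - k) + 1) :: 'a) = of_nat ((n - 1) * m') - of_nat (j - k)"
              unfolding sum[symmetric] of_nat_add by simp
            finally show ?thesis using True kj by (simp add: T)
          next
            case False
            \<comment> \<open>Here the monomial of \<open>P\<close> contains more factors x than the
              target. The matching coefficient of \<open>T\<close> vanishes: at index d m' through
              its numerical factor, beyond it through the degree bound on \<open>G\<close>.\<close>
            then have "(n - 1) * m' \<le> j - k" using k kj nm' by simp
            then have "coeff T (j - k) = 0"
              by (cases "(n - 1) * m' = j - k") (auto simp: T G0 simp del: of_nat_mult)
            then show ?thesis using False by simp
          qed
        qed simp
      qed auto
      also have "\<dots> = (\<Sum>k\<le>j. coeff f k * coeff T (j - k))"
        by (intro sum.mono_neutral_cong_right) auto
      also have "\<dots> = coeff (f * T) j" by (simp add: coeff_mult)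
      finally have 1: "(deriv_x F * fps2_of_poly (homog_poly n f)) $ j $ i = coeff (f * T) j" .
      have "(deriv_y F * fps2_of_poly (homog_poly n ?g)) $ j $ i = (\<Sum>k\<le>n + j. if k \<le> j then coeff ?g k * coeff (pderiv (G m')) (j - k) else 0)"
        unfolding mult_homog_poly_nth
      proof (intro sum.mono_neutral_cong_left ballI)
        fix k assume "k \<in> {..n + j} - {..n}"
        then show "(if k \<le> j then coeff ?g k * coeff (pderiv (G m')) (j - k) else 0) = 0"
          using g coeff_eq_0[of ?g k] by simp
      next
        fix k assume k: "k \<in> {..n}"
        show "(if n - k \<le> i \<and> k \<le> j then coeff ?g k * deriv_y F $ (j - k) $ (i - (n - k)) else 0) =
          (if k \<le> j then coeff ?g k * coeff (pderiv (G m')) (j - k) else 0)"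
        proof (cases "k \<le> j")
          case kj: True
          show ?thesis
          proof (cases "n - k \<le> i")
            case True
            have sum: "i - (n - k) + (j - k + 1) = (n - 1) * m'" using True kj k nm' n by simp
            then have "deriv_y F $ (j - k) $ (i - (n - k)) = coeff (pderiv (G m')) (j - k)"
              unfolding deriv_y_nth F sum using n by (simp add: coeff_pderiv)
            then show ?thesis using True kj by simp
          next
            case False
            then have "(n - 1) * m' < j - k + 1" using k kj nm' by simp
            then have "coeff (pderiv (G m')) (j - k) = 0"
              by (simp add: coeff_pderiv G0)
            then show ?thesis using False by simp
          qed
        qed simp
      qed auto
      also have "\<dots> = (\<Sum>k\<le>j. coeff ?g k * coeff (pderiv (G m')) (j - k))"
        by (intro sum.mono_neutral_cong_right) auto
      also have "\<dots> = coeff (?g * pderiv (G m')) j" by (simp add: coeff_mult)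
      finally have 2: "(deriv_y F * fps2_of_poly (homog_poly n ?g)) $ j $ i = coeff (?g * pderiv (G m')) j" .
      \<comment> \<open>The summand u f of \<open>?g\<close> cancels the Euler term of
        \<open>T\<close>; this is why the system is parametrised by \<open>h\<close> rather than by
        \<open>?g\<close>.\<close>
      have "f * T + ?g * pderiv (G m') = nonlin_op (n - 1) f h m' (G m')"
        by (simp add: T_def nonlin_op_def algebra_simps)
      then have "coeff (f * T) j + coeff (?g * pderiv (G m')) j = coeff (nonlin_op (n - 1) f h m' (G m')) j"
        by (simp flip: coeff_add)
      then show ?thesis
        unfolding F_def[symmetric] dotF lin res 1 2 by (simp add: graded_dot_def Suc)
    qed
  qed
qed

section \<open>Resonances and the order-by-order solution for a first integral\<close>

definition res_index :: "nat \<Rightarrow> nat \<Rightarrow> nat \<Rightarrow> nat \<Rightarrow> nat \<Rightarrow> bool" where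
  "res_index p q d m i \<longleftrightarrow> p * d * m = (p + q) * i"

definition eig :: "nat \<Rightarrow> nat \<Rightarrow> nat \<Rightarrow> nat \<Rightarrow> nat \<Rightarrow> 'a::field_char_0" where
  "eig p q d m i = of_nat (p * d * m) - of_nat ((p + q) * i)"

lemma eig_eq_0_iff: "eig p q d m i = (0 :: 'a::field_char_0) \<longleftrightarrow> res_index p q d m i"
  unfolding eig_def res_index_def by (simp only: right_minus_eq of_nat_eq_iff)

text \<open>
  The equation for a first integral is solved order by order in \<open>\<rho>\<close>: it determines the nonresonant
  coefficients, the resonant ones are free and taken from \<open>K\<close>, and the resonant coefficients of the
  equation itself are the obstructions to integrability.
\<close>

fun graded_solution :: "nat \<Rightarrow> nat \<Rightarrow> nat \<Rightarrow> (nat \<Rightarrow> 'a::field_char_0 poly) \<Rightarrow> 'a poly \<Rightarrow> 'a poly \<Rightarrow>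
    nat \<Rightarrow> 'a poly" where
  "graded_solution p q d K f h 0 = 0"
| "graded_solution p q d K f h (Suc m) =
     (\<Sum>i\<le>d * Suc m. monom (if res_index p q d (Suc m) i then coeff (K (Suc m)) i
        else - coeff (nonlin_op d f h m (graded_solution p q d K f h m)) i / eig p q d (Suc m) i) i)"

lemma coeff_graded_solution_Suc:
  "coeff (graded_solution p q d K f h (Suc m)) i =
     (if i > d * Suc m then 0 else if res_index p q d (Suc m) i then coeff (K (Suc m)) i
      else - coeff (nonlin_op d f h m (graded_solution p q d K f h m)) i / eig p q d (Suc m) i)"
  by (auto simp: coeff_sum if_distrib[where f = "\<lambda>x. coeff x _"] sum.delta)

lemma degree_graded_solution: "degree (graded_solution p q d K f h m) \<le> d * m"
proof (cases m)
  case (Suc m')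
  show ?thesis unfolding Suc
    by (rule degree_le) (simp add: coeff_graded_solution_Suc del: graded_solution.simps)
qed simp

text \<open>The degree could a priori be one higher. The top coefficient is d m g (f_(d+1) +
  h_(d+2)), with g the coefficient of \<open>G\<close> at d m, and the bracket is 0 exactly because
  h + u f has no term of degree d + 2.\<close>

lemma degree_nonlin_op:
  assumes "degree f \<le> d + 1" "degree h \<le> d + 2" "coeff h (d + 2) = - coeff f (d + 1)" "degree G \<le> d * m"
  shows "degree (nonlin_op d f h m G) \<le> d * Suc m"
proof (rule degree_le, intro allI impI)
  fix i assume i: "d * Suc m < i"
  show "coeff (nonlin_op d f h m G) i = 0"
  proof (cases "i = d * m + d + 1")
    case True
    have 1: "coeff (f * G) i = coeff f (d + 1) * coeff G (d * m)"
    proof -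
      have "coeff (f * G) i = (\<Sum>k\<le>i. if k = d + 1 then coeff f (d + 1) * coeff G (d * m) else 0)"
        unfolding coeff_mult
      proof (rule sum.cong)
        fix k assume "k \<in> {..i}"
        have "coeff f k = 0" if "k > d + 1" using assms(1) that by (intro coeff_eq_0) simp
        moreover have "coeff G (i - k) = 0" if "k < d + 1" using assms(4) that True by (intro coeff_eq_0) simp
        ultimately show "coeff f k * coeff G (i - k) = (if k = d + 1 then coeff f (d + 1) * coeff G (d * m) else 0)"
          using True by (cases k "d + 1" rule: linorder_cases) simp_all
      qed simp
      then show ?thesis using True by simp
    qed
    have 2: "coeff (h * pderiv G) i = coeff h (d + 2) * (of_nat (d * m) * coeff G (d * m))"
    proof (cases "d * m = 0")
      case True
      then have "degree G = 0" using assms(4) by (simp only: le_zero_eq)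
      then have "pderiv G = 0" by (simp add: pderiv_eq_0_iff)
      then show ?thesis using True by simp
    next
      case False
      then obtain k0 where k0: "d * m = Suc k0" by (cases "d * m") auto
      have "coeff (h * pderiv G) i = (\<Sum>k\<le>i. if k = d + 2 then coeff h (d + 2) * coeff (pderiv G) k0 else 0)"
        unfolding coeff_mult
      proof (rule sum.cong)
        fix k assume "k \<in> {..i}"
        have "coeff h k = 0" if "k > d + 2" using assms(2) that by (intro coeff_eq_0) simp
        moreover have "coeff (pderiv G) (i - k) = 0" if "k < d + 2"
          using assms(4) that True k0 by (simp add: coeff_pderiv coeff_eq_0)
        moreover have "i - (d + 2) = k0" using True k0 by simp
        ultimately show "coeff h k * coeff (pderiv G) (i - k) = (if k = d + 2 then coeff h (d + 2) * coeff (pderiv G) k0 else 0)"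
          by (cases k "d + 2" rule: linorder_cases) simp_all
      qed simp
      also have "\<dots> = coeff h (d + 2) * coeff (pderiv G) k0" using True k0 by simp
      finally show ?thesis by (simp add: coeff_pderiv k0 del: of_nat_Suc of_nat_mult)
    qed
    show ?thesis unfolding nonlin_op_def coeff_add coeff_smult 1 2 assms(3) by simp
  next
    case False
    have "coeff (f * G) i = 0"
      using i False degree_mult_le[of f G] assms(1,4) by (intro coeff_eq_0) simp
    moreover have "coeff (h * pderiv G) i = 0"
    proof (cases "pderiv G = 0")
      case False
      then have "degree G \<noteq> 0" by (simp add: pderiv_eq_0_iff)
      then show ?thesis
        using i \<open>i \<noteq> d * m + d + 1\<close> degree_mult_le[of h "pderiv G"] assms(2,4)
        by (intro coeff_eq_0) (simp add: degree_pderiv)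
    qed simp
    ultimately show ?thesis by (simp add: nonlin_op_def)
  qed
qed

lemma coeff_graded_dot_solution:
  assumes "degree f \<le> d + 1" "degree h \<le> d + 2" "coeff h (d + 2) = - coeff f (d + 1)"
  shows "coeff (graded_dot p q d f h (graded_solution p q d K f h) (Suc m)) i =
     (if res_index p q d (Suc m) i
      then coeff (nonlin_op d f h m (graded_solution p q d K f h m)) i else 0)"
proof -
  let ?N = "nonlin_op d f h m (graded_solution p q d K f h m)"
  have "coeff ?N i = 0" if "i > d * Suc m"
    by (rule coeff_eq_0, rule le_less_trans[OF degree_nonlin_op[OF assms degree_graded_solution] that])
  moreover have "eig p q d (Suc m) i = (0 :: 'a) \<longleftrightarrow> res_index p q d (Suc m) i"
    by (rule eig_eq_0_iff)
  ultimately show ?thesis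
    unfolding graded_dot_def coeff_add coeff_lin_op coeff_graded_solution_Suc nat.case eig_def[symmetric]
    by (auto simp del: mult_Suc_right)
qed

section \<open>Strict derivatives and the inverse function theorem\<close>

text \<open>
  The number of parameters depends on \<open>n\<close>, so it cannot be encoded in a type: parameters are sequences,
  with the supremum norm. The condition on \<open>g\<close> is strict differentiability at the origin with derivative
  \<open>L\<close>, where the Lipschitz constant of the remainder is linear in the radius.
\<close>

definition small :: "(nat \<Rightarrow> 'a::real_normed_field) \<Rightarrow> real \<Rightarrow> bool" where
  "small x t \<longleftrightarrow> (\<forall>i. norm (x i) \<le> t)"

definition lin_bounded :: "((nat \<Rightarrow> 'a::real_normed_field) \<Rightarrow> 'a) \<Rightarrow> bool" where
  "lin_bounded L \<longleftrightarrow> (\<forall>a b x y. L (\<lambda>i. a * x i + b * y i) = a * L x + b * L y) \<and>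
     (\<exists>B\<ge>0. \<forall>x t. small x t \<longrightarrow> norm (L x) \<le> B * t)"

definition strict_deriv ::
  "((nat \<Rightarrow> 'a::real_normed_field) \<Rightarrow> 'a) \<Rightarrow> ((nat \<Rightarrow> 'a) \<Rightarrow> 'a) \<Rightarrow> bool" where
  "strict_deriv g L \<longleftrightarrow> lin_bounded L \<and>
     (\<exists>C\<ge>0. \<forall>x y \<delta> t. \<delta> \<le> 1 \<longrightarrow> small x \<delta> \<longrightarrow> small y \<delta> \<longrightarrow> small (\<lambda>i. x i - y i) t \<longrightarrow>
        norm (g x - g y - L (\<lambda>i. x i - y i)) \<le> C * \<delta> * t)"

lemma lin_boundedE:
  assumes "lin_bounded L"
  obtains B where "B \<ge> 0" "\<And>x t. small x t \<Longrightarrow> norm (L x) \<le> B * t"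
  using assms[unfolded lin_bounded_def, THEN conjunct2] by blast

lemma strict_derivD: "strict_deriv g L \<Longrightarrow> lin_bounded L"
  by (simp add: strict_deriv_def)

lemma strict_derivE:
  assumes "strict_deriv g L"
  obtains C where "C \<ge> 0"
    "\<And>x y \<delta> t. \<lbrakk>\<delta> \<le> 1; small x \<delta>; small y \<delta>; small (\<lambda>i. x i - y i) t\<rbrakk> \<Longrightarrow>
       norm (g x - g y - L (\<lambda>i. x i - y i)) \<le> C * \<delta> * t"
proof -
  from assms[unfolded strict_deriv_def, THEN conjunct2] obtain C where
    C: "C \<ge> 0" and
    *: "\<forall>x y \<delta> t. \<delta> \<le> 1 \<longrightarrow> small x \<delta> \<longrightarrow> small y \<delta> \<longrightarrow> small (\<lambda>i. x i - y i) t \<longrightarrow>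
        norm (g x - g y - L (\<lambda>i. x i - y i)) \<le> C * \<delta> * t" by blast
  show ?thesis by (rule that[OF C *[rule_format]])
qed

lemma small_nonneg: "small x t \<Longrightarrow> 0 \<le> t"
  using norm_ge_zero order_trans unfolding small_def by blast

lemma lin_bounded_linear:
  assumes "lin_bounded L"
  shows "L (\<lambda>i. 0) = 0" "L (\<lambda>i. a * x i) = a * L x" "L (\<lambda>i. x i - y i) = L x - L y"
proof -
  have *: "L (\<lambda>i. a * x i + b * y i) = a * L x + b * L y" for a b x y
    using assms by (auto simp: lin_bounded_def)
  show "L (\<lambda>i. 0) = 0" using *[of 0 "\<lambda>i. 0" 0 "\<lambda>i. 0"] by simp
  show "L (\<lambda>i. a * x i) = a * L x" using *[of a x 0 x] by simp
  show "L (\<lambda>i. x i - y i) = L x - L y" using *[of 1 x "-1" y] by simp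
qed

lemma lin_bounded_sum:
  assumes "lin_bounded L"
  shows "L (\<lambda>i. \<Sum>k\<in>A. c k * x k i) = (\<Sum>k\<in>A. c k * L (x k))"
proof (induction A rule: infinite_finite_induct)
  case (insert k A)
  have "L (\<lambda>i. c k * x k i + 1 * (\<Sum>k\<in>A. c k * x k i)) = c k * L (x k) + 1 * L (\<lambda>i. \<Sum>k\<in>A. c k * x k i)"
    using assms[unfolded lin_bounded_def, THEN conjunct1, rule_format] .
  then show ?case using insert by simp
qed (simp_all add: lin_bounded_linear[OF assms])

lemma strict_deriv_const: "strict_deriv (\<lambda>x. a) (\<lambda>x. 0)"
  unfolding strict_deriv_def lin_bounded_def by (intro conjI exI[of _ 0]) auto

lemma strict_deriv_coord: "strict_deriv (\<lambda>x. x i) (\<lambda>x. x i)"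
proof -
  have "lin_bounded (\<lambda>x. x i)"
    unfolding lin_bounded_def by (intro conjI exI[of _ 1]) (auto simp: small_def)
  then show ?thesis unfolding strict_deriv_def by (intro conjI exI[of _ 0]) auto
qed

lemma lin_bounded_comb:
  assumes "lin_bounded L1" "lin_bounded L2"
  shows "lin_bounded (\<lambda>x. a * L1 x + b * L2 x)"
proof -
  obtain B1 where B1: "B1 \<ge> 0" "\<And>x t. small x t \<Longrightarrow> norm (L1 x) \<le> B1 * t"
    using assms(1) by (rule lin_boundedE) blast
  obtain B2 where B2: "B2 \<ge> 0" "\<And>x t. small x t \<Longrightarrow> norm (L2 x) \<le> B2 * t"
    using assms(2) by (rule lin_boundedE) blast
  note B = B1(1) B2(1) B1(2) B2(2)
  have lin: "L1 (\<lambda>i. c * x i + d * y i) = c * L1 x + d * L1 y" "L2 (\<lambda>i. c * x i + d * y i) = c * L2 x + d * L2 y"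
    for c d x y using assms by (auto simp: lin_bounded_def)
  have "norm (a * L1 x + b * L2 x) \<le> (norm a * B1 + norm b * B2) * t" if "small x t" for x t
  proof -
    have "norm (a * L1 x + b * L2 x) \<le> norm a * norm (L1 x) + norm b * norm (L2 x)"
      by (metis norm_mult norm_triangle_ineq)
    also have "\<dots> \<le> norm a * (B1 * t) + norm b * (B2 * t)"
      by (intro add_mono mult_left_mono B that) auto
    finally show ?thesis by (simp add: algebra_simps)
  qed
  then show ?thesis using B(1,2) unfolding lin_bounded_def
    by (intro conjI allI exI[of _ "norm a * B1 + norm b * B2"]) (auto simp: lin algebra_simps)
qed

lemma strict_deriv_add:
  assumes "strict_deriv g1 L1" "strict_deriv g2 L2"
  shows "strict_deriv (\<lambda>x. g1 x + g2 x) (\<lambda>x. L1 x + L2 x)"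
proof -
  have L: "lin_bounded (\<lambda>x. L1 x + L2 x)"
    using lin_bounded_comb[of L1 L2 1 1] assms by (simp add: strict_deriv_def)
  obtain C1 where C1: "C1 \<ge> 0"
    "\<And>x y \<delta> t. \<lbrakk>\<delta> \<le> 1; small x \<delta>; small y \<delta>; small (\<lambda>i. x i - y i) t\<rbrakk> \<Longrightarrow>
       norm (g1 x - g1 y - L1 (\<lambda>i. x i - y i)) \<le> C1 * \<delta> * t"
    using assms(1) by (rule strict_derivE) blast
  obtain C2 where C2: "C2 \<ge> 0"
    "\<And>x y \<delta> t. \<lbrakk>\<delta> \<le> 1; small x \<delta>; small y \<delta>; small (\<lambda>i. x i - y i) t\<rbrakk> \<Longrightarrow>
       norm (g2 x - g2 y - L2 (\<lambda>i. x i - y i)) \<le> C2 * \<delta> * t"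
    using assms(2) by (rule strict_derivE) blast
  note C = C1(1) C2(1) C1(2) C2(2)
  have "norm (g1 x + g2 x - (g1 y + g2 y) - (L1 (\<lambda>i. x i - y i) + L2 (\<lambda>i. x i - y i))) \<le> (C1 + C2) * \<delta> * t"
    if "\<delta> \<le> 1" "small x \<delta>" "small y \<delta>" "small (\<lambda>i. x i - y i) t" for x y \<delta> t
  proof -
    have "g1 x + g2 x - (g1 y + g2 y) - (L1 (\<lambda>i. x i - y i) + L2 (\<lambda>i. x i - y i)) =
       (g1 x - g1 y - L1 (\<lambda>i. x i - y i)) + (g2 x - g2 y - L2 (\<lambda>i. x i - y i))" by simp
    also have "norm \<dots> \<le> C1 * \<delta> * t + C2 * \<delta> * t"
      by (intro norm_triangle_mono C that)
    finally show ?thesis by (simp add: algebra_simps)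
  qed
  then show ?thesis using L C(1,2) unfolding strict_deriv_def by (intro conjI exI[of _ "C1 + C2"]) auto
qed

lemma strict_deriv_mult:
  assumes "strict_deriv g1 L1" "strict_deriv g2 L2"
  shows "strict_deriv (\<lambda>x. g1 x * g2 x) (\<lambda>x. g1 (\<lambda>i. 0) * L2 x + g2 (\<lambda>i. 0) * L1 x)"
proof -
  have L: "lin_bounded (\<lambda>x. g1 (\<lambda>i. 0) * L2 x + g2 (\<lambda>i. 0) * L1 x)"
    by (rule lin_bounded_comb) (use assms in \<open>simp_all add: strict_deriv_def\<close>)
  obtain C1 where C1: "C1 \<ge> 0"
    "\<And>x y \<delta> t. \<lbrakk>\<delta> \<le> 1; small x \<delta>; small y \<delta>; small (\<lambda>i. x i - y i) t\<rbrakk> \<Longrightarrow>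
       norm (g1 x - g1 y - L1 (\<lambda>i. x i - y i)) \<le> C1 * \<delta> * t"
    using assms(1) by (rule strict_derivE) blast
  obtain C2 where C2: "C2 \<ge> 0"
    "\<And>x y \<delta> t. \<lbrakk>\<delta> \<le> 1; small x \<delta>; small y \<delta>; small (\<lambda>i. x i - y i) t\<rbrakk> \<Longrightarrow>
       norm (g2 x - g2 y - L2 (\<lambda>i. x i - y i)) \<le> C2 * \<delta> * t"
    using assms(2) by (rule strict_derivE) blast
  note C = C1(1) C2(1) C1(2) C2(2)
  obtain B1 where B1: "B1 \<ge> 0" "\<And>x t. small x t \<Longrightarrow> norm (L1 x) \<le> B1 * t"
    using strict_derivD[OF assms(1)] by (rule lin_boundedE) blast
  obtain B2 where B2: "B2 \<ge> 0" "\<And>x t. small x t \<Longrightarrow> norm (L2 x) \<le> B2 * t"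
    using strict_derivD[OF assms(2)] by (rule lin_boundedE) blast
  note B = B1(1) B2(1) B1(2) B2(2)
  let ?a = "g1 (\<lambda>i. 0)" and ?b = "g2 (\<lambda>i. 0)"
  have dev: "norm (g1 x - ?a) \<le> (B1 + C1) * \<delta>" "norm (g2 x - ?b) \<le> (B2 + C2) * \<delta>"
    if "\<delta> \<le> 1" "small x \<delta>" for x \<delta>
  proof -
    have \<delta>: "0 \<le> \<delta>" using that small_nonneg by blast
    have z: "small (\<lambda>i. 0 :: 'a) \<delta>" using \<delta> by (simp add: small_def)
    have "norm (g1 x - ?a) \<le> norm (g1 x - ?a - L1 x) + norm (L1 x)"
      by (metis norm_triangle_sub add.commute)
    also have "\<dots> \<le> C1 * \<delta> * \<delta> + B1 * \<delta>"
      using C(3)[OF that z, of \<delta>] B(3)[OF that(2)] that(2) by (intro add_mono) simp_all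
    \<comment> \<open>The bound \<delta> \<le> 1 absorbs the quadratic remainder into a linear
      one.\<close>
    also have "\<dots> \<le> C1 * \<delta> * 1 + B1 * \<delta>" using that B C \<delta> by (intro add_mono mult_left_mono) auto
    finally show "norm (g1 x - ?a) \<le> (B1 + C1) * \<delta>" by (simp add: algebra_simps)
    have "norm (g2 x - ?b) \<le> norm (g2 x - ?b - L2 x) + norm (L2 x)"
      by (metis norm_triangle_sub add.commute)
    also have "\<dots> \<le> C2 * \<delta> * \<delta> + B2 * \<delta>"
      using C(4)[OF that z, of \<delta>] B(4)[OF that(2)] that(2) by (intro add_mono) simp_all
    also have "\<dots> \<le> C2 * \<delta> * 1 + B2 * \<delta>" using that B C \<delta> by (intro add_mono mult_left_mono) auto
    finally show "norm (g2 x - ?b) \<le> (B2 + C2) * \<delta>" by (simp add: algebra_simps)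
  qed
  have bnd: "norm (g1 x) \<le> norm ?a + (B1 + C1)" "norm (g2 x) \<le> norm ?b + (B2 + C2)"
    if "\<delta> \<le> 1" "small x \<delta>" for x \<delta>
  proof -
    have "small x 1" using that unfolding small_def by (meson order_trans)
    from dev[OF _ this] show "norm (g1 x) \<le> norm ?a + (B1 + C1)" "norm (g2 x) \<le> norm ?b + (B2 + C2)"
      using norm_triangle_sub[of "g1 x" ?a] norm_triangle_sub[of "g2 x" ?b] by simp_all
  qed
  define C where "C = C1 * (norm ?b + (B2 + C2)) + B1 * (B2 + C2) + (norm ?a + (B1 + C1)) * C2 + (B1 + C1) * B2"
  have "C \<ge> 0" unfolding C_def using B C by (intro add_nonneg_nonneg mult_nonneg_nonneg) auto
  moreover have "norm (g1 x * g2 x - g1 y * g2 y - (?a * L2 (\<lambda>i. x i - y i) + ?b * L1 (\<lambda>i. x i - y i))) \<le> C * \<delta> * t"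
    if *: "\<delta> \<le> 1" "small x \<delta>" "small y \<delta>" "small (\<lambda>i. x i - y i) t" for x y \<delta> t
  proof -
    let ?d = "\<lambda>i. x i - y i"
    have nn: "0 \<le> \<delta>" "0 \<le> t" using * small_nonneg by blast+
    \<comment> \<open>The product error splits into four terms. Each is either a remainder times a
      bounded factor, or an increment of size t times a deviation from the value at 0 of size
      \<delta>, up to constants.\<close>
    have "norm ((g1 x - g1 y - L1 ?d) * g2 x) \<le> (C1 * \<delta> * t) * (norm ?b + (B2 + C2))"
      unfolding norm_mult using C nn * bnd by (intro mult_mono) auto
    moreover have "norm (L1 ?d * (g2 x - ?b)) \<le> (B1 * t) * ((B2 + C2) * \<delta>)"
      unfolding norm_mult using B nn * dev by (intro mult_mono) auto
    moreover have "norm (g1 y * (g2 x - g2 y - L2 ?d)) \<le> (norm ?a + (B1 + C1)) * (C2 * \<delta> * t)"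
      unfolding norm_mult using B C nn * bnd by (intro mult_mono) auto
    moreover have "norm ((g1 y - ?a) * L2 ?d) \<le> ((B1 + C1) * \<delta>) * (B2 * t)"
      unfolding norm_mult using B C nn * dev by (intro mult_mono) auto
    ultimately have "norm ((g1 x - g1 y - L1 ?d) * g2 x) + norm (L1 ?d * (g2 x - ?b)) +
        norm (g1 y * (g2 x - g2 y - L2 ?d)) + norm ((g1 y - ?a) * L2 ?d) \<le> C * \<delta> * t"
      unfolding C_def by (simp add: algebra_simps)
    moreover have "g1 x * g2 x - g1 y * g2 y - (?a * L2 ?d + ?b * L1 ?d) =
        (g1 x - g1 y - L1 ?d) * g2 x + L1 ?d * (g2 x - ?b) + g1 y * (g2 x - g2 y - L2 ?d) + (g1 y - ?a) * L2 ?d"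
      by (simp add: algebra_simps)
    ultimately show ?thesis
      using norm_triangle_ineq order_trans by (smt (verit, best))
  qed
  ultimately show ?thesis using L unfolding strict_deriv_def by blast
qed

lemma strict_deriv_sum:
  assumes "\<And>k. k \<in> A \<Longrightarrow> strict_deriv (g k) (L k)"
  shows "strict_deriv (\<lambda>x. \<Sum>k\<in>A. g k x) (\<lambda>x. \<Sum>k\<in>A. L k x)"
  using assms
proof (induction A rule: infinite_finite_induct)
  case (insert k A)
  then show ?case using strict_deriv_add[of "g k" "L k" "\<lambda>x. \<Sum>k\<in>A. g k x"] by simp
qed (simp_all add: strict_deriv_const)

text \<open>Gaussian elimination, by induction on the unknowns: injectivity provides a pivot row
  \<open>i0\<close> for column \<open>j\<close>, and it passes to the reduced system
  \<open>A'\<close> because a kernel vector of \<open>A'\<close> extends to one of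
  \<open>A\<close>.\<close>

lemma injective_imp_solvable:
  fixes A :: "'i \<Rightarrow> 'j \<Rightarrow> 'a::field"
  assumes "finite J" "finite I" "card I = card J"
    and "\<And>x. (\<And>i. i \<in> I \<Longrightarrow> (\<Sum>k\<in>J. A i k * x k) = 0) \<Longrightarrow> (\<forall>k\<in>J. x k = 0)"
  shows "\<exists>x. \<forall>i\<in>I. (\<Sum>k\<in>J. A i k * x k) = v i"
  using assms
proof (induction J arbitrary: I A v rule: finite_induct)
  case empty
  then show ?case by simp
next
  case (insert j J)
  have sum_upd: "(\<Sum>k\<in>insert j J. A i k * (x(j := a)) k) = A i j * a + (\<Sum>k\<in>J. A i k * x k)" for i x a
    using insert.hyps by (simp, intro sum.cong) auto
  have "\<exists>i0\<in>I. A i0 j \<noteq> 0"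
  proof (rule ccontr)
    assume "\<not> ?thesis"
    then have "(\<Sum>k\<in>insert j J. A i k * ((\<lambda>_. 0)(j := 1)) k) = 0" if "i \<in> I" for i
      unfolding sum_upd using that by simp
    from insert.prems(3)[OF this] show False by (auto split: if_splits)
  qed
  then obtain i0 where i0: "i0 \<in> I" "A i0 j \<noteq> 0" by blast
  define A' where "A' = (\<lambda>i k. A i k - A i j * A i0 k / A i0 j)"
  have A': "(\<Sum>k\<in>J. A' i k * x k) = (\<Sum>k\<in>J. A i k * x k) - A i j / A i0 j * (\<Sum>k\<in>J. A i0 k * x k)" for i x
  proof -
    have "A' i k * x k = A i k * x k - A i j / A i0 j * (A i0 k * x k)" for k
      by (simp add: A'_def algebra_simps)
    then show ?thesis by (simp only: sum_subtractf sum_distrib_left)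
  qed
  have "\<exists>x. \<forall>i\<in>I - {i0}. (\<Sum>k\<in>J. A' i k * x k) = v i - A i j / A i0 j * v i0"
  proof (rule insert.IH)
    fix x assume x: "\<And>i. i \<in> I - {i0} \<Longrightarrow> (\<Sum>k\<in>J. A' i k * x k) = 0"
    let ?x = "x(j := - (\<Sum>k\<in>J. A i0 k * x k) / A i0 j)"
    have "(\<Sum>k\<in>insert j J. A i k * ?x k) = 0" if "i \<in> I" for i
    proof (cases "i = i0")
      case False
      with x[of i] that show ?thesis unfolding sum_upd A' by simp
    qed (unfold sum_upd, use i0 in simp)
    from insert.prems(3)[OF this] have "\<forall>k\<in>insert j J. ?x k = 0" by blast
    then show "\<forall>k\<in>J. x k = 0" using insert.hyps by (metis fun_upd_other insertCI)
  qed (use insert i0 in auto)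
  then obtain x where x: "\<And>i. i \<in> I - {i0} \<Longrightarrow> (\<Sum>k\<in>J. A' i k * x k) = v i - A i j / A i0 j * v i0"
    by blast
  let ?x = "x(j := (v i0 - (\<Sum>k\<in>J. A i0 k * x k)) / A i0 j)"
  have "(\<Sum>k\<in>insert j J. A i k * ?x k) = v i" if "i \<in> I" for i
  proof (cases "i = i0")
    case False
    with x[of i] that show ?thesis unfolding sum_upd A' by (simp add: algebra_simps diff_divide_distrib)
  qed (unfold sum_upd, use i0 in simp)
  then show ?case by blast
qed

text \<open>Newton's iteration with the derivative frozen at 0, T x = x - S (g x - w), contracts a
  small ball by the factor 1/2; its fixed point solves g = w. The target \<open>w\<close> is a small
  positive \<open>r\<close> at \<open>i1\<close> and 0 elsewhere.\<close>

lemma strict_deriv_local_solution: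
  fixes g :: "'i \<Rightarrow> (nat \<Rightarrow> 'a::{real_normed_field, banach}) \<Rightarrow> 'a"
  assumes fin: "finite J" "finite I" "card I = card J" and i1: "i1 \<in> I"
    and g: "\<And>i. i \<in> I \<Longrightarrow> strict_deriv (g i) (L i)" and g0: "\<And>i. i \<in> I \<Longrightarrow> g i (\<lambda>_. 0) = 0"
    and inj: "\<And>x. (\<And>k. k \<notin> J \<Longrightarrow> x k = 0) \<Longrightarrow> (\<And>i. i \<in> I \<Longrightarrow> L i x = 0) \<Longrightarrow> x = (\<lambda>_. 0)"
  shows "\<exists>x s. s \<noteq> 0 \<and> (\<forall>k. k \<notin> J \<longrightarrow> x k = 0) \<and> (\<forall>i\<in>I. g i x = (if i = i1 then s else 0))"
proof -
  have L: "lin_bounded (L i)" if "i \<in> I" for i using g[OF that] by (simp add: strict_deriv_def)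
  have expand: "(\<lambda>k. if k \<in> J then x k else 0) = (\<lambda>k. \<Sum>j\<in>J. x j * of_bool (k = j))" for x :: "nat \<Rightarrow> 'a"
  proof
    fix k
    have "(\<Sum>j\<in>J. x j * of_bool (k = j)) = (\<Sum>j\<in>J. if k = j then x k else 0)"
      by (intro sum.cong) auto
    then show "(if k \<in> J then x k else 0) = (\<Sum>j\<in>J. x j * of_bool (k = j))"
      using fin by simp
  qed
  have L_expand: "L i (\<lambda>k. if k \<in> J then x k else 0) = (\<Sum>j\<in>J. L i (\<lambda>k. of_bool (k = j)) * x j)" if "i \<in> I" for i x
    unfolding expand lin_bounded_sum[OF L[OF that]] by (simp add: mult.commute)
  have "\<exists>x. \<forall>i\<in>I. (\<Sum>j\<in>J. L i (\<lambda>k. of_bool (k = j)) * x j) = v i" for v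
  proof (rule injective_imp_solvable[OF fin])
    fix x :: "nat \<Rightarrow> 'a" assume "\<And>i. i \<in> I \<Longrightarrow> (\<Sum>j\<in>J. L i (\<lambda>k. of_bool (k = j)) * x j) = 0"
    then have "(\<lambda>k. if k \<in> J then x k else 0) = (\<lambda>_. 0)"
      by (intro inj) (simp_all add: L_expand)
    then show "\<forall>k\<in>J. x k = 0" by (metis (full_types))
  qed
  then have "\<exists>X. \<forall>l. \<forall>i\<in>I. (\<Sum>j\<in>J. L i (\<lambda>k. of_bool (k = j)) * X l j) = of_bool (i = l)"
    by (intro choice) auto
  then obtain X where X: "\<And>l i. i \<in> I \<Longrightarrow> (\<Sum>j\<in>J. L i (\<lambda>k. of_bool (k = j)) * X l j) = of_bool (i = l)"
    by blast
  \<comment> \<open>Inverse of the derivative on sequences supported in \<open>J\<close>, assembled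
    from the solutions \<open>X l\<close> for unit right-hand sides.\<close>
  define S where "S = (\<lambda>v k. if k \<in> J then (\<Sum>l\<in>I. v l * X l k) else 0)"
  have S_diff: "S (\<lambda>i. a i - b i) k = S a k - S b k" for a b k
    by (simp add: S_def left_diff_distrib sum_subtractf)
  have LS: "L i (S v) = v i" if "i \<in> I" for i v
  proof -
    have "L i (S v) = (\<Sum>j\<in>J. \<Sum>l\<in>I. v l * (L i (\<lambda>k. of_bool (k = j)) * X l j))"
      unfolding S_def L_expand[OF that] by (simp add: sum_distrib_left mult_ac)
    also have "\<dots> = (\<Sum>l\<in>I. v l * of_bool (i = l))"
      by (subst sum.swap) (simp add: sum_distrib_left[symmetric] X[OF that])
    also have "\<dots> = (\<Sum>l\<in>I. if i = l then v l else 0)" by (intro sum.cong) auto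
    finally show ?thesis using that fin by simp
  qed
  have SL: "S (\<lambda>i. L i x) = x" if x: "\<And>k. k \<notin> J \<Longrightarrow> x k = 0" for x
  proof -
    have "(\<lambda>k. S (\<lambda>i. L i x) k - x k) = (\<lambda>_. 0)"
    proof (rule inj)
      show "S (\<lambda>i. L i x) k - x k = 0" if "k \<notin> J" for k using that x by (simp add: S_def)
      show "L i (\<lambda>k. S (\<lambda>i. L i x) k - x k) = 0" if "i \<in> I" for i
        using lin_bounded_linear(3)[OF L[OF that], of "S (\<lambda>i. L i x)" x] LS[OF that, of "\<lambda>i. L i x"] by simp
    qed
    then show ?thesis by (auto simp: fun_eq_iff)
  qed
  define \<beta> where "\<beta> = (\<Sum>k\<in>J. \<Sum>l\<in>I. norm (X l k))"
  have \<beta>: "\<beta> \<ge> 0" unfolding \<beta>_def by (intro sum_nonneg) auto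
  have S_bound: "norm (S v k) \<le> \<beta> * t" if v: "\<And>l. l \<in> I \<Longrightarrow> norm (v l) \<le> t" and t: "t \<ge> 0" for v k t
  proof (cases "k \<in> J")
    case True
    have "norm (S v k) \<le> (\<Sum>l\<in>I. norm (v l * X l k))" using True by (simp add: S_def norm_sum)
    also have "\<dots> \<le> (\<Sum>l\<in>I. t * norm (X l k))" by (intro sum_mono) (simp add: norm_mult mult_right_mono v)
    also have "\<dots> = t * (\<Sum>l\<in>I. norm (X l k))" by (simp add: sum_distrib_left)
    also have "\<dots> \<le> t * \<beta>"
      unfolding \<beta>_def using True fin t by (intro mult_left_mono member_le_sum sum_nonneg) auto
    finally show ?thesis by (simp add: mult.commute)
  qed (use \<beta> t in \<open>simp add: S_def\<close>)
  have "\<exists>C\<ge>0. \<forall>x y \<delta> t. \<delta> \<le> 1 \<longrightarrow> small x \<delta> \<longrightarrow> small y \<delta> \<longrightarrow> small (\<lambda>i. x i - y i) t \<longrightarrow>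
        norm (g i x - g i y - L i (\<lambda>i. x i - y i)) \<le> C * \<delta> * t" if "i \<in> I" for i
    using g[OF that] by (simp add: strict_deriv_def)
  then obtain C0 where C0: "\<And>i. i \<in> I \<Longrightarrow> C0 i \<ge> 0" and "\<And>i. i \<in> I \<Longrightarrow> \<forall>x y \<delta> t. \<delta> \<le> 1 \<longrightarrow> small x \<delta> \<longrightarrow> small y \<delta> \<longrightarrow> small (\<lambda>i. x i - y i) t \<longrightarrow>
        norm (g i x - g i y - L i (\<lambda>i. x i - y i)) \<le> C0 i * \<delta> * t"
    by metis
  note C0' = this(2)[rule_format]
  define C where "C = (\<Sum>i\<in>I. C0 i)"
  have C: "C \<ge> 0" unfolding C_def by (intro sum_nonneg C0)
  have g_bound: "norm (g i x - g i y - L i (\<lambda>i. x i - y i)) \<le> C * \<delta> * t"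
    if "i \<in> I" "\<delta> \<le> 1" "small x \<delta>" "small y \<delta>" "small (\<lambda>i. x i - y i) t" for i x y \<delta> t
  proof -
    have "C0 i \<le> C" unfolding C_def using that fin C0 by (intro member_le_sum) auto
    then have "C0 i * \<delta> * t \<le> C * \<delta> * t"
      using that small_nonneg by (intro mult_right_mono) auto
    then show ?thesis using C0'[OF that] by linarith
  qed
  \<comment> \<open>The radius makes the contraction factor \<beta> C \<delta> at most 1/2. The
    choice of \<open>r\<close> below makes the first step at most \<delta>/2, so that the ball is
    mapped into itself.\<close>
  define \<delta> where "\<delta> = 1 / (2 * (\<beta> * C + 1))"
  have "\<beta> * C \<ge> 0" using \<beta> C by simp
  then have \<delta>: "0 < \<delta>" "\<delta> \<le> 1" "\<beta> * (C * \<delta>) \<le> 1 / 2"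
    by (auto simp: \<delta>_def divide_simps)
  define r where "r = \<delta> / (2 * (\<beta> + 1))"
  have r: "0 < r" "\<beta> * r \<le> \<delta> / 2" using \<delta> \<beta> by (auto simp: r_def divide_simps)
  define w :: "'i \<Rightarrow> 'a" where "w = (\<lambda>i. if i = i1 then of_real r else 0)"
  \<comment> \<open>\<open>S\<close> inverts the derivative only on sequences supported in
    \<open>J\<close>; truncating first lets \<open>T\<close> act on all sequences.\<close>
  define cut where "cut = (\<lambda>(x :: nat \<Rightarrow> 'a) k. if k \<in> J then x k else 0)"
  define T where "T = (\<lambda>x k. cut x k - S (\<lambda>i. g i (cut x) - w i) k)"
  have cut0: "cut x k = 0" if "k \<notin> J" for x k using that by (simp add: cut_def)
  have cut_small: "small (cut x) t" if "small x t" for x t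
    using that small_nonneg[OF that] by (auto simp: small_def cut_def)
  have T_diff: "norm (T x k - T y k) \<le> t / 2"
    if "small x \<delta>" "small y \<delta>" "small (\<lambda>i. x i - y i) t" for x y t k
  proof -
    let ?d = "\<lambda>i. cut x i - cut y i"
    have t: "t \<ge> 0" using that small_nonneg by blast
    have d: "small ?d t" using that(3) t by (auto simp: cut_def small_def)
    have "T x k - T y k = S (\<lambda>i. L i ?d) k - S (\<lambda>i. g i (cut x) - g i (cut y)) k"
      using SL[of ?d] cut0 by (simp add: T_def S_diff)
    also have "\<dots> = S (\<lambda>i. - (g i (cut x) - g i (cut y) - L i ?d)) k"
      by (simp add: S_diff[symmetric])
    also have "norm \<dots> \<le> \<beta> * (C * \<delta> * t)"
      using g_bound[OF _ \<delta>(2) cut_small cut_small d] that C \<delta> t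
      by (intro S_bound) (auto simp only: norm_minus_cancel intro!: mult_nonneg_nonneg)
    also have "\<dots> = (\<beta> * (C * \<delta>)) * t" by simp
    also have "\<dots> \<le> 1 / 2 * t" using \<delta>(3) t by (rule mult_right_mono)
    finally show ?thesis by simp
  qed
  have T0: "norm (T (\<lambda>_. 0) k) \<le> \<delta> / 2" for k
  proof -
    have "cut (\<lambda>_. 0) = (\<lambda>_. 0)" by (auto simp: cut_def)
    then have "T (\<lambda>_. 0) k = - S (\<lambda>i. g i (\<lambda>_. 0) - w i) k" by (simp add: T_def)
    also have "norm \<dots> \<le> \<beta> * r"
      unfolding norm_minus_cancel using r g0 by (intro S_bound) (auto simp: w_def)
    finally show ?thesis using r by simp
  qed
  have T_small: "small (T x) \<delta>" if "small x \<delta>" for x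
    unfolding small_def
  proof
    fix k
    have z: "small (\<lambda>_. 0 :: 'a) \<delta>" using \<delta> by (simp add: small_def)
    have "norm (T x k - T (\<lambda>_. 0) k) \<le> \<delta> / 2" using that z by (intro T_diff) simp_all
    then show "norm (T x k) \<le> \<delta>" using T0[of k] norm_triangle_sub[of "T x k" "T (\<lambda>_. 0) k"] by linarith
  qed
  define X0 where "X0 = (\<lambda>n. (T ^^ n) (\<lambda>_. 0))"
  have X0_Suc: "X0 (Suc n) = T (X0 n)" for n by (simp add: X0_def)
  have X0_small: "small (X0 n) \<delta>" for n
    using T_small \<delta> by (induction n) (simp_all add: X0_Suc, simp add: X0_def small_def)
  have X0_step: "norm (X0 (Suc n) k - X0 n k) \<le> \<delta> * (1 / 2) ^ Suc n" for n k
  proof (induction n arbitrary: k)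
    case 0
    then show ?case using T0[of k] by (simp add: X0_def)
  next
    case (Suc n)
    have "norm (T (X0 (Suc n)) k - T (X0 n) k) \<le> \<delta> * (1 / 2) ^ Suc n / 2"
      using Suc by (intro T_diff X0_small) (auto simp: small_def)
    then show ?case by (simp add: X0_Suc)
  qed
  have dist: "norm (X0 m k - X0 n k) \<le> \<delta> * ((1 / 2) ^ n - (1 / 2) ^ m)" if "n \<le> m" for m n k
    using that
  proof (induction m rule: dec_induct)
    case (step m)
    have "norm (X0 (Suc m) k - X0 n k) \<le> norm (X0 (Suc m) k - X0 m k) + norm (X0 m k - X0 n k)"
      using norm_triangle_ineq[of "X0 (Suc m) k - X0 m k" "X0 m k - X0 n k"] by simp
    also have "\<dots> \<le> \<delta> * (1 / 2) ^ Suc m + \<delta> * ((1 / 2) ^ n - (1 / 2) ^ m)"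
      by (intro add_mono step.IH X0_step)
    finally show ?case by (simp add: algebra_simps)
  qed simp
  have dist': "norm (X0 m k - X0 n k) \<le> \<delta> * (1 / 2) ^ n" if "n \<le> m" for m n k
  proof -
    have "\<delta> * ((1 / 2) ^ n - (1 / 2) ^ m) \<le> \<delta> * (1 / 2) ^ n"
      using \<delta> by (intro mult_left_mono) auto
    then show ?thesis using dist[OF that, of k] by linarith
  qed
  have half: "(\<lambda>n. \<delta> * (1 / 2) ^ n) \<longlonglongrightarrow> 0"
    by (intro tendsto_mult_right_zero LIMSEQ_power_zero) simp
  have "Cauchy (\<lambda>n. X0 n k)" for k
  proof (rule metric_CauchyI)
    fix e :: real assume "e > 0"
    from order_tendstoD(2)[OF half half_gt_zero[OF \<open>e > 0\<close>]] obtain N where N: "\<delta> * (1 / 2) ^ N < e / 2"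
      by (auto simp: eventually_sequentially)
    have "dist (X0 m k) (X0 n k) < e" if "m \<ge> N" "n \<ge> N" for m n
      using dist'[OF that(1), of k] dist'[OF that(2), of k] N
        dist_triangle2[of "X0 m k" "X0 n k" "X0 N k"] by (simp add: dist_norm)
    then show "\<exists>N. \<forall>m\<ge>N. \<forall>n\<ge>N. dist (X0 m k) (X0 n k) < e" by blast
  qed
  then have "\<exists>x. \<forall>k. (\<lambda>n. X0 n k) \<longlonglongrightarrow> x k"
    by (intro choice allI) (metis Cauchy_convergent convergent_def)
  then obtain x where lim: "\<And>k. (\<lambda>n. X0 n k) \<longlonglongrightarrow> x k" by blast
  have x_dist: "norm (x k - X0 n k) \<le> \<delta> * (1 / 2) ^ n" for n k
    by (rule LIMSEQ_le_const2[OF tendsto_norm[OF tendsto_diff[OF lim tendsto_const]]]) (use dist' in blast)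
  have x_small: "small x \<delta>" using x_dist[of _ 0] by (simp add: small_def X0_def)
  have fix_T: "T x = x"
  proof
    fix k
    have "norm (T x k - X0 (Suc n) k) \<le> \<delta> * (1 / 2) ^ Suc n" for n
      using T_diff[OF x_small X0_small, of n "\<delta> * (1 / 2) ^ n" k] x_dist by (simp add: X0_Suc small_def)
    then have "(\<lambda>n. X0 (Suc n) k - T x k) \<longlonglongrightarrow> 0"
      using half by (intro tendsto_0_le[OF LIMSEQ_Suc[OF half], of _ 1] always_eventually)
        (use \<delta> in \<open>simp add: norm_minus_commute abs_mult\<close>)
    then have "(\<lambda>n. X0 (Suc n) k) \<longlonglongrightarrow> T x k" by (simp add: LIM_zero_iff)
    from LIMSEQ_unique[OF this LIMSEQ_Suc[OF lim]] show "T x k = x k" .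
  qed
  have x0: "x k = 0" if "k \<notin> J" for k
    using that fix_T[symmetric, THEN fun_cong, of k] by (simp add: T_def cut_def S_def)
  then have cutx: "cut x = x" by (auto simp: cut_def)
  have "S (\<lambda>i. g i x - w i) = (\<lambda>_. 0)"
    using fix_T unfolding T_def cutx by (auto simp: fun_eq_iff)
  then have "g i x - w i = 0" if "i \<in> I" for i
    using LS[OF that, of "\<lambda>i. g i x - w i"] lin_bounded_linear(1)[OF L[OF that]] by simp
  then show ?thesis
    using x0 r by (intro exI[of _ x] exI[of _ "of_real r"]) (auto simp: w_def)
qed

section \<open>The unperturbed integrable system\<close>

lemma alternating_choose_choose_sum:
  assumes "k < a"
  shows "(\<Sum>t\<le>a. (-1) ^ t * of_nat ((a choose t) * (t choose k))) = (0 :: 'a::comm_ring_1)"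
proof -
  have "(\<Sum>t\<le>a. (-1) ^ t * of_nat ((a choose t) * (t choose k))) =
      (\<Sum>t=k..a. (-1) ^ t * of_nat ((a choose k) * ((a - k) choose (t - k))) :: 'a)"
    by (intro sum.mono_neutral_cong_right) (auto simp: choose_mult binomial_eq_0 not_le)
  also have "\<dots> = (\<Sum>s\<le>a - k. (-1) ^ (s + k) * of_nat ((a choose k) * ((a - k) choose s)))"
    using assms by (intro sum.reindex_bij_witness[of _ "\<lambda>s. s + k" "\<lambda>t. t - k"]) auto
  also have "\<dots> = (-1) ^ k * of_nat (a choose k) * (\<Sum>s\<le>a - k. (-1) ^ s * of_nat ((a - k) choose s))"
    by (simp add: sum_distrib_left power_add mult_ac)
  also have "(\<Sum>s\<le>a - k. (-1) ^ s * of_nat ((a - k) choose s)) = (0 :: 'a)"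
    by (rule choose_alternating_sum) (use assms in simp)
  finally show ?thesis by simp
qed

lemma alternating_choose_choose_sum':
  assumes "k < a"
  shows "(\<Sum>t=1..a. (-1) ^ t * of_nat ((a choose t) * (t choose Suc k))) =
    (if Suc k < a then 0 else (-1) ^ a :: 'a::comm_ring_1)"
proof -
  have "(\<Sum>t=1..a. (-1) ^ t * of_nat ((a choose t) * (t choose Suc k))) =
      (\<Sum>t\<le>a. (-1) ^ t * of_nat ((a choose t) * (t choose Suc k)) :: 'a)"
    by (intro sum.mono_neutral_left) (auto simp: not_less_eq_eq)
  also have "\<dots> = (if Suc k < a then 0 else (-1) ^ a)"
  proof (cases "Suc k < a")
    case False
    then have "a = Suc k" using assms by simp
    then have "(\<Sum>t\<le>a. (-1) ^ t * of_nat ((a choose t) * (t choose Suc k)) :: 'a) =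
        (\<Sum>t\<in>{a}. (-1) ^ t * of_nat ((a choose t) * (t choose Suc k)))"
      by (intro sum.mono_neutral_right) (auto simp: binomial_eq_0)
    then show ?thesis using False \<open>a = Suc k\<close> by simp
  qed (use alternating_choose_choose_sum[of "Suc k" a] in simp)
  finally show ?thesis .
qed

text \<open>Pascal's rule reduces the case \<open>Suc k\<close> to the case \<open>k\<close> and to
  the preceding lemma. The shifted upper index comes from the expansion of (1 - z)^-c, whose
  coefficients are those of the first integral.\<close>

lemma alternating_choose_pred_choose_sum:
  "k < a \<Longrightarrow>
    (\<Sum>t=1..a. (-1) ^ t * of_nat ((a choose t) * ((t - 1) choose k))) = (- 1 :: 'a::comm_ring_1) ^ Suc k"
proof (induction k)
  case 0
  have "(\<Sum>t\<le>a. (-1) ^ t * of_nat (a choose t)) = 1 + (\<Sum>t=1..a. (-1) ^ t * of_nat (a choose t) :: 'a)"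
    by (simp add: atMost_atLeast0 sum.atLeast_Suc_atMost)
  then have "1 + (\<Sum>t=1..a. (-1) ^ t * of_nat (a choose t)) = (0 :: 'a)"
    using choose_alternating_sum[of a, where 'a = 'a] 0 by simp
  then have "(\<Sum>t=1..a. (-1) ^ t * of_nat (a choose t)) = (- 1 :: 'a)"
    by (simp only: add_eq_0_iff)
  then show ?case by simp
next
  case (Suc k)
  have "(t - 1) choose Suc k = (t choose Suc k) - ((t - 1) choose k)" "(t - 1) choose k \<le> t choose Suc k"
    if "1 \<le> t" for t
    using that by (cases t; simp)+
  then have "(\<Sum>t=1..a. (-1) ^ t * of_nat ((a choose t) * ((t - 1) choose Suc k))) =
      (\<Sum>t=1..a. (-1) ^ t * of_nat ((a choose t) * (t choose Suc k)) -
         (-1) ^ t * of_nat ((a choose t) * ((t - 1) choose k)) :: 'a)"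
    by (intro sum.cong) (auto simp: of_nat_diff algebra_simps)
  also have "\<dots> = - ((-1) ^ Suc k)"
    using Suc alternating_choose_choose_sum'[of k a, where 'a = 'a] by (simp add: sum_subtractf)
  finally show ?case by simp
qed

section \<open>The Bernoulli system and its first integral\<close>

definition var_u :: "'a::field_char_0 poly" where
  "var_u = [:0, 1:]"

lemma var_u_mult: "pCons 0 G = var_u * G"
  by (simp add: var_u_def)

text \<open>For h = 0 the equation of 1/\<rho> is linear. This is the \<open>f\<close> for which
  1/\<rho> - F(u) is an eigenfunction, with eigenvalue -p d.\<close>

definition bernoulli_poly :: "nat \<Rightarrow> nat \<Rightarrow> nat \<Rightarrow> 'a::field_char_0 poly \<Rightarrow> 'a poly" where
  "bernoulli_poly p q d F =
     smult (of_nat (p + q) / of_nat d) (pCons 0 (pderiv F)) - smult (of_nat p) F"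

text \<open>
  The series \<open>\<rho>\<^bsup>c\<^esup> u\<^bsup>p d\<^esup> (1 - \<rho> F u)\<^bsup>-c\<^esup>\<close> with \<open>c = p + q\<close>.
\<close>

definition base_integral :: "nat \<Rightarrow> nat \<Rightarrow> nat \<Rightarrow> 'a::field_char_0 poly \<Rightarrow> nat \<Rightarrow> 'a poly" where
  "base_integral p q d F m = (if m < p + q then 0
     else of_nat ((m - 1) choose (p + q - 1)) * (F ^ (m - (p + q)) * var_u ^ (p * d)))"

lemma lin_op_eq:
  "lin_op p q d m G = of_nat (p * d * m) * G - of_nat (p + q) * (var_u * pderiv G)"
  by (simp add: lin_op_def of_nat_mult_conv_smult var_u_mult del: of_nat_mult of_nat_add)

lemma bernoulli_poly_eq:
  assumes "0 < d"
  shows "of_nat d * bernoulli_poly p q d F =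
    of_nat (p + q) * (var_u * pderiv F) - of_nat (d * p) * F"
  using assms
  by (simp add: bernoulli_poly_def of_nat_mult_conv_smult smult_diff_right var_u_mult del: of_nat_add)

lemma nonlin_op_bernoulli:
  assumes "0 < d"
  shows "nonlin_op d (bernoulli_poly p q d F) 0 m G =
    of_nat m * ((of_nat (p + q) * (var_u * pderiv F) - of_nat (d * p) * F) * G)"
proof -
  have "nonlin_op d (bernoulli_poly p q d F) 0 m G = of_nat m * ((of_nat d * bernoulli_poly p q d F) * G)"
    unfolding nonlin_op_def of_nat_mult_conv_smult[symmetric] by (simp add: mult_ac)
  then show ?thesis unfolding bernoulli_poly_eq[OF assms] .
qed

lemma pderiv_of_nat_mult: "pderiv (of_nat k * G) = of_nat k * pderiv G"
  by (simp add: of_nat_mult_conv_smult pderiv_smult)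

lemma var_pderiv_power:
  "var_u * pderiv (F ^ k) = of_nat k * (F ^ (k - 1) * (var_u * pderiv F))"
  by (simp add: pderiv_power of_nat_mult_conv_smult mult_ac)

lemma var_pderiv_var_power:
  "var_u * pderiv (var_u ^ k) = of_nat k * var_u ^ k"
proof -
  have D: "pderiv var_u = (1 :: 'a poly)" by (simp add: var_u_def pderiv_pCons)
  show ?thesis
  proof (cases "k = 0")
    case False
    then show ?thesis
      by (simp only: var_pderiv_power D mult_1_right power_minus_mult neq0_conv)
  qed simp
qed

text \<open>The series is (1/\<rho> - F)^-c u^(pd) with c = p + q, of eigenvalue c p d - p d c = 0.
  In terms of coefficients this is the absorption identity for binomials.\<close>

lemma base_integral_eqn:
  assumes "0 < d" "0 < p + q"
  shows "lin_op p q d (Suc m) (base_integral p q d F (Suc m)) +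
     nonlin_op d (bernoulli_poly p q d F) 0 m (base_integral p q d F m) = 0"
proof -
  let ?u = "var_u :: 'a poly" and ?c = "p + q"
  consider "Suc m < ?c" | "Suc m = ?c" | k where "m = ?c + k"
    by (meson le_iff_add not_less_eq_eq linorder_le_less_linear less_antisym not_less)
  then show ?thesis
  proof cases
    case 1
    then show ?thesis by (simp add: base_integral_def lin_op_eq nonlin_op_def)
  next
    case 2
    then have "base_integral p q d F (Suc m) = ?u ^ (p * d)" "base_integral p q d F m = 0"
      by (simp_all add: base_integral_def)
    moreover have "p * d * Suc m = ?c * (p * d)" unfolding 2 by simp
    ultimately show ?thesis
      unfolding lin_op_eq by (simp only: var_pderiv_var_power of_nat_mult) (simp add: nonlin_op_def)
  next
    case 3
    let ?W = "?u ^ (p * d)" and ?D = "?u * pderiv F"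
    have K: "base_integral p q d F m = of_nat ((m - 1) choose (?c - 1)) * (F ^ k * ?W)"
      using 3 by (simp add: base_integral_def)
    have K1: "base_integral p q d F (Suc m) = of_nat (m choose (?c - 1)) * (F ^ Suc k * ?W)"
      using 3 by (simp add: base_integral_def Suc_diff_le)
    have D: "?u * pderiv (F ^ Suc k * ?W) = of_nat (Suc k) * (F ^ k * ?D) * ?W + F ^ Suc k * (of_nat (p * d) * ?W)"
    proof -
      have "?u * pderiv (F ^ Suc k * ?W) = (?u * pderiv (F ^ Suc k)) * ?W + F ^ Suc k * (?u * pderiv ?W)"
        by (simp only: pderiv_mult) (simp add: algebra_simps)
      then show ?thesis unfolding var_pderiv_power[of F] var_pderiv_var_power by simp
    qed
    have "(m - (?c - 1)) * (m choose (?c - 1)) = m * ((m - 1) choose (?c - 1))"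
      by (rule binomial_absorb_comp)
    moreover have "m - (?c - 1) = Suc k" using 3 assms(2) by arith
    ultimately have "(m choose (?c - 1)) * Suc k = m * ((m - 1) choose (?c - 1))"
      by (simp only: mult.commute)
    then have B: "of_nat (m choose (?c - 1)) * of_nat (Suc k) =
        (of_nat m * of_nat ((m - 1) choose (?c - 1)) :: 'a poly)"
      by (simp only: of_nat_mult[symmetric])
    have A: "lin_op p q d (Suc m) (F ^ Suc k * ?W) =
        of_nat (Suc k) * ((of_nat (d * p) * F - of_nat ?c * ?D) * (F ^ k * ?W))"
      unfolding lin_op_eq D by (simp add: 3 algebra_simps)
    have "lin_op p q d (Suc m) (base_integral p q d F (Suc m)) =
        of_nat (m choose (?c - 1)) * lin_op p q d (Suc m) (F ^ Suc k * ?W)"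
      unfolding K1 lin_op_eq pderiv_of_nat_mult by (simp only: right_diff_distrib mult_ac)
    also have "\<dots> = of_nat (m choose (?c - 1)) * of_nat (Suc k) * ((of_nat (d * p) * F - of_nat ?c * ?D) * (F ^ k * ?W))"
      unfolding A by (simp only: mult.assoc)
    finally have lin: "lin_op p q d (Suc m) (base_integral p q d F (Suc m)) =
        of_nat m * of_nat ((m - 1) choose (?c - 1)) * ((of_nat (d * p) * F - of_nat ?c * ?D) * (F ^ k * ?W))"
      unfolding B .
    show ?thesis
      unfolding lin nonlin_op_bernoulli[OF assms(1)] K by (simp only: left_diff_distrib right_diff_distrib mult_ac) simp
  qed
qed

text \<open>
  In the coordinates \<open>\<rho>' = \<rho> / (1 - \<rho> F u)\<close> and \<open>u\<close> the unperturbed system is linear. The functional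
  extracts, up to sign, the coefficient of \<open>\<rho>'\<^bsup>l\<^esup> u\<^bsup>E\<^esup>\<close>. It vanishes on the image of the
  unperturbed derivation if this monomial is resonant.
\<close>

definition res_functional :: "'a::field_char_0 poly \<Rightarrow> nat \<Rightarrow> nat \<Rightarrow> (nat \<Rightarrow> 'a poly) \<Rightarrow> 'a" where
  "res_functional F l E G =
     coeff (\<Sum>t<l. of_nat ((l - 1) choose t) * ((-1) ^ t * (F ^ (l - 1 - t) * G (Suc t)))) E"

lemma coeff_of_nat_mult: "coeff (of_nat k * G) i = of_nat k * coeff G i"
  by (simp add: of_nat_mult_conv_smult)

lemma coeff_minus_one_power_mult: "coeff ((-1) ^ t * G) i = (-1) ^ t * coeff G i"
  for G :: "'a::comm_ring_1 poly"
  by (cases "even t") simp_all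

lemma coeff_var_pderiv: "coeff (var_u * pderiv G) i = of_nat i * coeff G i"
  using coeff_pCons_0_pderiv[of G i] by (simp add: var_u_mult)

lemma res_functional_image_eq_0:
  assumes d: "0 < d" and E: "p * d * l = (p + q) * E" and l: "0 < l"
  shows "res_functional F l E
     (\<lambda>m. lin_op p q d m (G m) + nonlin_op d (bernoulli_poly p q d F) 0 (m - 1) (G (m - 1))) = 0"
proof -
  let ?u = "var_u :: 'a poly" and ?N = "nonlin_op d (bernoulli_poly p q d F) 0"
  let ?D = "of_nat (p + q) * (?u * pderiv F) - of_nat (d * p) * F"
  obtain a where a: "l = Suc a" using l by (cases l) auto
  define X where "X = (\<lambda>t. of_nat (a choose t) * ((-1) ^ t * (F ^ (a - t) * lin_op p q d (Suc t) (G (Suc t)))))"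
  define Y where "Y = (\<lambda>t. of_nat (a choose t) * ((-1) ^ t * (F ^ (a - t) * ?N t (G t))))"
  \<comment> \<open>\<open>X t\<close> and \<open>Y (Suc t)\<close> are the linear and nonlinear
    contributions of the same \<open>G (Suc t)\<close>. They cancel because the Euler derivation
    multiplies the coefficient of index E by E, and E is resonant for l.\<close>
  have zero: "coeff (X t + Y (Suc t)) E = 0" if "t < a" for t
  proof -
    obtain k where k: "a = t + Suc k" using \<open>t < a\<close> less_iff_Suc_add by auto
    have "(a - t) * (a choose t) = a * ((a - 1) choose t)" by (rule binomial_absorb_comp)
    moreover have "Suc t * (a choose Suc t) = a * ((a - 1) choose t)"
      using Suc_times_binomial[of t "a - 1"] k by simp
    ultimately have ch: "Suc k * (a choose t) = Suc t * (a choose Suc t)" using k by simp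
    have F1: "F ^ (a - t) = F * F ^ k" "F ^ (a - Suc t) = F ^ k" using k by simp_all
    let ?G = "G (Suc t)"
    define A where "A = F * F ^ k * ?G"
    define B where "B = F ^ k * (?u * pderiv F) * ?G"
    have prod: "?u * pderiv A = of_nat (Suc k) * B + F * F ^ k * (?u * pderiv ?G)"
    proof -
      have "?u * pderiv (F ^ Suc k * ?G) = (?u * pderiv (F ^ Suc k)) * ?G + F ^ Suc k * (?u * pderiv ?G)"
        by (simp only: pderiv_mult) (simp add: algebra_simps)
      then show ?thesis unfolding var_pderiv_power[of F] A_def B_def by (simp add: mult_ac)
    qed
    have "F * F ^ k * lin_op p q d (Suc t) ?G = of_nat (p * d * Suc t) * A
        - of_nat (p + q) * (?u * pderiv A) + of_nat (p + q) * (of_nat (Suc k) * B)"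
      unfolding prod lin_op_eq unfolding A_def by (simp add: algebra_simps)
    then have lin: "coeff (F * F ^ k * lin_op p q d (Suc t) ?G) E = of_nat (p * d * Suc t) * coeff A E
        - of_nat (p + q) * (of_nat E * coeff A E) + of_nat (p + q) * (of_nat (Suc k) * coeff B E)"
      by (simp only: coeff_add coeff_diff coeff_of_nat_mult coeff_var_pderiv)
    have id: "of_nat (p + q) * of_nat E = (of_nat (p * d * Suc t) + of_nat (Suc k) * of_nat (d * p) :: 'a)"
    proof -
      have "(p + q) * E = p * d * Suc t + Suc k * (d * p)" using E a k by (simp add: algebra_simps)
      then show ?thesis by (simp only: of_nat_add[symmetric] of_nat_mult[symmetric])
    qed
    have "?D * (F ^ k * ?G) = of_nat (p + q) * B - of_nat (d * p) * A"
      by (simp add: A_def B_def algebra_simps)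
    then have D: "coeff (?D * (F ^ k * ?G)) E = of_nat (p + q) * coeff B E - of_nat (d * p) * coeff A E"
      by (simp only: coeff_diff coeff_of_nat_mult)
    have lin': "coeff (F * F ^ k * lin_op p q d (Suc t) ?G) E = of_nat (Suc k) * coeff (?D * (F ^ k * ?G)) E"
      unfolding lin D mult.assoc[symmetric, of "of_nat (p + q)" "of_nat E"] id
      by (simp only: algebra_simps)
    have "coeff (X t) E = (-1) ^ t * (of_nat (a choose t) * coeff (F * F ^ k * lin_op p q d (Suc t) ?G) E)"
      unfolding X_def F1 by (simp only: coeff_of_nat_mult coeff_minus_one_power_mult) (simp only: mult_ac)
    also have "\<dots> = (-1) ^ t * (of_nat (Suc k * (a choose t)) * coeff (?D * (F ^ k * ?G)) E)"
      unfolding lin' by (simp only: of_nat_mult mult_ac)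
    finally have X: "coeff (X t) E = (-1) ^ t * (of_nat (Suc t * (a choose Suc t)) * coeff (?D * (F ^ k * ?G)) E)"
      unfolding ch .
    have "coeff (Y (Suc t)) E = (-1) ^ Suc t * (of_nat (a choose Suc t) * (of_nat (Suc t) * coeff (F ^ k * (?D * ?G)) E))"
      unfolding Y_def F1 nonlin_op_bernoulli[OF d]
      by (simp only: coeff_of_nat_mult coeff_minus_one_power_mult mult.left_commute[of "F ^ k" "of_nat (Suc t)"])
        (simp only: mult_ac)
    also have "F ^ k * (?D * ?G) = ?D * (F ^ k * ?G)" by (simp only: mult_ac)
    finally have Y: "coeff (Y (Suc t)) E = - ((-1) ^ t * (of_nat (Suc t * (a choose Suc t)) * coeff (?D * (F ^ k * ?G)) E))"
      by (simp only: of_nat_mult mult_ac power_Suc) simp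
    show ?thesis unfolding coeff_add X Y by simp
  qed
  have last: "coeff (X a) E = 0"
  proof -
    have "coeff (lin_op p q d (Suc a) (G (Suc a))) E = 0"
      unfolding coeff_lin_op using E a by simp
    then show ?thesis
      by (simp add: X_def coeff_minus_one_power_mult)
  qed
  have first: "Y 0 = 0" by (simp add: Y_def nonlin_op_def)
  have "res_functional F l E
     (\<lambda>m. lin_op p q d m (G m) + ?N (m - 1) (G (m - 1))) = coeff (\<Sum>t<Suc a. X t + Y t) E"
    unfolding res_functional_def a X_def Y_def by (simp add: distrib_left)
  also have "(\<Sum>t<Suc a. X t + Y t) = (\<Sum>t<a. X t + Y (Suc t)) + X a"
  proof -
    have "(\<Sum>t<Suc a. X t + Y t) = (\<Sum>t<Suc a. X t) + (\<Sum>t<Suc a. Y t)" by (simp only: sum.distrib)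
    also have "\<dots> = ((\<Sum>t<a. X t) + X a) + (\<Sum>t<a. Y (Suc t))"
      by (simp only: sum.lessThan_Suc[of X] sum.lessThan_Suc_shift[of Y] first add_0)
    finally show ?thesis by (simp add: sum.distrib)
  qed
  also have "coeff \<dots> E = (\<Sum>t<a. coeff (X t + Y (Suc t)) E) + coeff (X a) E"
    unfolding coeff_add[of "\<Sum>t<a. X t + Y (Suc t)"] coeff_sum ..
  also have "\<dots> = 0"
    using sum.neutral[of "{..<a}" "\<lambda>t. coeff (X t + Y (Suc t)) E"] zero last by (simp del: coeff_add)
  finally show ?thesis .
qed

section \<open>First-order perturbations\<close>

text \<open>All powers of \<open>F\<close> combine to fixed ones, so the functional reduces to three
  alternating binomial sums. The one belonging to \<open>g\<close> is 0, as it must be: changing f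
  alone keeps the system a Bernoulli equation.\<close>

lemma res_functional_perturbation:
  assumes d: "0 < d" and pq: "0 < p" "0 < q" and l: "l = (p + q) * (j + 1)" and j: "0 < j"
  shows "res_functional F l E (\<lambda>m. nonlin_op d g h (m - 1) (base_integral p q d F (m - 1))) =
    (-1) ^ (p + q) * coeff (h * (of_nat (p * d) * (F ^ ((p + q) * j - 1) * var_u ^ (p * d - 1)) -
      of_nat (p + q) * (F ^ ((p + q) * j - 2) * pderiv F * var_u ^ (p * d)))) E"
proof -
  define c where "c = p + q"
  define e where "e = p * d"
  define a where "a = l - 1"
  let ?C = "F ^ (c * j - 1)" and ?u = "var_u :: 'a poly"
  have c: "2 \<le> c" using pq by (simp add: c_def)
  have cj: "c \<le> c * j" using j by simp
  have l': "l = c * j + c" using l by (simp add: c_def algebra_simps)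
  have a_eq: "a = c * j - 1 + c" "l - 1 = a" "l = Suc a" and ca: "c < a"
    unfolding a_def using l' cj c by linarith+
  let ?A = "of_nat d * of_nat c * (g * ?C * ?u ^ e)"
  let ?B0 = "h * (of_nat e * (?C * ?u ^ (e - 1)))" and ?B1 = "h * (of_nat c * (F ^ (c * j - 2) * pderiv F * ?u ^ e))"
  have du: "pderiv (?u ^ e) = of_nat e * ?u ^ (e - 1)"
  proof -
    have "pderiv var_u = (1 :: 'a poly)" by (simp add: var_u_def pderiv_pCons)
    then show ?thesis by (simp add: pderiv_power of_nat_mult_conv_smult)
  qed
  have "of_nat (a choose t) * ((-1) ^ t * (F ^ (a - t) * nonlin_op d g h t (base_integral p q d F t))) =
      (-1) ^ t * of_nat ((a choose t) * (t choose c)) * ?A +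
      (-1) ^ t * of_nat ((a choose t) * ((t - 1) choose (c - 1))) * ?B0 +
      (-1) ^ t * of_nat ((a choose t) * ((t - 1) choose c)) * ?B1" if t: "t \<in> {1..a}" for t
  proof (cases "t < c")
    case True
    moreover have "t - 1 < c - 1" using True t by auto
    ultimately show ?thesis using t by (simp add: base_integral_def c_def[symmetric] nonlin_op_def binomial_eq_0)
  next
    case False
    then obtain k where k: "t = c + k" using le_Suc_ex not_less by blast
    have ks: "a - t = c * j - 1 - k" "k \<le> c * j - 1" using k t a_eq by auto
    have K: "base_integral p q d F t = of_nat ((t - 1) choose (c - 1)) * (F ^ k * ?u ^ e)"
      using k by (simp add: base_integral_def c_def e_def)
    have "a - t + k = c * j - 1" using ks by linarith
    then have F1: "F ^ (a - t) * F ^ k = ?C" by (simp only: power_add[symmetric])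
    have F2: "of_nat k * (F ^ (a - t) * F ^ (k - 1)) = of_nat k * F ^ (c * j - 2)"
    proof (cases "k = 0")
      case False
      then have "a - t + (k - 1) = c * j - 2" using ks by linarith
      then show ?thesis by (simp only: power_add[symmetric])
    qed simp
    \<comment> \<open>Absorption moves the factors t and k, which come from the m in
      \<open>nonlin_op\<close> and from differentiating F^k, into the binomial coefficients;
      afterwards t occurs only in binomials and signs.\<close>
    have ch1: "t * ((t - 1) choose (c - 1)) = c * (t choose c)"
    proof -
      have "Suc (c - 1) = c" "Suc (t - 1) = t" using c t by auto
      then show ?thesis using Suc_times_binomial[of "c - 1" "t - 1"] by (simp only:)
    qed
    have ch2: "k * ((t - 1) choose (c - 1)) = c * ((t - 1) choose c)"
    proof -
      have "c * (t choose c) = c * ((t - 1) choose (c - 1)) + c * ((t - 1) choose c)"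
        using c t choose_reduce_nat[of t c] by (simp add: distrib_left)
      then have "(c + k) * ((t - 1) choose (c - 1)) = c * ((t - 1) choose (c - 1)) + c * ((t - 1) choose c)"
        using ch1 k by simp
      then show ?thesis by (simp add: distrib_right)
    qed
    have "F ^ (a - t) * (of_nat (d * t) * (g * base_integral p q d F t)) =
        of_nat d * of_nat (t * ((t - 1) choose (c - 1))) * (g * (F ^ (a - t) * F ^ k) * ?u ^ e)"
      unfolding K by (simp add: mult_ac)
    then have 1: "F ^ (a - t) * (of_nat (d * t) * (g * base_integral p q d F t)) = of_nat (t choose c) * ?A"
      unfolding F1 ch1 by (simp add: mult_ac)
    have "F ^ (a - t) * (h * pderiv (base_integral p q d F t)) =
        of_nat ((t - 1) choose (c - 1)) * (h * ((of_nat k * (F ^ (a - t) * F ^ (k - 1))) * pderiv F * ?u ^ e +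
          (F ^ (a - t) * F ^ k) * (of_nat e * ?u ^ (e - 1))))"
      unfolding K pderiv_of_nat_mult pderiv_mult du pderiv_power[of F] of_nat_mult_conv_smult[symmetric]
      by (simp add: algebra_simps)
    also have "\<dots> = of_nat (k * ((t - 1) choose (c - 1))) * (h * (F ^ (c * j - 2) * pderiv F * ?u ^ e))
        + of_nat ((t - 1) choose (c - 1)) * ?B0"
      unfolding F1 F2 by (simp add: algebra_simps)
    finally have 2: "F ^ (a - t) * (h * pderiv (base_integral p q d F t)) =
        of_nat ((t - 1) choose c) * ?B1 + of_nat ((t - 1) choose (c - 1)) * ?B0"
      unfolding ch2 by (simp add: mult_ac)
    have "F ^ (a - t) * nonlin_op d g h t (base_integral p q d F t) =
        of_nat (t choose c) * ?A + (of_nat ((t - 1) choose c) * ?B1 + of_nat ((t - 1) choose (c - 1)) * ?B0)"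
      unfolding nonlin_op_def of_nat_mult_conv_smult[symmetric] distrib_left 1 2 ..
    then show ?thesis by (simp only: of_nat_mult) (simp only: distrib_left mult_ac add_ac)
  qed
  then have "(\<Sum>t=1..a. of_nat (a choose t) * ((-1) ^ t * (F ^ (a - t) * nonlin_op d g h t (base_integral p q d F t)))) =
      (\<Sum>t=1..a. (-1) ^ t * of_nat ((a choose t) * (t choose c))) * ?A +
      (\<Sum>t=1..a. (-1) ^ t * of_nat ((a choose t) * ((t - 1) choose (c - 1)))) * ?B0 +
      (\<Sum>t=1..a. (-1) ^ t * of_nat ((a choose t) * ((t - 1) choose c))) * ?B1"
    by (simp only: sum.distrib sum_distrib_right cong: sum.cong)
  also have "(\<Sum>t=1..a. (-1) ^ t * of_nat ((a choose t) * (t choose c))) = (0 :: 'a poly)"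
    using alternating_choose_choose_sum'[of "c - 1" a, where 'a = "'a poly"] c ca by simp
  also have "(\<Sum>t=1..a. (-1) ^ t * of_nat ((a choose t) * ((t - 1) choose (c - 1)))) = ((-1) ^ c :: 'a poly)"
    using alternating_choose_pred_choose_sum[of "c - 1" a, where 'a = "'a poly"] c ca by simp
  also have "(\<Sum>t=1..a. (-1) ^ t * of_nat ((a choose t) * ((t - 1) choose c))) = ((-1) ^ Suc c :: 'a poly)"
    using alternating_choose_pred_choose_sum[of c a, where 'a = "'a poly"] ca by simp
  also have "0 * ?A + (-1) ^ c * ?B0 + (-1) ^ Suc c * ?B1 = (-1) ^ c * (?B0 - ?B1)"
    by (simp add: algebra_simps)
  finally have sum1: "(\<Sum>t=1..a. of_nat (a choose t) * ((-1) ^ t * (F ^ (a - t) * nonlin_op d g h t (base_integral p q d F t)))) =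
      (-1) ^ c * (h * (of_nat e * (?C * ?u ^ (e - 1)) - of_nat c * (F ^ (c * j - 2) * pderiv F * ?u ^ e)))"
    by (simp only: right_diff_distrib)
  have "(\<Sum>t<l. of_nat (a choose t) * ((-1) ^ t * (F ^ (a - t) * nonlin_op d g h t (base_integral p q d F t)))) =
      (\<Sum>t=1..a. of_nat (a choose t) * ((-1) ^ t * (F ^ (a - t) * nonlin_op d g h t (base_integral p q d F t))))"
    using c by (intro sum.mono_neutral_right)
      (auto simp: a_eq(3) base_integral_def c_def[symmetric] nonlin_op_def not_le)
  then show ?thesis
    unfolding res_functional_def a_eq(2) diff_Suc_1 sum1 by (simp add: coeff_minus_one_power_mult c_def e_def)
qed

lemma coeff_mult_var_u_power:
  "coeff (G * var_u ^ k) s = (if s < k then 0 else coeff G (s - k))"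
proof -
  have "G * var_u ^ k = monom 1 k * G" by (simp add: monom_altdef var_u_def mult.commute)
  then show ?thesis by (simp only: coeff_monom_mult mult_1_left)
qed

text \<open>The factor (p + q) j - 1 turns F^((p+q)j-2) F' into the derivative of F^((p+q)j-1), so
  that only coefficients of this one power remain, each with a weight that does not depend on
  j.\<close>

lemma perturbation_coeff:
  assumes d: "0 < d" and pq: "0 < p" "0 < q" and j: "0 < j"
  shows "of_nat ((p + q) * j - 1) * coeff (h * (of_nat (p * d) * (F ^ ((p + q) * j - 1) * var_u ^ (p * d - 1)) -
      of_nat (p + q) * (F ^ ((p + q) * j - 2) * pderiv F * var_u ^ (p * d)))) (p * d * (j + 1)) =
    (\<Sum>i\<le>p * d * j + 1. coeff h i * (of_nat ((p + q) * i) - of_nat (p + q + p * d)) *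
       coeff (F ^ ((p + q) * j - 1)) (p * d * j + 1 - i))"
proof -
  define c where "c = p + q"
  define e where "e = p * d"
  define L where "L = c * j - 1"
  let ?C = "F ^ L" and ?u = "var_u :: 'a poly"
  have e: "1 \<le> e" using d pq by (simp add: e_def Suc_le_eq)
  have "c \<le> c * j" using j by simp
  then have L: "c * j = Suc L" using pq by (simp add: L_def c_def)
  have "pderiv ?C = of_nat L * (F ^ (c * j - 2) * pderiv F)"
    using L by (simp add: pderiv_power of_nat_mult_conv_smult numeral_2_eq_2)
  then have X: "of_nat L * (h * (of_nat e * (?C * ?u ^ (e - 1)) - of_nat c * (F ^ (c * j - 2) * pderiv F * ?u ^ e))) =
      h * (of_nat (e * L) * (?C * ?u ^ (e - 1)) - of_nat c * (pderiv ?C * ?u ^ e))"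
    by (simp add: algebra_simps)
  have coef: "coeff (of_nat (e * L) * (?C * ?u ^ (e - 1)) - of_nat c * (pderiv ?C * ?u ^ e)) (e * (j + 1) - i) =
      (if i \<le> e * j + 1 then (of_nat (c * i) - of_nat (c + e)) * coeff ?C (e * j + 1 - i) else 0)"
    if i: "i \<le> e * (j + 1)" for i
  proof (cases "i \<le> e * j + 1")
    case True
    have 1: "coeff (?C * ?u ^ (e - 1)) (e * (j + 1) - i) = coeff ?C (e * j + 1 - i)"
      using True e by (simp add: coeff_mult_var_u_power)
    have 2: "coeff (pderiv ?C * ?u ^ e) (e * (j + 1) - i) = of_nat (e * j + 1 - i) * coeff ?C (e * j + 1 - i)"
    proof (cases "i = e * j + 1")
      case False
      then have "e * j + 1 - i = Suc (e * j - i)" "\<not> e * (j + 1) - i < e" "e * (j + 1) - i - e = e * j - i"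
        using True by auto
      then show ?thesis by (simp only: coeff_mult_var_u_power coeff_pderiv if_False Suc_eq_plus1)
    qed (use e in \<open>simp add: coeff_mult_var_u_power\<close>)
    have "e * L + e = e * (c * j)" by (simp add: L)
    moreover have "c * (e * j + 1 - i) + c * i = e * (c * j) + c"
    proof -
      have "c * (e * j + 1 - i) + c * i = c * (e * j + 1 - i + i)" by (simp only: distrib_left)
      also have "e * j + 1 - i + i = e * j + 1" using True by simp
      finally show ?thesis by (simp add: algebra_simps)
    qed
    ultimately have "e * L + (c + e) = c * (e * j + 1 - i) + c * i" by simp
    then have "of_nat (e * L) + of_nat (c + e) = (of_nat c * of_nat (e * j + 1 - i) + of_nat (c * i) :: 'a)"
      by (simp only: of_nat_add[symmetric] of_nat_mult[symmetric])
    moreover have "x - z = w - y" if "x + y = z + w" for x y z w :: 'a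
      using that by algebra
    ultimately have "of_nat (e * L) - of_nat c * of_nat (e * j + 1 - i) = (of_nat (c * i) - of_nat (c + e) :: 'a)"
      by blast
    then show ?thesis
      unfolding coeff_diff coeff_of_nat_mult 1 2 using True
      by (simp only: mult.assoc[symmetric] left_diff_distrib[symmetric] if_True)
  next
    case False
    then have "e * (j + 1) - i < e - 1" using i e by simp
    then show ?thesis using False
      unfolding coeff_diff coeff_of_nat_mult coeff_mult_var_u_power by simp
  qed
  have "of_nat L * coeff (h * (of_nat e * (?C * ?u ^ (e - 1)) - of_nat c * (F ^ (c * j - 2) * pderiv F * ?u ^ e))) (e * (j + 1)) =
      coeff (h * (of_nat (e * L) * (?C * ?u ^ (e - 1)) - of_nat c * (pderiv ?C * ?u ^ e))) (e * (j + 1))"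
    unfolding coeff_of_nat_mult[symmetric] X ..
  also have "\<dots> = (\<Sum>i\<le>e * (j + 1). if i \<le> e * j + 1 then
      coeff h i * (of_nat (c * i) - of_nat (c + e)) * coeff ?C (e * j + 1 - i) else 0)"
    unfolding coeff_mult by (intro sum.cong refl, subst coef) auto
  also have "\<dots> = (\<Sum>i\<le>e * j + 1. coeff h i * (of_nat (c * i) - of_nat (c + e)) * coeff ?C (e * j + 1 - i))"
    using e by (intro sum.mono_neutral_cong_right) auto
  finally show ?thesis unfolding c_def e_def L_def .
qed

section \<open>Independence of the first-order obstructions\<close>

lemma falling_factorial_of_nat:
  "(\<Prod>s<i. of_nat b - of_nat s) = (fact i * of_nat (b choose i) :: 'a::field_char_0)"
  by (simp add: binomial_gbinomial gbinomial_mult_fact lessThan_atLeast0)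

text \<open>The condition A + N = a + b makes A - (b - i) equal to a - (N - i), so both lower
  factorials are truncations of b! and a!. If i > b or N - i > a, a falling factorial passes through
  0, in accordance with a vanishing binomial.\<close>

lemma binomial_falling_factorials:
  assumes "A + N = a + b" "i \<le> N"
  shows "(if i \<le> b then of_nat (A choose (b - i)) else 0) * (fact a * fact b) =
    (fact A * ((\<Prod>s<i. of_nat b - of_nat s) * (\<Prod>s<N - i. of_nat a - of_nat s)) :: 'a::field_char_0)"
proof -
  consider "i > b" | "N - i > a" | "i \<le> b" "N - i \<le> a" by linarith
  then show ?thesis
  proof cases
    case 1
    then show ?thesis by (simp add: falling_factorial_of_nat)
  next
    case 2
    then have "A < b - i" using assms by simp
    with 2 show ?thesis by (simp add: falling_factorial_of_nat binomial_eq_0)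
  next
    case 3
    then have "b - i \<le> A" "A - (b - i) = a - (N - i)" using assms by auto
    then have "of_nat (A choose (b - i)) = (fact A / (fact (b - i) * fact (a - (N - i))) :: 'a)"
      by (simp add: binomial_fact)
    moreover have "of_nat (b choose i) = (fact b / (fact i * fact (b - i)) :: 'a)"
      and "of_nat (a choose (N - i)) = (fact a / (fact (N - i) * fact (a - (N - i))) :: 'a)"
      using 3 by (simp_all add: binomial_fact)
    ultimately show ?thesis using 3 by (simp add: falling_factorial_of_nat)
  qed
qed

text \<open>
  Up to nonzero factors, row \<open>j\<close> is the value at \<open>j\<close> of a polynomial of degree at most \<open>d + 2\<close>, which
  also vanishes at \<open>0\<close>, and hence is zero. The coefficients are then read off at the points where the
  first falling factorial is applied to \<open>0, 1, 2, \<dots>\<close>.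
\<close>

lemma binomial_rows_injective:
  fixes w :: "nat \<Rightarrow> 'a::field_char_0"
  assumes d: "2 \<le> d" and pq: "0 < p" "0 < q" and cop: "coprime d (p + q)" and tau: "p + q < q * d"
    and w1: "w 1 = 0"
    and rows: "\<And>j. j \<in> {1..d + 2} \<Longrightarrow> (\<Sum>i\<le>d + 2. w i * (if i \<le> p * d * j + 1
        then of_nat (((d - 1) * ((p + q) * j - 1)) choose (p * d * j + 1 - i)) else 0)) = 0"
    and k: "k \<le> d + 2"
  shows "w k = 0"
proof -
  define c where "c = p + q"
  define e where "e = p * d"
  define \<tau> where "\<tau> = q * d - c"
  define N where "N = d + 2"
  have e: "0 < e" using pq d by (simp add: e_def)
  have \<tau>: "0 < \<tau>" "\<tau> + c = q * d" using tau by (simp_all add: \<tau>_def c_def)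
  \<comment> \<open>Row j equals A! / (a! b!) times the value of \<open>R\<close> at j, where b = e
    j + 1 and a = \<tau> j + 2 are linear in j.\<close>
  define R where "R = (\<Sum>i\<le>N. smult (w i) ((\<Prod>s<i. [:1 - of_nat s, of_nat e:]) * (\<Prod>s<N - i. [:2 - of_nat s, of_nat \<tau>:])))"
  have R: "poly R z = (\<Sum>i\<le>N. w i * ((\<Prod>s<i. of_nat e * z + 1 - of_nat s) * (\<Prod>s<N - i. of_nat \<tau> * z + 2 - of_nat s)))" for z
    by (simp add: R_def poly_sum poly_prod algebra_simps)
  have deg: "degree R \<le> N"
    unfolding R_def
  proof (rule degree_sum_le)
    fix i assume "i \<in> {..N}"
    have lin: "degree (\<Prod>s<k. [:f s, x:]) \<le> k" for k and f :: "nat \<Rightarrow> 'a" and x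
    proof -
      have "degree (\<Prod>s<k. [:f s, x:]) \<le> (\<Sum>s<k. degree [:f s, x:])"
        using degree_prod_sum_le[of "{..<k}" "\<lambda>s. [:f s, x:]"] by (simp add: o_def)
      also have "\<dots> \<le> (\<Sum>s<k. 1)" by (intro sum_mono) simp
      finally show ?thesis by simp
    qed
    have "degree ((\<Prod>s<i. [:1 - of_nat s, of_nat e:]) * (\<Prod>s<N - i. [:2 - of_nat s, of_nat \<tau> :: 'a:])) \<le> i + (N - i)"
      by (rule order_trans[OF degree_mult_le add_mono[OF lin lin]])
    then show "degree (smult (w i) ((\<Prod>s<i. [:1 - of_nat s, of_nat e:]) * (\<Prod>s<N - i. [:2 - of_nat s, of_nat \<tau>:]))) \<le> N"
      using \<open>i \<in> {..N}\<close> by (simp add: degree_smult_le order_trans[OF degree_smult_le])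
  qed simp
  have root: "poly R (of_nat j) = 0" if "j \<in> {1..N}" for j
  proof -
    define A where "A = (d - 1) * (c * j - 1)"
    define a where "a = \<tau> * j + 2"
    define b where "b = e * j + 1"
    have ab: "A + N = a + b"
    proof -
      have "1 \<le> c * j" using that pq by (simp add: c_def Suc_le_eq)
      then obtain m where m: "c * j = Suc m" by (cases "c * j") auto
      obtain d' where d': "d = Suc d'" using d by (cases d) auto
      have "\<tau> * j + c * j + e * j = (\<tau> + c + e) * j" by (simp add: algebra_simps)
      also have "\<dots> = d * (c * j)" unfolding \<tau>(2) by (simp add: e_def c_def algebra_simps)
      finally have "\<tau> * j + Suc m + e * j = Suc d' * Suc m" by (simp only: m d')
      then show ?thesis by (simp add: A_def a_def b_def N_def m d')
    qed
    have "fact A * poly R (of_nat j) = (\<Sum>i\<le>N. w i *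
        (fact A * ((\<Prod>s<i. of_nat b - of_nat s) * (\<Prod>s<N - i. of_nat a - of_nat s))))"
    proof -
      have "of_nat b = of_nat e * of_nat j + (1 :: 'a)" "of_nat a = of_nat \<tau> * of_nat j + (2 :: 'a)"
        by (simp_all add: a_def b_def)
      then show ?thesis unfolding R sum_distrib_left by (intro sum.cong refl) (simp only: mult.left_commute)
    qed
    also have "\<dots> = (\<Sum>i\<le>N. w i * ((if i \<le> b then of_nat (A choose (b - i)) else 0) * (fact a * fact b)))"
      using binomial_falling_factorials[OF ab, where 'a = 'a] by (intro sum.cong refl) simp
    also have "\<dots> = (\<Sum>i\<le>N. w i * (if i \<le> b then of_nat (A choose (b - i)) else 0)) * (fact a * fact b)"
      by (simp only: sum_distrib_right mult.assoc)
    also have "(\<Sum>i\<le>N. w i * (if i \<le> b then of_nat (A choose (b - i)) else 0)) = 0"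
      using rows[of j] that by (simp only: N_def A_def b_def c_def e_def)
    finally show ?thesis by simp
  qed
  \<comment> \<open>At 0 the falling factorials are those of 1 and 2, which vanish from length 2 and
    3 on. This gives the last of the N + 1 roots needed in degree N.\<close>
  have root0: "poly R 0 = 0"
    unfolding R
  proof (intro sum.neutral ballI)
    fix i assume "i \<in> {..N}"
    consider "i = 0" | "i = 1" | "2 \<le> i" by linarith
    then show "w i * ((\<Prod>s<i. of_nat e * 0 + 1 - of_nat s) * (\<Prod>s<N - i. of_nat \<tau> * 0 + 2 - of_nat s)) = 0"
    proof cases
      case 1
      moreover have "(\<Prod>s<N. of_nat \<tau> * 0 + 2 - of_nat s) = (0 :: 'a)"
        by (rule prod_zero) (use d in \<open>auto simp: N_def intro!: bexI[of _ 2]\<close>)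
      ultimately show ?thesis by simp
    next
      case 3
      then have "(\<Prod>s<i. of_nat e * 0 + 1 - of_nat s) = (0 :: 'a)"
        by (intro prod_zero) (auto intro!: bexI[of _ 1])
      then show ?thesis by simp
    qed (simp add: w1[simplified])
  qed
  have "R = 0"
  proof (rule poly_eqI_degree[where A = "of_nat ` {0..N}"])
    have "inj_on (of_nat :: nat \<Rightarrow> 'a) {0..N}" by (simp add: inj_on_def)
    then have "card ((of_nat :: nat \<Rightarrow> 'a) ` {0..N}) = N + 1" by (simp add: card_image)
    then show "card ((of_nat :: nat \<Rightarrow> 'a) ` {0..N}) > degree R" "card ((of_nat :: nat \<Rightarrow> 'a) ` {0..N}) > degree (0 :: 'a poly)"
      using deg by simp_all
    fix x :: 'a assume "x \<in> of_nat ` {0..N}"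
    then obtain j where "x = of_nat j" "j \<le> N" by auto
    moreover from this have "j = 0 \<or> j \<in> {1..N}" by auto
    ultimately show "poly R x = poly 0 x" using root root0 by auto
  qed
  show ?thesis
    using k
  proof (induction k rule: less_induct)
    case (less k)
    show ?case
    proof (cases "k = 1")
      case False
      \<comment> \<open>At this point the first product is a falling factorial of k and vanishes for
        i > k; the terms with i < k are 0 by induction, so only i = k is left.\<close>
      define z :: 'a where "z = (of_nat k - 1) / of_nat e"
      have ez: "of_nat e * z + 1 = of_nat k" using e by (simp add: z_def)
      have "poly R z = (\<Sum>i\<le>N. if i = k then w k * ((\<Prod>s<k. of_nat k - of_nat s) * (\<Prod>s<N - k. of_nat \<tau> * z + 2 - of_nat s)) else 0)"
        unfolding R ez
      proof (intro sum.cong refl)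
        fix i assume i: "i \<in> {..N}"
        show "w i * ((\<Prod>s<i. of_nat k - of_nat s) * (\<Prod>s<N - i. of_nat \<tau> * z + 2 - of_nat s)) =
          (if i = k then w k * ((\<Prod>s<k. of_nat k - of_nat s) * (\<Prod>s<N - k. of_nat \<tau> * z + 2 - of_nat s)) else 0)"
        proof (cases i k rule: linorder_cases)
          case less': less
          then show ?thesis using less.IH[of i] i by (simp add: N_def)
        next
          case greater
          then have "(\<Prod>s<i. of_nat k - of_nat s) = (0 :: 'a)" by (auto intro!: bexI[of _ k])
          then show ?thesis using greater by simp
        qed simp
      qed
      also have "\<dots> = w k * ((\<Prod>s<k. of_nat k - of_nat s) * (\<Prod>s<N - k. of_nat \<tau> * z + 2 - of_nat s))"
        using less.prems by (simp add: N_def)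
      finally have "w k * ((\<Prod>s<k. of_nat k - of_nat s) * (\<Prod>s<N - k. of_nat \<tau> * z + 2 - of_nat s)) = 0"
        using \<open>R = 0\<close> by simp
      moreover have "(\<Prod>s<k. of_nat k - of_nat s) \<noteq> (0 :: 'a)" by auto
      moreover have "of_nat \<tau> * z + 2 - of_nat s \<noteq> 0" if s: "s < N - k" for s
      proof
        assume "of_nat \<tau> * z + 2 - of_nat s = 0"
        then have "of_nat e * (of_nat \<tau> * z + 2) = of_nat e * of_nat s" by simp
        moreover have "of_nat e * (of_nat \<tau> * z + 2) = of_nat \<tau> * (of_nat e * z) + 2 * of_nat e"
          by (simp add: algebra_simps)
        moreover have "of_nat e * z = of_nat k - 1" using ez by (simp add: eq_diff_eq)
        ultimately have "of_int (int \<tau> * (int k - 1) + 2 * int e) = (of_int (int e * int s) :: 'a)" by simp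
        then have eq: "int \<tau> * (int k - 1) + 2 * int e = int e * int s" by (simp only: of_int_eq_iff)
        have "int \<tau> = int q * int d - int c"
          using arg_cong[OF \<tau>(2), of int] by simp
        moreover have "int e = int p * int d" by (simp add: e_def)
        ultimately have "int c * (int k - 1) = int d * (int q * (int k - 1) + 2 * int p - int p * int s)"
          using eq by algebra
        \<comment> \<open>Multiplication by e = p d clears the denominator. Modulo d only the part
          -c of \<tau> survives, so d would divide k - 1; within the range of k this leaves k = d +
          1, where s = 0 and the left side is positive.\<close>
        then have "int d dvd int c * (int k - 1)" by simp
        moreover have "coprime (int d) (int c)" using cop unfolding c_def by (simp only: coprime_int_iff)
        ultimately have dvd: "int d dvd int k - 1"
          by (simp add: coprime_dvd_mult_right_iff)
        show False
        proof (cases "k = 0")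
          case True
          then show False using dvd d by (simp add: zdvd1_eq)
        next
          case False
          then obtain m where m: "k = Suc m" by (cases k) auto
          then have "d dvd m" using dvd by (simp add: int_dvd_int_iff)
          then obtain x where x: "m = d * x" ..
          have "m \<le> d + 1" "m \<noteq> 0" using less.prems m \<open>k \<noteq> 1\<close> by simp_all
          have "x < 2"
          proof (rule ccontr)
            assume "\<not> x < 2"
            then have "d * 2 \<le> d * x" by (intro mult_le_mono2) simp
            then show False using \<open>m \<le> d + 1\<close> d unfolding x by linarith
          qed
          moreover have "x \<noteq> 0" using \<open>m \<noteq> 0\<close> x by (cases x) auto
          ultimately have "x = 1" by simp
          then have "s = 0" using s m x by (simp add: N_def)
          then have "int \<tau> * int m + 2 * int e = 0" using eq m by simp
          moreover have "0 \<le> int \<tau> * int m" by simp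
          ultimately show False using e by linarith
        qed
      qed
      ultimately show ?thesis by auto
    qed (simp add: w1[simplified])
  qed
qed

section \<open>The perturbed family\<close>

text \<open>The point is that \<rho>^((p+q)k) u^(pdk) = (x^q y^p)^(dk), while \<rho>^m carries total
  degree d m.\<close>

lemma lead_fps2_of_graded:
  assumes d: "0 < d"
    and G: "\<And>m j. m \<le> (p + q) * k \<Longrightarrow> j \<le> d * m \<Longrightarrow>
      coeff (G m) j = (if m = (p + q) * k \<and> j = p * d * k then v else 0)"
  shows "lead p q (d * k) v (fps2_of_graded d G)"
  unfolding lead_def ord_ge_def
proof (intro allI impI)
  fix i j assume ij: "i + j < (q + p) * (d * k) + 1"
  have "fps2_of_graded d G $ j $ i = (if i = q * (d * k) \<and> j = p * (d * k) then v else 0)"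
  proof (cases "d dvd i + j")
    case True
    then obtain m where m: "i + j = d * m" ..
    have "d * m \<le> d * ((p + q) * k)" using ij m by (simp add: algebra_simps)
    then have m_le: "m \<le> (p + q) * k" using d by simp
    have "fps2_of_graded d G $ j $ i = coeff (G m) j"
      using d m by (simp add: fps2_of_graded_def)
    also have "\<dots> = (if m = (p + q) * k \<and> j = p * d * k then v else 0)"
      using m by (intro G m_le) simp
    also have "m = (p + q) * k \<and> j = p * d * k \<longleftrightarrow> i = q * (d * k) \<and> j = p * (d * k)"
    proof
      assume *: "i = q * (d * k) \<and> j = p * (d * k)"
      then have "d * m = d * ((p + q) * k)" using m by (simp add: algebra_simps)
      then show "m = (p + q) * k \<and> j = p * d * k" using d * by simp
    qed (use m in \<open>simp add: algebra_simps\<close>)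
    finally show ?thesis .
  next
    case False
    have nd: "\<not> (i = q * (d * k) \<and> j = p * (d * k))"
      using False by auto
    have "fps2_of_graded d G $ j $ i = 0" using False by (simp add: fps2_of_graded_def)
    then show ?thesis by (simp only: nd if_False)
  qed
  then show "(fps2_of_graded d G - fps_const (fps_const v) * mono2 q p ^ (d * k)) $ j $ i = 0"
    by (simp add: mono2_power mono2_nth)
qed

lemma coeff_nonlin_op:
  "coeff (nonlin_op d f h m G) i = of_nat (d * m) * (\<Sum>k\<le>i. coeff f k * coeff G (i - k)) +
     (\<Sum>k\<le>i. coeff h k * (of_nat (Suc (i - k)) * coeff G (Suc (i - k))))"
  by (simp add: nonlin_op_def coeff_mult coeff_pderiv)

lemma nonlin_op_zero [simp]: "nonlin_op d f h m 0 = 0"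
  by (simp add: nonlin_op_def)

text \<open>Linearisation of \<open>graded_solution\<close> about h = 0, where \<open>B\<close>
  collects the first-order effect of changing f and h. Resonant coefficients are prescribed
  independently of the parameters, so their variation is 0.\<close>

fun variation :: "nat \<Rightarrow> nat \<Rightarrow> nat \<Rightarrow> 'a::field_char_0 poly \<Rightarrow> (nat \<Rightarrow> 'a poly) \<Rightarrow> nat \<Rightarrow> 'a poly" where
  "variation p q d f B 0 = 0"
| "variation p q d f B (Suc m) =
     (\<Sum>i\<le>d * Suc m. monom (if res_index p q d (Suc m) i then 0
        else - coeff (nonlin_op d f 0 m (variation p q d f B m) + B m) i / eig p q d (Suc m) i) i)"

lemma coeff_variation_Suc:
  "coeff (variation p q d f B (Suc m)) i =
     (if i > d * Suc m \<or> res_index p q d (Suc m) i then 0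
      else - coeff (nonlin_op d f 0 m (variation p q d f B m) + B m) i / eig p q d (Suc m) i)"
  by (auto simp: coeff_sum if_distrib[where f = "\<lambda>x. coeff x _"] sum.delta)

lemma degree_variation: "degree (variation p q d f B m) \<le> d * m"
proof (cases m)
  case (Suc m')
  show ?thesis unfolding Suc
    by (rule degree_le) (simp add: coeff_variation_Suc del: variation.simps)
qed simp

lemma strict_deriv_cmult:
  assumes "strict_deriv g L"
  shows "strict_deriv (\<lambda>x. a * g x) (\<lambda>x. a * L x)"
  using strict_deriv_mult[OF strict_deriv_const[of a] assms] by simp

section \<open>The concrete family and its linearised obstructions\<close>

context
  fixes p q d :: nat
  assumes pq: "0 < p" "0 < q" "coprime p q" and d: "2 \<le> d"
    and cop: "coprime d (p + q)" and tau: "p + q < q * d"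
begin

text \<open>Index 1 is missing because its coefficient cannot be read off in
  \<open>binomial_rows_injective\<close>: the corresponding point is z = 0, where every summand of
  \<open>R\<close> vanishes. This leaves d + 2 parameters for d + 2 obstructions.\<close>

definition pert_index :: "nat set" where
  "pert_index = {0..d + 2} - {1}"

definition pert_h :: "(nat \<Rightarrow> 'a::field_char_0) \<Rightarrow> 'a poly" where
  "pert_h \<eta> = (\<Sum>i\<in>pert_index. monom (\<eta> i) i)"

text \<open>Compensates the term of \<open>pert_h\<close> whose degree is too large.\<close>

definition pert_f :: "(nat \<Rightarrow> 'a::field_char_0) \<Rightarrow> 'a poly" where
  "pert_f \<eta> = - monom (\<eta> (d + 2)) (d + 1)"

definition shape :: "'a::field_char_0 poly" where
  "shape = [:1, 1:] ^ (d - 1)"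

definition base_f :: "'a::field_char_0 poly" where
  "base_f = bernoulli_poly p q d shape"

definition base_H :: "nat \<Rightarrow> 'a::field_char_0 poly" where
  "base_H = base_integral p q d shape"

text \<open>Taking the free resonant coefficients from \<open>base_H\<close> makes the recursion
  return \<open>base_H\<close> itself at parameter 0 (\<open>sol_0\<close>).\<close>

definition sol :: "(nat \<Rightarrow> 'a::field_char_0) \<Rightarrow> nat \<Rightarrow> 'a poly" where
  "sol \<eta> = graded_solution p q d base_H (base_f + pert_f \<eta>) (pert_h \<eta>)"

definition inhom :: "(nat \<Rightarrow> 'a::field_char_0) \<Rightarrow> nat \<Rightarrow> 'a poly" where
  "inhom v m = nonlin_op d (pert_f v) (pert_h v) m (base_H m)"

definition dsol :: "(nat \<Rightarrow> 'a::field_char_0) \<Rightarrow> nat \<Rightarrow> 'a poly" where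
  "dsol v = variation p q d base_f (inhom v)"

text \<open>The coefficient of (x^q y^p)^(dk) in the derivative of the formal solution. The linear
  part contributes nothing there, so the coefficient of \<open>sol\<close> in the same place cannot
  cancel it.\<close>

definition obstr :: "nat \<Rightarrow> (nat \<Rightarrow> 'a::field_char_0) \<Rightarrow> 'a" where
  "obstr k \<eta> = coeff (nonlin_op d (base_f + pert_f \<eta>) (pert_h \<eta>) ((p + q) * k - 1)
     (sol \<eta> ((p + q) * k - 1))) (p * d * k)"

definition dobstr :: "nat \<Rightarrow> (nat \<Rightarrow> 'a::field_char_0) \<Rightarrow> 'a" where
  "dobstr k v = coeff (nonlin_op d base_f 0 ((p + q) * k - 1) (dsol v ((p + q) * k - 1)) +
     inhom v ((p + q) * k - 1)) (p * d * k)"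

lemma coeff_pert_h: "coeff (pert_h \<eta>) i = (if i \<in> pert_index then \<eta> i else 0)"
proof -
  have "coeff (pert_h \<eta>) i = (\<Sum>k\<in>pert_index. if k = i then \<eta> i else 0)"
    unfolding pert_h_def coeff_sum by (intro sum.cong) auto
  then show ?thesis by (simp add: pert_index_def)
qed

lemma coeff_pert_f: "coeff (pert_f \<eta>) i = (if i = d + 1 then - \<eta> (d + 2) else 0)"
  by (simp add: pert_f_def)

lemma pert_zero: "pert_h (\<lambda>_. 0) = 0" "pert_f (\<lambda>_. 0) = 0"
  by (simp_all add: pert_h_def pert_f_def)

lemma degree_pert_h: "degree (pert_h \<eta>) \<le> d + 2"
  by (rule degree_le) (simp add: coeff_pert_h pert_index_def)

lemma degree_pert_f: "degree (pert_f \<eta>) \<le> d + 1"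
  by (rule degree_le) (simp add: coeff_pert_f)

lemma degree_shape: "degree (shape :: 'a::field_char_0 poly) \<le> d - 1"
  unfolding shape_def using degree_power_le[of "[:1, 1:] :: 'a poly" "d - 1"] by simp

lemma coeff_base_f_eq_0: "i > d \<Longrightarrow> coeff (base_f :: 'a::field_char_0 poly) i = 0"
proof -
  assume i: "i > d"
  have "coeff (shape :: 'a poly) i = 0" using degree_shape[where 'a = 'a] i by (intro coeff_eq_0) simp
  then show ?thesis
    by (simp only: base_f_def bernoulli_poly_def coeff_diff coeff_smult coeff_pCons_0_pderiv) simp
qed

lemma degree_base_f: "degree (base_f :: 'a::field_char_0 poly) \<le> d + 1"
  by (rule degree_le) (simp add: coeff_base_f_eq_0)

lemma coeff_pert_top: "coeff (pert_h \<eta>) (d + 2) = - coeff (pert_f \<eta>) (d + 1)"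
    "coeff (pert_h \<eta>) (d + 2) = - coeff (base_f + pert_f \<eta>) (d + 1)"
  by (simp_all add: coeff_pert_h coeff_pert_f coeff_base_f_eq_0 pert_index_def)

lemma degree_total_f: "degree (base_f + pert_f \<eta>) \<le> d + 1"
  by (intro degree_add_le degree_base_f degree_pert_f)

lemma degree_total_g: "degree (pert_h \<eta> + pCons 0 (base_f + pert_f \<eta>)) \<le> d + 1"
proof (rule degree_le, intro allI impI)
  fix i assume "d + 1 < i"
  then obtain i' where i': "i = Suc i'" "d + 1 \<le> i'" by (cases i) auto
  show "coeff (pert_h \<eta> + pCons 0 (base_f + pert_f \<eta>)) i = 0"
  proof (cases "i' = d + 1")
    case True
    then show ?thesis using coeff_pert_top(2)[of \<eta>] i' by simp
  next
    case False
    then show ?thesis using i' by (simp add: coeff_pert_h coeff_pert_f coeff_base_f_eq_0 pert_index_def)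
  qed
qed

lemma degree_base_H: "degree (base_H m :: 'a::field_char_0 poly) \<le> d * m"
proof (cases "m < p + q")
  case False
  then obtain k where k: "m = p + q + k" using le_Suc_ex not_less by blast
  have "degree (shape ^ k * var_u ^ (p * d) :: 'a poly) \<le> (d - 1) * k + p * d"
  proof (rule order_trans[OF degree_mult_le add_mono])
    show "degree (shape ^ k :: 'a poly) \<le> (d - 1) * k"
      by (rule order_trans[OF degree_power_le]) (use degree_shape[where 'a = 'a] in \<open>simp add: mult_le_mono\<close>)
    show "degree (var_u ^ (p * d) :: 'a poly) \<le> p * d"
      by (rule order_trans[OF degree_power_le]) (simp add: var_u_def)
  qed
  also have "\<dots> \<le> d * k + p * d" by (intro add_mono mult_le_mono) simp_all
  also have "\<dots> \<le> d * m" by (simp add: k algebra_simps)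
  finally have "degree (shape ^ k * var_u ^ (p * d) :: 'a poly) \<le> d * m" .
  then show ?thesis
    using False by (simp add: base_H_def base_integral_def k of_nat_mult_conv_smult order_trans[OF degree_smult_le])
qed (simp add: base_H_def base_integral_def)

lemma base_H_eq_0: "m < p + q \<Longrightarrow> base_H m = 0"
  by (simp add: base_H_def base_integral_def)

lemma base_H_eqn: "lin_op p q d (Suc m) (base_H (Suc m)) + nonlin_op d base_f 0 m (base_H m) = 0"
  unfolding base_H_def base_f_def by (rule base_integral_eqn) (use d pq in simp_all)

text \<open>Since p + q is coprime to p and to d, it must divide m. Hence resonances occur only at
  every (p + q)-th power of \<rho>.\<close>

lemma res_index_iff: "res_index p q d m i \<longleftrightarrow> (\<exists>k. m = (p + q) * k \<and> i = p * d * k)"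
proof
  assume *: "res_index p q d m i"
  have "coprime (p + q) p" using pq(3) by (simp add: coprime_iff_gcd_eq_1 gcd.commute)
  then have "coprime (p + q) (p * d)" using cop by (simp add: coprime_commute)
  moreover have "p + q dvd p * d * m" using * by (simp add: res_index_def)
  ultimately have "p + q dvd m" by (simp add: coprime_dvd_mult_right_iff)
  then obtain k where k: "m = (p + q) * k" ..
  with * pq have "i = p * d * k" by (simp add: res_index_def)
  with k show "\<exists>k. m = (p + q) * k \<and> i = p * d * k" by blast
qed (auto simp: res_index_def)

lemma sol_0: "sol (\<lambda>_. 0) m = (base_H m :: 'a::field_char_0 poly)"
proof (induction m)
  case 0
  then show ?case using pq by (simp add: sol_def base_H_eq_0)
next
  case (Suc m)
  show ?case
  proof (rule poly_eqI)
    fix i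
    have "coeff (lin_op p q d (Suc m) (base_H (Suc m)) + nonlin_op d base_f 0 m (base_H m)) i = (0 :: 'a)"
      unfolding base_H_eqn by simp
    then have eq: "eig p q d (Suc m) i * coeff (base_H (Suc m)) i = (- coeff (nonlin_op d base_f 0 m (base_H m)) i :: 'a)"
      unfolding coeff_add coeff_lin_op eig_def by (simp add: eq_neg_iff_add_eq_0)
    show "coeff (sol (\<lambda>_. 0) (Suc m)) i = coeff (base_H (Suc m) :: 'a poly) i"
    proof (cases "i > d * Suc m")
      case True
      then have "coeff (base_H (Suc m) :: 'a poly) i = 0"
        using degree_base_H[of "Suc m", where 'a = 'a] by (intro coeff_eq_0) simp
      then show ?thesis using True unfolding sol_def coeff_graded_solution_Suc by simp
    next
      case False
      have IH: "graded_solution p q d base_H (base_f + pert_f (\<lambda>_. 0)) (pert_h (\<lambda>_. 0)) m = (base_H m :: 'a poly)"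
        using Suc unfolding sol_def .
      show ?thesis
      proof (cases "res_index p q d (Suc m) i")
        case True
        then show ?thesis using False unfolding sol_def coeff_graded_solution_Suc by simp
      next
        case nres: False
        then have "eig p q d (Suc m) i \<noteq> (0 :: 'a)" by (simp add: eig_eq_0_iff)
        then have "coeff (base_H (Suc m)) i = (- coeff (nonlin_op d base_f 0 m (base_H m)) i / eig p q d (Suc m) i :: 'a)"
          unfolding eq[symmetric] by simp
        then show ?thesis
          using False nres unfolding sol_def coeff_graded_solution_Suc IH unfolding pert_zero by simp
      qed
    qed
  qed
qed

lemma strict_deriv_pert:
  "strict_deriv (\<lambda>\<eta>. coeff (base_f + pert_f \<eta>) k) (\<lambda>v. coeff (pert_f v) k)"
  "strict_deriv (\<lambda>\<eta>. coeff (pert_h \<eta>) k) (\<lambda>v. coeff (pert_h v) k)"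
proof -
  have "strict_deriv (\<lambda>\<eta>. coeff (pert_f \<eta>) k) (\<lambda>v. coeff (pert_f v) k)"
    using strict_deriv_cmult[OF strict_deriv_coord[of "d + 2"], of "- 1"] strict_deriv_const[of 0]
    by (cases "k = d + 1") (simp_all add: coeff_pert_f)
  from strict_deriv_add[OF strict_deriv_const[of "coeff base_f k"] this]
  show "strict_deriv (\<lambda>\<eta>. coeff (base_f + pert_f \<eta>) k) (\<lambda>v. coeff (pert_f v) k)" by simp
  show "strict_deriv (\<lambda>\<eta>. coeff (pert_h \<eta>) k) (\<lambda>v. coeff (pert_h v) k)"
    using strict_deriv_coord[of k] strict_deriv_const[of 0]
    by (cases "k \<in> pert_index") (simp_all add: coeff_pert_h)
qed

lemma strict_deriv_nonlin:
  assumes "\<And>i. strict_deriv (\<lambda>\<eta> :: nat \<Rightarrow> 'a::real_normed_field. coeff (sol \<eta> m) i) (\<lambda>v. coeff (dsol v m) i)"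
  shows "strict_deriv (\<lambda>\<eta> :: nat \<Rightarrow> 'a. coeff (nonlin_op d (base_f + pert_f \<eta>) (pert_h \<eta>) m (sol \<eta> m)) i)
    (\<lambda>v. coeff (nonlin_op d base_f 0 m (dsol v m) + inhom v m) i)"
proof -
  have "strict_deriv (\<lambda>\<eta> :: nat \<Rightarrow> 'a. coeff (nonlin_op d (base_f + pert_f \<eta>) (pert_h \<eta>) m (sol \<eta> m)) i)
    (\<lambda>v. of_nat (d * m) * (\<Sum>k\<le>i. coeff (base_f + pert_f (\<lambda>_. 0)) k * coeff (dsol v m) (i - k) +
         coeff (sol (\<lambda>_. 0) m) (i - k) * coeff (pert_f v) k) +
      (\<Sum>k\<le>i. coeff (pert_h (\<lambda>_. 0)) k * (of_nat (Suc (i - k)) * coeff (dsol v m) (Suc (i - k))) +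
         (of_nat (Suc (i - k)) * coeff (sol (\<lambda>_. 0) m) (Suc (i - k))) * coeff (pert_h v) k))"
    unfolding coeff_nonlin_op
    by (intro strict_deriv_add strict_deriv_cmult strict_deriv_sum strict_deriv_mult strict_deriv_pert assms)
  moreover have "of_nat (d * m) * (\<Sum>k\<le>i. coeff (base_f + pert_f (\<lambda>_. 0)) k * coeff (dsol v m) (i - k) +
         coeff (sol (\<lambda>_. 0) m) (i - k) * coeff (pert_f v) k) +
      (\<Sum>k\<le>i. coeff (pert_h (\<lambda>_. 0)) k * (of_nat (Suc (i - k)) * coeff (dsol v m) (Suc (i - k))) +
         (of_nat (Suc (i - k)) * coeff (sol (\<lambda>_. 0) m) (Suc (i - k))) * coeff (pert_h v) k) =
      coeff (nonlin_op d base_f 0 m (dsol v m) + inhom v m) i" for v :: "nat \<Rightarrow> 'a"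
    unfolding inhom_def coeff_add coeff_nonlin_op pert_zero sol_0
    by (simp add: sum.distrib distrib_left mult_ac)
  ultimately show ?thesis by simp
qed

lemma strict_deriv_sol:
  "strict_deriv (\<lambda>\<eta> :: nat \<Rightarrow> 'a::real_normed_field. coeff (sol \<eta> m) i) (\<lambda>v. coeff (dsol v m) i)"
proof (induction m arbitrary: i)
  case 0
  then show ?case by (simp add: sol_def dsol_def strict_deriv_const)
next
  case (Suc m)
  let ?c = "\<lambda>i. - 1 / eig p q d (Suc m) i :: 'a"
  have *: "strict_deriv (\<lambda>\<eta>. ?c i * coeff (nonlin_op d (base_f + pert_f \<eta>) (pert_h \<eta>) m (sol \<eta> m)) i)
    (\<lambda>v. ?c i * coeff (nonlin_op d base_f 0 m (dsol v m) + inhom v m) i)"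
    by (rule strict_deriv_cmult[OF strict_deriv_nonlin[OF Suc]])
  consider "i > d * Suc m" | "\<not> i > d * Suc m" "res_index p q d (Suc m) i" | "\<not> i > d * Suc m" "\<not> res_index p q d (Suc m) i"
    by blast
  then show ?case
  proof cases
    case 1
    then show ?thesis
      using strict_deriv_const[of 0] unfolding sol_def dsol_def coeff_graded_solution_Suc coeff_variation_Suc by simp
  next
    case 2
    then show ?thesis
      using strict_deriv_const[of "coeff (base_H (Suc m)) i"]
      unfolding sol_def dsol_def coeff_graded_solution_Suc coeff_variation_Suc by simp
  next
    case 3
    have "coeff (sol \<eta> (Suc m)) i = ?c i * coeff (nonlin_op d (base_f + pert_f \<eta>) (pert_h \<eta>) m (sol \<eta> m)) i"
      for \<eta> :: "nat \<Rightarrow> 'a"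
      using 3 unfolding sol_def coeff_graded_solution_Suc by simp
    moreover have "coeff (dsol v (Suc m)) i = ?c i * coeff (nonlin_op d base_f 0 m (dsol v m) + inhom v m) i"
      for v :: "nat \<Rightarrow> 'a"
      using 3 unfolding dsol_def coeff_variation_Suc by (simp add: add_divide_distrib diff_divide_distrib)
    ultimately show ?thesis using * by (simp only:)
  qed
qed

lemma strict_deriv_obstr: "strict_deriv (obstr k :: (nat \<Rightarrow> 'a::real_normed_field) \<Rightarrow> 'a) (dobstr k)"
  using strict_deriv_nonlin[OF strict_deriv_sol, of "(p + q) * k - 1" "p * d * k", where 'a = 'a]
  unfolding obstr_def dobstr_def .

lemma obstr_0: "obstr k (\<lambda>_. 0 :: 'a::field_char_0) = 0"
proof (cases "k = 0")
  case True
  then show ?thesis using sol_0[of 0, where 'a = 'a] pq by (simp add: obstr_def base_H_eq_0)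
next
  case False
  then obtain m where m: "(p + q) * k = Suc m" using pq by (cases "(p + q) * k") auto
  have "p * d * Suc m = (p + q) * (p * d * k)" unfolding m[symmetric] by simp
  then have "eig p q d (Suc m) (p * d * k) = (0 :: 'a)" by (simp add: eig_eq_0_iff res_index_def)
  moreover have "coeff (lin_op p q d (Suc m) (base_H (Suc m)) + nonlin_op d base_f 0 m (base_H m)) (p * d * k) = (0 :: 'a)"
    unfolding base_H_eqn by simp
  ultimately show ?thesis
    unfolding coeff_add coeff_lin_op eig_def[symmetric] obstr_def m diff_Suc_1 sol_0 pert_zero by simp
qed

lemma sol_eq_0: "m < p + q \<Longrightarrow> sol \<eta> m = 0"
proof (induction m)
  case (Suc m)
  show ?case
    by (rule poly_eqI) (use Suc in \<open>simp add: sol_def coeff_graded_solution_Suc base_H_eq_0 del: graded_solution.simps\<close>)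
qed (simp add: sol_def)

lemma dsol_eq_0: "m < p + q \<Longrightarrow> dsol v m = 0"
proof (induction m)
  case (Suc m)
  show ?case
    by (rule poly_eqI) (use Suc in \<open>simp add: dsol_def coeff_variation_Suc inhom_def base_H_eq_0 del: variation.simps\<close>)
qed (simp add: dsol_def)

text \<open>Vanishing linearised obstructions make the linearised equation solvable through order (p
  + q)(d + 3). The obstruction k = 1 is absent from the premise: \<open>dsol\<close> and
  \<open>base_H\<close> vanish below order p + q.\<close>

lemma dsol_eqn:
  fixes v :: "nat \<Rightarrow> 'a::field_char_0"
  assumes v: "\<And>k. k \<in> {2..d + 3} \<Longrightarrow> dobstr k v = 0" and m: "Suc m \<le> (p + q) * (d + 3)"
  shows "lin_op p q d (Suc m) (dsol v (Suc m)) + nonlin_op d base_f 0 m (dsol v m) = - inhom v m"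
proof (rule poly_eqI)
  fix i
  let ?N = "nonlin_op d base_f 0 m (dsol v m) + inhom v m"
  have deg: "degree ?N \<le> d * Suc m"
    unfolding inhom_def
    by (intro degree_add_le degree_nonlin_op degree_base_f degree_pert_f degree_pert_h coeff_pert_top degree_base_H)
      (simp_all add: coeff_base_f_eq_0 degree_variation dsol_def)
  have "eig p q d (Suc m) i * coeff (dsol v (Suc m)) i + coeff ?N i = 0"
  proof (cases "i > d * Suc m \<or> res_index p q d (Suc m) i")
    case True
    have "coeff ?N i = 0"
    proof (cases "res_index p q d (Suc m) i")
      case True
      then obtain k where k: "Suc m = (p + q) * k" "i = p * d * k" by (auto simp: res_index_iff)
      then have m': "m = (p + q) * k - 1" by simp
      have "k \<noteq> 0" using k by (cases k) auto
      have "k \<le> d + 3"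
        using m pq unfolding k by simp
      show ?thesis
      proof (cases "k = 1")
        case True
        then have "m < p + q" using k by simp
        then show ?thesis by (simp add: dsol_eq_0 inhom_def base_H_eq_0)
      next
        case False
        then show ?thesis
          using v[of k] \<open>k \<noteq> 0\<close> \<open>k \<le> d + 3\<close> unfolding dobstr_def m'[symmetric] k(2)[symmetric] by simp
      qed
    next
      case False
      then show ?thesis using True deg by (intro coeff_eq_0) simp
    qed
    then show ?thesis using True unfolding dsol_def coeff_variation_Suc by simp
  next
    case False
    then show ?thesis
      using eig_eq_0_iff[of p q d "Suc m" i, where 'a = 'a] unfolding dsol_def coeff_variation_Suc by simp
  qed
  then show "coeff (lin_op p q d (Suc m) (dsol v (Suc m)) + nonlin_op d base_f 0 m (dsol v m)) i = coeff (- inhom v m) i"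
    unfolding coeff_add coeff_lin_op eig_def[symmetric] coeff_minus
    by (simp add: eq_neg_iff_add_eq_0 add.assoc)
qed

text \<open>If the obstructions vanish, the inhomogeneity is in the image of the unperturbed
  derivation through the relevant order, so \<open>res_functional\<close> annihilates it. Each l =
  (p + q)(j + 1) then yields one row of the binomial system, with unknowns the weighted coefficients
  of \<open>pert_h v\<close>.\<close>

lemma dobstr_injective:
  fixes v :: "nat \<Rightarrow> 'a::field_char_0"
  assumes supp: "\<And>k. k \<notin> pert_index \<Longrightarrow> v k = 0" and v: "\<And>k. k \<in> {2..d + 3} \<Longrightarrow> dobstr k v = 0"
  shows "v = (\<lambda>_. 0)"
proof -
  define w where "w = (\<lambda>i. coeff (pert_h v) i * (of_nat ((p + q) * i) - of_nat (p + q + p * d)))"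
  have "(\<Sum>i\<le>d + 2. w i * (if i \<le> p * d * j + 1
        then of_nat (((d - 1) * ((p + q) * j - 1)) choose (p * d * j + 1 - i)) else 0)) = 0"
    if j: "j \<in> {1..d + 2}" for j
  proof -
    define l where "l = (p + q) * (j + 1)"
    define E where "E = p * d * (j + 1)"
    have l_le: "l \<le> (p + q) * (d + 3)" unfolding l_def using j by (intro mult_le_mono2) simp
    have "res_functional shape l E
       (\<lambda>m. lin_op p q d m (dsol v m) + nonlin_op d base_f 0 (m - 1) (dsol v (m - 1))) = 0"
      unfolding base_f_def
      by (rule res_functional_image_eq_0) (use d pq in \<open>simp_all add: l_def E_def algebra_simps\<close>)
    also have "res_functional shape l E
       (\<lambda>m. lin_op p q d m (dsol v m) + nonlin_op d base_f 0 (m - 1) (dsol v (m - 1))) =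
       - res_functional shape l E (\<lambda>m. inhom v (m - 1))"
      unfolding res_functional_def coeff_minus[symmetric] sum_negf[symmetric]
    proof (intro arg_cong2[where f = coeff] sum.cong refl)
      fix t assume "t \<in> {..<l}"
      then have "Suc t \<le> (p + q) * (d + 3)" using l_le by simp
      from dsol_eqn[OF v this]
      show "of_nat (l - 1 choose t) * ((-1) ^ t * (shape ^ (l - 1 - t) *
          (lin_op p q d (Suc t) (dsol v (Suc t)) + nonlin_op d base_f 0 (Suc t - 1) (dsol v (Suc t - 1))))) =
        - (of_nat (l - 1 choose t) * ((-1) ^ t * (shape ^ (l - 1 - t) * inhom v (Suc t - 1))))"
        by simp
    qed
    finally have "res_functional shape l E (\<lambda>m. inhom v (m - 1)) = 0" by simp
    moreover have "res_functional shape l E (\<lambda>m. inhom v (m - 1)) = (-1) ^ (p + q) *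
        coeff (pert_h v * (of_nat (p * d) * (shape ^ ((p + q) * j - 1) * var_u ^ (p * d - 1)) -
          of_nat (p + q) * (shape ^ ((p + q) * j - 2) * pderiv shape * var_u ^ (p * d)))) E"
      unfolding inhom_def base_H_def
      by (rule res_functional_perturbation) (use d pq j in \<open>simp_all add: l_def\<close>)
    ultimately have "coeff (pert_h v * (of_nat (p * d) * (shape ^ ((p + q) * j - 1) * var_u ^ (p * d - 1)) -
          of_nat (p + q) * (shape ^ ((p + q) * j - 2) * pderiv shape * var_u ^ (p * d)))) E = 0"
      by simp
    then have "(\<Sum>i\<le>p * d * j + 1. coeff (pert_h v) i * (of_nat ((p + q) * i) - of_nat (p + q + p * d)) *
       coeff (shape ^ ((p + q) * j - 1)) (p * d * j + 1 - i)) = 0"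
      using perturbation_coeff[of d p q j "pert_h v" shape] d pq j by (simp only: E_def) simp
    moreover have coef: "coeff (shape ^ ((p + q) * j - 1)) k = (of_nat (((d - 1) * ((p + q) * j - 1)) choose k) :: 'a)" for k
    proof (cases "k \<le> (d - 1) * ((p + q) * j - 1)")
      case True
      then show ?thesis unfolding shape_def power_mult[symmetric] by (simp add: coeff_linear_poly_power)
    next
      case False
      have "degree ([:1, 1:] ^ ((d - 1) * ((p + q) * j - 1)) :: 'a poly) \<le> (d - 1) * ((p + q) * j - 1)"
        using degree_power_le[of "[:1, 1:] :: 'a poly"] by simp
      then show ?thesis using False
        unfolding shape_def power_mult[symmetric] by (simp add: coeff_eq_0 binomial_eq_0)
    qed
    ultimately have "(\<Sum>i\<le>p * d * j + 1. w i * of_nat (((d - 1) * ((p + q) * j - 1)) choose (p * d * j + 1 - i))) = 0"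
      unfolding w_def by (simp only: coef)
    also have "(\<Sum>i\<le>p * d * j + 1. w i * of_nat (((d - 1) * ((p + q) * j - 1)) choose (p * d * j + 1 - i))) =
      (\<Sum>i\<le>p * d * j + 1 + (d + 2). w i * (if i \<le> p * d * j + 1
        then of_nat (((d - 1) * ((p + q) * j - 1)) choose (p * d * j + 1 - i)) else 0))"
      by (intro sum.mono_neutral_cong_left) auto
    also have "\<dots> = (\<Sum>i\<le>d + 2. w i * (if i \<le> p * d * j + 1
        then of_nat (((d - 1) * ((p + q) * j - 1)) choose (p * d * j + 1 - i)) else 0))"
      by (intro sum.mono_neutral_right) (auto simp: w_def coeff_pert_h pert_index_def)
    finally show ?thesis .
  qed
  moreover have "w 1 = 0" by (simp add: w_def coeff_pert_h pert_index_def)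
  ultimately have w0: "w k = 0" if "k \<le> d + 2" for k
    using binomial_rows_injective[OF d pq(1,2) cop tau _ _ that, of w] by blast
  show ?thesis
  proof
    fix k
    show "v k = 0"
    proof (cases "k \<in> pert_index")
      case True
      \<comment> \<open>The weight in \<open>w\<close> never vanishes, as p + q is coprime to p d;
        hence w = 0 implies v = 0.\<close>
      have "(p + q) * k \<noteq> p + q + p * d"
      proof
        assume *: "(p + q) * k = p + q + p * d"
        then have "p + q dvd (p + q) + p * d" by (metis dvd_triv_left)
        then have "p + q dvd p * d" by simp
        moreover have "coprime (p + q) p" using pq(3) by (simp add: coprime_iff_gcd_eq_1 gcd.commute)
        then have "coprime (p + q) (p * d)" using cop by (simp add: coprime_commute)
        ultimately have "p + q dvd 1"
          using coprime_common_divisor[of "p + q" "p * d" "p + q"] by simp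
        then show False using pq by simp
      qed
      then have "of_nat ((p + q) * k) - of_nat (p + q + p * d) \<noteq> (0 :: 'a)"
        by (simp only: right_minus_eq of_nat_eq_iff not_False_eq_True)
      then show ?thesis
        using w0[of k] True by (simp add: w_def coeff_pert_h pert_index_def del: of_nat_mult of_nat_add)
    qed (rule supp)
  qed
qed

lemma homogeneous_saddle_order:
  "\<exists>P Q :: 'a::{real_normed_field, banach} poly poly. nonlinear_poly (d + 1) P \<and> nonlinear_poly (d + 1) Q \<and>
     has_saddle_order p q P Q (d * (d + 2))"
proof -
  \<comment> \<open>All obstructions up to index d + 2 are made 0, and the one of index d + 3 is
    made nonzero.\<close>
  have "\<exists>\<eta> s. s \<noteq> 0 \<and> (\<forall>k. k \<notin> pert_index \<longrightarrow> \<eta> k = 0) \<and>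
      (\<forall>k\<in>{2..d + 3}. obstr k \<eta> = (if k = d + 3 then s else 0 :: 'a))"
  proof (rule strict_deriv_local_solution[where L = dobstr])
    show "finite pert_index" "finite {2..d + 3}" "card {2..d + 3} = card pert_index" "d + 3 \<in> {2..d + 3}"
      by (simp_all add: pert_index_def)
  qed (rule strict_deriv_obstr obstr_0 dobstr_injective; assumption?)+
  then obtain \<eta> and s :: 'a where s: "s \<noteq> 0"
    and obstr: "\<And>k. k \<in> {2..d + 3} \<Longrightarrow> obstr k \<eta> = (if k = d + 3 then s else 0)"
    by blast
  let ?f = "base_f + pert_f \<eta>" and ?h = "pert_h \<eta>"
  let ?P = "homog_poly (d + 1) ?f" and ?Q = "homog_poly (d + 1) (?h + pCons 0 ?f)"
  let ?H = "fps2_of_graded d (sol \<eta>)"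
  have c: "0 < p + q" using pq by simp
  have nonlin: "nonlinear_poly (d + 1) ?P" "nonlinear_poly (d + 1) ?Q"
    using d by (auto intro!: nonlinear_homog_poly)
  have dotH: "dot p q ?P ?Q ?H = fps2_of_graded d (graded_dot p q d ?f ?h (sol \<eta>))"
  proof -
    have "dot p q ?P ?Q (fps2_of_graded (d + 1 - 1) (sol \<eta>)) =
        fps2_of_graded (d + 1 - 1) (graded_dot p q (d + 1 - 1) ?f ?h (sol \<eta>))"
    proof (rule dot_fps2_of_graded[OF _ degree_total_f degree_total_g])
      show "2 \<le> d + 1" using d by simp
      show "degree (sol \<eta> m) \<le> (d + 1 - 1) * m" for m
        unfolding sol_def add_diff_cancel_right' by (rule degree_graded_solution)
    qed
    then show ?thesis by (simp only: add_diff_cancel_right')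
  qed
  \<comment> \<open>The solution starts with \<rho>^(p+q) u^(pd) = (x^q y^p)^d, so M = d; its
    derivative will start at index d (d + 3), and the difference d (d + 2) is the saddle
    order.\<close>
  have "lead p q (d * 1) 1 ?H"
  proof (rule lead_fps2_of_graded)
    show "0 < d" using d by simp
    fix m j assume m: "m \<le> (p + q) * 1" and j: "j \<le> d * m"
    show "coeff (sol \<eta> m) j = (if m = (p + q) * 1 \<and> j = p * d * 1 then 1 else 0)"
    proof (cases "m = p + q")
      case True
      then have "m \<noteq> 0" using c by simp
      then obtain m' where m': "m = Suc m'" by (cases m) auto
      have B: "base_H (p + q) = (var_u ^ (p * d) :: 'a poly)" using c by (simp add: base_H_def base_integral_def)
      have "coeff (var_u ^ (p * d) :: 'a poly) j = (if j = p * d then 1 else 0)"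
        using coeff_mult_var_u_power[of 1 "p * d" j] by (auto simp: coeff_1)
      moreover have "res_index p q d m j \<longleftrightarrow> j = p * d" using True c by (auto simp: res_index_def)
      moreover have "sol \<eta> m' = 0" using True m' by (intro sol_eq_0) simp
      ultimately have "coeff (sol \<eta> m) j = (if j = p * d then 1 else 0)"
        using True j B unfolding sol_def m' coeff_graded_solution_Suc
        by (auto simp: m'[symmetric] simp del: mult_Suc_right)
      then show ?thesis using True by simp
    next
      case False
      then show ?thesis using m by (simp add: sol_eq_0)
    qed
  qed
  moreover have "lead p q (d * (d + 3)) s (dot p q ?P ?Q ?H)"
    unfolding dotH
  proof (rule lead_fps2_of_graded)
    show "0 < d" using d by simp
    fix m j assume m: "m \<le> (p + q) * (d + 3)" and j: "j \<le> d * m"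
    show "coeff (graded_dot p q d ?f ?h (sol \<eta>) m) j = (if m = (p + q) * (d + 3) \<and> j = p * d * (d + 3) then s else 0)"
    proof (cases m)
      case 0
      then show ?thesis using pq by (simp add: graded_dot_def sol_def coeff_lin_op)
    next
      case (Suc m')
      have gd: "coeff (graded_dot p q d ?f ?h (sol \<eta>) m) j = (if res_index p q d m j
          then coeff (nonlin_op d ?f ?h m' (sol \<eta> m')) j else 0)"
        unfolding Suc sol_def
        by (rule coeff_graded_dot_solution[OF degree_total_f degree_pert_h coeff_pert_top(2)])
      show ?thesis
      proof (cases "res_index p q d m j")
        case True
        then obtain k where k: "m = (p + q) * k" "j = p * d * k" by (auto simp: res_index_iff)
        have "k \<noteq> 0" using k Suc by (cases k) auto
        have "k \<le> d + 3" using m pq unfolding k by simp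
        have m': "m' = (p + q) * k - 1" using k Suc by simp
        have val: "coeff (nonlin_op d ?f ?h m' (sol \<eta> m')) j = obstr k \<eta>"
          unfolding obstr_def m' k ..
        have "obstr k \<eta> = (if k = d + 3 then s else 0)"
        proof (cases "k = 1")
          case True
          then have "m' < p + q" using k Suc by simp
          then show ?thesis using True val[symmetric] by (simp add: sol_eq_0)
        qed (use \<open>k \<noteq> 0\<close> \<open>k \<le> d + 3\<close> obstr[of k] in simp)
        moreover have "m = (p + q) * (d + 3) \<and> j = p * d * (d + 3) \<longleftrightarrow> k = d + 3"
          unfolding k using c by auto
        ultimately show ?thesis unfolding gd val using True by simp
      next
        case False
        then have "\<not> (m = (p + q) * (d + 3) \<and> j = p * d * (d + 3))" by (auto simp: res_index_iff)
        with False show ?thesis unfolding gd by (simp only: if_False)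
      qed
    qed
  qed
  moreover have "d * (d + 3) = d * (d + 2) + d" by (simp add: algebra_simps)
  ultimately have "has_saddle_order p q ?P ?Q (d * (d + 2))"
    using d s by (intro has_saddle_orderI[OF pq nonlin, of d _ ?H s]) simp_all
  with nonlin show ?thesis by blast
qed

end

text \<open>With N = n - r and d = N - 1 the bound is N^2 - 1 = d (d + 2), and a system of degree at
  most N also has degree at most n. The threshold on n ensures d \<ge> 3, whence p + q \<le> 2 q < q
  d.\<close>

lemma max_saddle_order_ge:
  assumes pq: "0 < p" "p \<le> q" "coprime p q" and n: "p + q + 4 \<le> n"
    and r: "r \<le> p + q - 1" "r mod (p + q) = n mod (p + q)"
  shows "max_saddle_order TYPE('a::{real_normed_field, banach}) p q n
    \<ge> enat (nat ((int n)\<^sup>2 - 2 * int r * int n + (int r)\<^sup>2 - 1))"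
proof -
  have r': "r = n mod (p + q)" using r pq by simp
  then have rn: "r \<le> n" by simp
  have "r < p + q" using r pq by simp
  define N where "N = n - r"
  have N: "4 \<le> N" "p + q dvd N" using n \<open>r < p + q\<close> r' by (simp_all add: N_def dvd_minus_mod)
  obtain d where d: "N = Suc d" using N by (cases N) auto
  have "3 \<le> d" using N d by simp
  \<comment> \<open>Consecutive numbers are coprime, so d is coprime to N and hence to its divisor p
    + q.\<close>
  have "coprime d N" unfolding d by (rule coprime_Suc_right_nat)
  then have cop: "coprime d (p + q)" using N(2) by (rule coprime_divisors[OF dvd_refl, rotated])
  have "p + q \<le> q * 2" using pq by simp
  also have "\<dots> < q * d" using pq \<open>3 \<le> d\<close> by (intro mult_strict_left_mono) simp_all
  finally have tau: "p + q < q * d" .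
  obtain P Q :: "'a poly poly" where PQ: "nonlinear_poly N P" "nonlinear_poly N Q" "has_saddle_order p q P Q (d * (d + 2))"
    using homogeneous_saddle_order[OF pq(1) _ pq(3) _ cop tau, where 'a = 'a] pq \<open>3 \<le> d\<close> d by auto
  have "nonlinear_poly n P" "nonlinear_poly n Q"
    using PQ(1,2) by (fastforce simp: nonlinear_poly_def N_def)+
  with PQ(3) have "enat (d * (d + 2)) \<le> max_saddle_order TYPE('a) p q n"
    unfolding max_saddle_order_def by (intro Sup_upper) blast
  moreover have "nat ((int n)\<^sup>2 - 2 * int r * int n + (int r)\<^sup>2 - 1) = d * (d + 2)"
  proof -
    have "int n = int (Suc d) + int r" using d rn by (simp add: N_def)
    then have "(int n)\<^sup>2 - 2 * int r * int n + (int r)\<^sup>2 - 1 = int (d * (d + 2))"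
      by (simp add: power2_eq_square algebra_simps)
    then show ?thesis by (simp only: nat_int)
  qed
  ultimately show ?thesis by simp
qed

theorem theorem2:
  fixes p q :: nat
  assumes "0 < p" and "p \<le> q" and "coprime p q"
  shows
    "(\<forall>\<^sub>F n in sequentially. \<forall>r. r \<le> p + q - 1 \<and> r mod (p + q) = n mod (p + q) \<longrightarrow>
        max_saddle_order TYPE(real) p q n
          \<ge> enat (nat ((int n)\<^sup>2 - 2 * int r * int n + (int r)\<^sup>2 - 1))) \<and>
     (\<forall>\<^sub>F n in sequentially. \<forall>r. r \<le> p + q - 1 \<and> r mod (p + q) = n mod (p + q) \<longrightarrow>
        max_saddle_order TYPE(complex) p q n
          \<ge> enat (nat ((int n)\<^sup>2 - 2 * int r * int n + (int r)\<^sup>2 - 1)))"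
  by (intro conjI eventually_sequentiallyI[of "p + q + 4"] allI impI max_saddle_order_ge assms)
    (elim conjE, assumption)+

end
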